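(* Let $\mathbf f={}^t(f_1(z),\dots,f_n(z))\in\overline{\mathbb{Q}}[[z]]^n$ satisfy $\mathbf f'=G\mathbf f$ with $G\in M_n(\overline{\mathbb{Q}}(z))$. If $f_i(z)$ is a $G$-function for every $i\in\{1,\dots,n\}$ and the family $(f_1(z),\dots,f_n(z))$ is linearly independent over $\overline{\mathbb{Q}}(z)$, then $G$ satisfies the Galochkin condition.
   Context: **$G$-function.** A series $f(z)=\sum_{n\ge0}a_nz^n\in\overline{\mathbb{Q}}[[z]]$ such that (a) $f$ satisfies a nonzero linear differential equation with coefficients in $\overline{\mathbb{Q}}(z)$; (b) there is $C_1>0$ such that for all $n$, every Galois conjugate of $a_n$ has absolute value at most $C_1^{n+1}$; (c) there is $C_2>0$ such that for all $n$, the least integer $d\ge1$ for which $da_0,\dots,da_n$ are algebraic integers satisfies $d\le C_2^{n+1}$. **Galochkin condition.** Put $G_0=I_n$ and $G_{s+1}=G_sG+G_s'$ (entrywise derivative), so that $y'=Gy$ implies $y^{(s)}=G_sy$. Let $T(z)\in\overline{\mathbb{Q}}[z]$ be a least common denominator of the entries of $G$ (then $T^sG_s$ has polynomial entries). For $s\in\mathbb{N}$ let $q_s\ge1$ be the least positive integer $q$ such that $q$ times every coefficient of every entry of $T^m\frac{G_m}{m!}$, $1\le m\le s$, is an algebraic integer. $G$ (or the system $y'=Gy$) satisfies the Galochkin condition if there is $C>0$ with $q_s\le C^{s+1}$ for all $s\in\mathbb{N}$. *)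

theory Defs
  imports
    "HOL-Analysis.Analysis"
    "HOL-Computational_Algebra.Computational_Algebra"
begin

unbundle no fps_syntax

text \<open>
  The field of algebraic numbers is the set of algebraic elements of \<^typ>\<open>complex\<close>. Rational functions
  over it are identified with their Laurent expansions at 0, i.e. its rational function field is
  realised as a subfield of the field \<^typ>\<open>complex fls\<close> of formal Laurent series (poles at 0
  are allowed). Products of rational functions with power series and derivatives are then those of
  \<^typ>\<open>complex fls\<close>.
\<close>

definition alg_polys :: "complex poly set" where
  "alg_polys = {p. \<forall>k. algebraic (coeff p k)}"

definition fls_of_poly :: "complex poly \<Rightarrow> complex fls" where
  "fls_of_poly p = fps_to_fls (fps_of_poly p)"

definition alg_ratfuns :: "complex fls set" where
  "alg_ratfuns = {fls_of_poly p / fls_of_poly q | p q. p \<in> alg_polys \<and> q \<in> alg_polys \<and> q \<noteq> 0}"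

definition alg_fps :: "complex fps set" where
  "alg_fps = {f. \<forall>k. algebraic (fps_nth f k)}"

text \<open>Galois conjugates over the rationals: roots of a common irreducible rational polynomial.\<close>

definition galois_conjugate :: "complex \<Rightarrow> complex \<Rightarrow> bool" where
  "galois_conjugate x y \<longleftrightarrow>
     (\<exists>p :: rat poly. irreducible p \<and> poly (map_poly of_rat p) x = 0 \<and> poly (map_poly of_rat p) y = 0)"

definition solves_linear_ode :: "complex fps \<Rightarrow> bool" where
  "solves_linear_ode f \<longleftrightarrow>
     (\<exists>(r::nat) c. (\<forall>k\<le>r. c k \<in> alg_ratfuns) \<and> (\<exists>k\<le>r. c k \<noteq> 0) \<and>
        (\<Sum>k\<le>r. c k * fps_to_fls ((fps_deriv ^^ k) f)) = 0)"

definition common_den :: "complex fps \<Rightarrow> nat \<Rightarrow> nat" where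
  "common_den f n = (LEAST d. 1 \<le> d \<and> (\<forall>k\<le>n. algebraic_int (of_nat d * fps_nth f k)))"

definition G_function :: "complex fps \<Rightarrow> bool" where
  "G_function f \<longleftrightarrow>
     f \<in> alg_fps \<and>
     solves_linear_ode f \<and>
     (\<exists>C>0. \<forall>n y. galois_conjugate (fps_nth f n) y \<longrightarrow> norm y \<le> C ^ (n + 1)) \<and>
     (\<exists>C>0. \<forall>n. real (common_den f n) \<le> C ^ (n + 1))"

definition lin_indep_ratfuns :: "complex fps ^ 'n \<Rightarrow> bool" where
  "lin_indep_ratfuns f \<longleftrightarrow>
     (\<forall>c. (\<forall>i. c i \<in> alg_ratfuns) \<and> (\<Sum>i\<in>UNIV. c i * fps_to_fls (f $ i)) = 0 \<longrightarrow> (\<forall>i. c i = 0))"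

definition matrix_deriv :: "complex fls ^ 'n ^ 'm \<Rightarrow> complex fls ^ 'n ^ 'm" where
  "matrix_deriv A = (\<chi> i j. fls_deriv (A $ i $ j))"

primrec iterated_matrix :: "complex fls ^ 'n ^ 'n \<Rightarrow> nat \<Rightarrow> complex fls ^ 'n ^ 'n" where
  "iterated_matrix G 0 = mat 1"
| "iterated_matrix G (Suc s) = iterated_matrix G s ** G + matrix_deriv (iterated_matrix G s)"

definition common_denominator :: "complex poly \<Rightarrow> complex fls ^ 'n ^ 'n \<Rightarrow> bool" where
  "common_denominator T G \<longleftrightarrow>
     T \<in> alg_polys \<and> T \<noteq> 0 \<and> (\<forall>i j. fls_of_poly T * G $ i $ j \<in> fls_of_poly ` alg_polys)"

definition least_common_denominator :: "complex poly \<Rightarrow> complex fls ^ 'n ^ 'n \<Rightarrow> bool" where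
  "least_common_denominator T G \<longleftrightarrow>
     common_denominator T G \<and> (\<forall>P. common_denominator P G \<longrightarrow> T dvd P)"

text \<open>
  For a common denominator \<open>T\<close> of \<open>G\<close>, the entries of \<open>T ^ m * iterated_matrix G m / fact m\<close> are
  polynomials, so their coefficients are their Laurent coefficients.
\<close>

definition galochkin_den :: "complex poly \<Rightarrow> complex fls ^ 'n ^ 'n \<Rightarrow> nat \<Rightarrow> nat" where
  "galochkin_den T G s =
     (LEAST q. 1 \<le> q \<and> (\<forall>m\<in>{1..s}. \<forall>i j k.
        algebraic_int (of_nat q *
          fls_nth (fls_of_poly T ^ m * (iterated_matrix G m $ i $ j) / fact m) k)))"

text \<open>
  \<open>T\<close> is only unique up to a nonzero constant; the condition does not depend on its choice and is
  required for every choice. The first conjunct excludes vacuous truth.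
\<close>

definition galochkin_condition :: "complex fls ^ 'n ^ 'n \<Rightarrow> bool" where
  "galochkin_condition G \<longleftrightarrow>
     (\<exists>T. least_common_denominator T G) \<and>
     (\<forall>T. least_common_denominator T G \<longrightarrow>
        (\<exists>C>0. \<forall>s. real (galochkin_den T G s) \<le> C ^ (s + 1)))"

end

(* Idea (D. and G. Chudnovsky). Choose an integer polynomial Q of degree at most N such that Q f agrees
   with a polynomial vector P up to order N + M + 1, with M proportional to N; Siegel's lemma gives
   such a Q of size exponential in N. Applying nabla = d/dz - G to Q f - P yields the further
   approximants nabla^m P / m! of f, whose coefficients are coefficients of (T^m Q^(m) / m!) f as long
   as m is small compared with M, so that their denominators are bounded by those of f. A zero estimate
   shows that the first n of them are linearly independent. Since the s-th iterated matrix is a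
   combination of the operators D^(s-j) nabla^j, its product with the matrix of these n approximants
   has a controlled denominator; Cramer's rule, Dedekind's Prague theorem and a norm down to the
   rationals remove the determinant.

   Zero estimate: if the approximants span a proper subspace, the linear forms annihilating it are
   stable under the dual connection. Each nonzero stable subspace contains a form taking f to a solution
   of one of finitely many differential equations, and such forms have bounded orders at 0, whereas
   they annihilate P and so vanish to high order on Q f. *)

theory Submission
  imports Defs "Jordan_Normal_Form.Char_Poly"
begin

hide_const (open) Module.smult Module.module Determinant.det Matrix.mat Matrix.vec Matrix.row Matrix.vec_index
hide_fact (open) Matrix.vec_eq_iff Matrix.mat_def Determinant.det_def Determinant.det_transpose Determinant.det_rows_mul
no_notation Matrix.vec_index (infixl "$" 100)
no_notation fps_nth (infixl "$" 75)

section \<open>Algebraic integers\<close>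

lemma algebraic_int_eigenvalue:
  fixes v :: "nat \<Rightarrow> complex"
  assumes eq: "\<And>i. i < n \<Longrightarrow> x * v i = (\<Sum>j<n. of_int (a i j) * v j)"
    and nz: "i0 < n" "v i0 \<noteq> 0"
  shows "algebraic_int x"
proof -
  define A :: "int mat" where "A = Matrix.mat n n (\<lambda>(i,j). a i j)"
  define V where "V = Matrix.vec n v"
  have A: "A \<in> carrier_mat n n" by (simp add: A_def)
  let ?A = "map_mat complex_of_int A"
  have A': "?A \<in> carrier_mat n n" using A by simp
  have "eigenvector ?A V x"
    unfolding eigenvector_def
  proof (intro conjI)
    show "V \<in> carrier_vec (dim_row ?A)" using A by (simp add: V_def A_def)
    show "V \<noteq> 0\<^sub>v (dim_row ?A)"
      using nz by (metis A_def V_def carrier_matD(1) A' index_vec index_zero_vec(1))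
    show "?A *\<^sub>v V = x \<cdot>\<^sub>v V"
      by (rule eq_vecI) (use eq in \<open>auto simp: A_def V_def scalar_prod_def atLeast0LessThan\<close>)
  qed
  then have "poly (char_poly ?A) x = 0"
    using eigenvalue_root_char_poly[OF A'] unfolding eigenvalue_def by blast
  then have "poly (map_poly of_int (char_poly A)) x = 0"
    unfolding of_int_hom.char_poly_hom[OF A] .
  moreover have "lead_coeff (char_poly A) = 1"
    using degree_monic_char_poly[OF A] by simp
  ultimately show ?thesis
    unfolding algebraic_int_altdef_ipoly by blast
qed

definition zscale :: "int \<Rightarrow> complex \<Rightarrow> complex" where
  "zscale n x = of_int n * x"

interpretation zmod: Modules.module zscale
  by unfold_locales (simp_all add: zscale_def algebra_simps)

definition zstable :: "complex set \<Rightarrow> complex \<Rightarrow> bool" where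
  "zstable B x \<longleftrightarrow> (\<forall>b\<in>B. x * b \<in> zmod.span B)"

lemma zspan_image_mult: "y \<in> zmod.span B \<Longrightarrow> x * y \<in> zmod.span ((*) x ` B)"
proof (induction rule: zmod.span_induct_alt)
  case base show ?case by (simp add: zmod.span_zero)
next
  case (step c b y)
  have "x * (zscale c b + y) = zscale c (x * b) + x * y" by (simp add: zscale_def algebra_simps)
  moreover have "zscale c (x * b) \<in> zmod.span ((*) x ` B)"
    using step by (intro zmod.span_scale zmod.span_base) auto
  ultimately show ?case using step by (auto intro: zmod.span_add)
qed

lemma zstable_span: "zstable B x \<Longrightarrow> y \<in> zmod.span B \<Longrightarrow> x * y \<in> zmod.span B"
  using zspan_image_mult[of y B x] zmod.span_minimal[of "(*) x ` B" "zmod.span B"]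
  by (auto simp: zstable_def zmod.subspace_span)

lemma zstable_add: "zstable B x \<Longrightarrow> zstable B y \<Longrightarrow> zstable B (x + y)"
  by (auto simp: zstable_def distrib_right intro: zmod.span_add)

lemma zstable_mult: "zstable B x \<Longrightarrow> zstable B y \<Longrightarrow> zstable B (x * y)"
  unfolding zstable_def using zstable_span[of B x] by (auto simp: mult.assoc zstable_def)

lemma zstable_imp_algebraic_int:
  assumes fin: "finite B" and b: "b0 \<in> B" "b0 \<noteq> 0" and st: "zstable B x"
  shows "algebraic_int x"
proof -
  obtain h where h: "bij_betw h {..<card B} B"
    using fin ex_bij_betw_nat_finite[of B] by (auto simp: atLeast0LessThan)
  have "\<exists>u. x * b = (\<Sum>c\<in>B. of_int (u c) * c)" if "b \<in> B" for b
    using st that unfolding zstable_def zmod.span_finite[OF fin] zscale_def by auto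
  then obtain u where u: "\<And>b. b \<in> B \<Longrightarrow> x * b = (\<Sum>c\<in>B. of_int (u b c) * c)" by metis
  obtain i0 where i0: "i0 < card B" "h i0 = b0"
    using h b by (metis bij_betw_def imageE lessThan_iff)
  show ?thesis
  proof (rule algebraic_int_eigenvalue[where v = h and n = "card B" and a = "\<lambda>i j. u (h i) (h j)"])
    fix i assume "i < card B"
    then have "h i \<in> B" using h by (meson bij_betwE lessThan_iff)
    then have "x * h i = (\<Sum>c\<in>B. of_int (u (h i) c) * c)" by (rule u)
    also have "\<dots> = (\<Sum>j<card B. of_int (u (h i) (h j)) * h j)"
      using h by (rule sum.reindex_bij_betw[symmetric])
    finally show "x * h i = (\<Sum>j<card B. of_int (u (h i) (h j)) * h j)" .
  qed (use i0 b in auto)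
qed

text \<open>Adjoining the powers of \<open>x\<close> below the degree of a monic equation for \<open>x\<close>.\<close>

lemma zstable_adjoin:
  assumes fin: "finite B" and b: "b0 \<in> B" "b0 \<noteq> 0"
    and c: "\<And>i. i < n \<Longrightarrow> zstable B (c i)"
    and x: "x ^ n = (\<Sum>i<n. c i * x ^ i)"
  shows "\<exists>B'. finite B' \<and> (\<exists>b\<in>B'. b \<noteq> 0) \<and> zstable B' x \<and> (\<forall>y. zstable B y \<longrightarrow> zstable B' y)"
proof -
  have n: "n > 0" using x by (cases n) auto
  define B' where "B' = (\<lambda>(b,i). b * x ^ i) ` (B \<times> {..<n})"
  have sub: "y * x ^ i \<in> zmod.span B'" if "y \<in> zmod.span B" "i < n" for y i
  proof -
    have "x ^ i * y \<in> zmod.span ((*) (x ^ i) ` B)" by (rule zspan_image_mult[OF that(1)])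
    moreover have "(*) (x ^ i) ` B \<subseteq> B'" using that(2) by (auto simp: B'_def image_iff mult.commute)
    ultimately show ?thesis using zmod.span_mono by (metis mult.commute subsetD)
  qed
  have "zstable B' x"
    unfolding zstable_def
  proof
    fix b' assume "b' \<in> B'"
    then obtain b i where b': "b \<in> B" "i < n" "b' = b * x ^ i" by (auto simp: B'_def)
    show "x * b' \<in> zmod.span B'"
    proof (cases "Suc i < n")
      case True
      then show ?thesis using sub[of b "Suc i"] b' by (simp add: zmod.span_base mult_ac)
    next
      case False
      then have "Suc i = n" using b' by simp
      then have "x * b' = b * x ^ n" using b' by (auto simp: mult_ac)
      also have "\<dots> = (\<Sum>i<n. (c i * b) * x ^ i)" by (simp add: x sum_distrib_left mult_ac)
      also have "\<dots> \<in> zmod.span B'"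
        using c b' by (intro zmod.span_sum sub) (auto simp: zstable_def)
      finally show ?thesis .
    qed
  qed
  moreover have "zstable B' y" if "zstable B y" for y
    unfolding zstable_def
  proof
    fix b' assume "b' \<in> B'"
    then obtain b i where b': "b \<in> B" "i < n" "b' = b * x ^ i" by (auto simp: B'_def)
    then show "y * b' \<in> zmod.span B'" using sub[of "y * b" i] that by (auto simp: zstable_def mult_ac)
  qed
  moreover have "b0 \<in> B'" using b n by (force simp: B'_def image_iff)
  moreover have "finite B'" using fin by (auto simp: B'_def)
  ultimately show ?thesis using b by blast
qed

lemma monic_root_power:
  fixes p :: "'a::comm_ring_1 poly"
  assumes "lead_coeff p = 1" "poly p x = 0"
  shows "x ^ degree p = (\<Sum>i<degree p. - coeff p i * x ^ i)"
proof -
  have "poly p x = (\<Sum>i<degree p. coeff p i * x ^ i) + x ^ degree p"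
    using assms by (simp add: poly_altdef lessThan_Suc_atMost[symmetric])
  then show ?thesis using assms by (simp add: sum_negf eq_neg_iff_add_eq_0 add.commute)
qed

lemma zstable_of_int: "zstable B (of_int k)"
  unfolding zstable_def zscale_def[symmetric] by (auto intro: zmod.span_scale zmod.span_base)

lemma zstable_of_finite:
  assumes "finite C" "\<And>c. c \<in> C \<Longrightarrow> algebraic_int c"
  shows "\<exists>B. finite B \<and> (\<exists>b\<in>B. b \<noteq> 0) \<and> (\<forall>c\<in>C. zstable B c)"
  using assms
proof (induction C rule: finite_induct)
  case empty
  show ?case by (rule exI[of _ "{1}"]) auto
next
  case (insert x C)
  then obtain B b0 where B: "finite B" "b0 \<in> B" "b0 \<noteq> 0" "\<forall>c\<in>C. zstable B c" by blast
  obtain p where p: "lead_coeff p = 1" "\<forall>i. coeff p i \<in> \<int>" "poly p x = 0"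
    using insert.prems[of x] by (auto simp: algebraic_int.simps)
  have "zstable B (- coeff p i)" for i
    using p(2) zstable_of_int[of B] by (metis Ints_cases of_int_minus)
  with zstable_adjoin[OF B(1-3) _ monic_root_power[OF p(1,3)]] B(4)
  show ?case by blast
qed

lemma algebraic_int_root_monic:
  fixes x :: complex
  assumes "lead_coeff p = 1" "\<And>i. algebraic_int (coeff p i)" "poly p x = 0"
  shows "algebraic_int x"
proof -
  obtain B b0 where B: "finite B" "b0 \<in> B" "b0 \<noteq> 0" "\<forall>c\<in>(\<lambda>i. - coeff p i) ` {..<degree p}. zstable B c"
    using zstable_of_finite[of "(\<lambda>i. - coeff p i) ` {..<degree p}"] assms(2) by fastforce
  with zstable_adjoin[OF B(1-3) _ monic_root_power[OF assms(1,3)]]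
  show ?thesis using zstable_imp_algebraic_int by (metis image_eqI lessThan_iff)
qed

lemma algebraic_int_add [intro]:
  assumes "algebraic_int x" "algebraic_int (y::complex)"
  shows "algebraic_int (x + y)"
proof -
  from zstable_of_finite[of "{x, y}"] assms obtain B b0
    where "finite B" "b0 \<in> B" "b0 \<noteq> 0" "zstable B x" "zstable B y" by auto
  then show ?thesis using zstable_imp_algebraic_int zstable_add by blast
qed

lemma algebraic_int_mult [intro]:
  assumes "algebraic_int x" "algebraic_int (y::complex)"
  shows "algebraic_int (x * y)"
proof -
  from zstable_of_finite[of "{x, y}"] assms obtain B b0
    where "finite B" "b0 \<in> B" "b0 \<noteq> 0" "zstable B x" "zstable B y" by auto
  then show ?thesis using zstable_imp_algebraic_int zstable_mult by blast
qed

lemma algebraic_int_diff [intro]: "algebraic_int x \<Longrightarrow> algebraic_int (y::complex) \<Longrightarrow> algebraic_int (x - y)"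
  using algebraic_int_add[of x "-y"] by simp

lemma algebraic_int_sum [intro]: "(\<And>i. i \<in> I \<Longrightarrow> algebraic_int (f i :: complex)) \<Longrightarrow> algebraic_int (sum f I)"
  by (induction I rule: infinite_finite_induct) auto

lemma algebraic_int_1 [simp, intro]: "algebraic_int (1::complex)"
  by (rule int_imp_algebraic_int) simp

lemma algebraic_int_prod [intro]: "(\<And>i. i \<in> I \<Longrightarrow> algebraic_int (f i :: complex)) \<Longrightarrow> algebraic_int (prod f I)"
  by (induction I rule: infinite_finite_induct) auto

lemma algebraic_int_power [intro]: "algebraic_int (x::complex) \<Longrightarrow> algebraic_int (x ^ n)"
  by (induction n) auto

lemma algebraic_int_of_int [simp, intro]: "algebraic_int (of_int k :: complex)"
  by (rule int_imp_algebraic_int) simp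

lemma algebraic_int_of_nat [simp, intro]: "algebraic_int (of_nat k :: complex)"
  by (rule int_imp_algebraic_int) simp

lemma algebraic_int_lead_coeff_mult_root:
  fixes p :: "complex poly"
  assumes "\<And>i. algebraic_int (coeff p i)" "poly p x = 0" "p \<noteq> 0"
  shows "algebraic_int (lead_coeff p * x)"
proof -
  define n where "n = degree p"
  define a where "a = lead_coeff p"
  have a: "a \<noteq> 0" using assms by (simp add: a_def)
  have n: "n > 0"
  proof (rule ccontr)
    assume "\<not> n > 0"
    then obtain c where "p = [:c:]" unfolding n_def using degree_eq_zeroE by auto
    then show False using assms by auto
  qed
  define q where "q = Abs_poly (\<lambda>i. if i = n then 1 else if i < n then a ^ (n - 1 - i) * coeff p i else 0)"
  have cq: "coeff q i = (if i = n then 1 else if i < n then a ^ (n - 1 - i) * coeff p i else 0)" for i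
    unfolding q_def by (subst coeff_Abs_poly[of n]) auto
  have dq: "degree q = n"
    by (intro antisym degree_le le_degree) (auto simp: cq)
  have "poly q (a * x) = (\<Sum>i\<le>n. coeff q i * (a * x) ^ i)" by (simp add: poly_altdef dq)
  also have "\<dots> = (\<Sum>i\<le>n. a ^ (n - 1) * (coeff p i * x ^ i))"
  proof (rule sum.cong[OF refl])
    fix i assume "i \<in> {..n}"
    then consider "i = n" | "i < n" by fastforce
    then show "coeff q i * (a * x) ^ i = a ^ (n - 1) * (coeff p i * x ^ i)"
    proof cases
      case 1
      then show ?thesis using n by (simp add: cq power_mult_distrib a_def n_def flip: power_Suc2)
    next
      case 2
      then have "a ^ (n - 1) = a ^ (n - 1 - i) * a ^ i" by (simp flip: power_add)
      then show ?thesis using 2 by (simp add: cq power_mult_distrib)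
    qed
  qed
  also have "\<dots> = a ^ (n - 1) * poly p x"
    by (simp add: poly_altdef n_def sum_distrib_left)
  finally have "poly q (a * x) = 0" using assms by simp
  moreover have "algebraic_int (coeff q i)" for i
    using assms(1) by (auto simp: cq a_def)
  ultimately show ?thesis unfolding a_def[symmetric]
    using algebraic_int_root_monic[of q "a * x"] by (simp add: dq cq)
qed

declare mult_pCons_left [simp del]

lemma algebraic_int_coeff_linear_factor:
  fixes q :: "complex poly"
  assumes "\<And>i. algebraic_int (coeff ([:-x, 1:] * q) i)"
  shows "algebraic_int (coeff q i)"
  using assms
proof (induction "degree q" arbitrary: q i rule: less_induct)
  case less
  define h where "h = [:-x, 1:] * q"
  show ?case
  proof (cases "q = 0")
    case False
    have dh: "degree h = Suc (degree q)" "lead_coeff h = lead_coeff q"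
      unfolding h_def using False by (subst degree_mult_eq lead_coeff_mult; simp)+
    have lq: "algebraic_int (lead_coeff q)" using less.prems[of "degree h"] dh(2) by (simp add: h_def)
    have hx: "poly h x = 0" "h \<noteq> 0" using False by (simp_all add: h_def)
    have lx: "algebraic_int (lead_coeff q * x)"
      using algebraic_int_lead_coeff_mult_root[OF _ hx] less.prems dh by (simp add: h_def)
    define q' where "q' = q - monom (lead_coeff q) (degree q)"
    have eq: "[:-x, 1:] * q' = h - [:-x, 1:] * monom (lead_coeff q) (degree q)"
      by (simp add: q'_def h_def algebra_simps)
    have int: "algebraic_int (coeff ([:-x, 1:] * q') j)" for j
    proof -
      have "algebraic_int (coeff ([:-x, 1:] * monom (lead_coeff q) (degree q)) j)"
        using lq lx by (cases j) (auto simp: mult.commute mult_pCons_left)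
      then show ?thesis unfolding eq coeff_diff using less.prems[of j] by (auto simp: h_def)
    qed
    show ?thesis
    proof (cases "degree q = 0")
      case True
      then obtain c where "q = [:c:]" using degree_eq_zeroE by auto
      then show ?thesis using lq by (cases i) auto
    next
      case False
      have "degree q' < degree q"
      proof -
        have "degree q' \<le> degree q" unfolding q'_def by (intro degree_diff_le) (auto simp: degree_monom_le)
        moreover have "coeff q' (degree q) = 0" by (simp add: q'_def)
        ultimately show ?thesis using False by (metis eq_zero_or_degree_less neq0_conv degree_0)
      qed
      then have "algebraic_int (coeff q' i)" using less.hyps int by blast
      moreover have "coeff q i = coeff q' i + coeff (monom (lead_coeff q) (degree q)) i"
        by (simp add: q'_def)
      moreover have "algebraic_int (coeff (monom (lead_coeff q) (degree q)) i)" using lq by (cases "degree q = i") simp_all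
      ultimately show ?thesis by (simp add: algebraic_int_add)
    qed
  qed auto
qed

lemma algebraic_int_prod_roots:
  fixes c :: complex
  assumes "\<And>i. algebraic_int (coeff (smult c (\<Prod>x\<in>#M. [:-x, 1:])) i)" "M' \<subseteq># M"
  shows "algebraic_int (c * prod_mset M')"
proof -
  from assms(2) obtain N where "M = M' + N" by (metis subset_mset.le_iff_add)
  with assms(1) show ?thesis
  proof (induction N arbitrary: M)
    case empty
    have "poly (\<Prod>x\<in>#M'. [:-x, 1:]) 0 = prod_mset (image_mset uminus M')"
      by (simp add: poly_prod_mset image_mset.compositionality o_def)
    also have "\<dots> = (-1) ^ size M' * prod_mset M'"
      by (induction M') auto
    finally have e: "coeff (smult c (\<Prod>x\<in>#M'. [:-x, 1:])) 0 = (-1) ^ size M' * (c * prod_mset M')"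
      by (simp add: poly_0_coeff_0)
    have "(-1) ^ size M' * coeff (smult c (\<Prod>x\<in>#M'. [:-x, 1:])) 0 = c * prod_mset M'"
      unfolding e by (simp flip: power_mult_distrib mult.assoc)
    moreover have "algebraic_int ((-1) ^ size M' :: complex)" by (intro algebraic_int_power) auto
    ultimately show ?case using empty by (metis add.right_neutral algebraic_int_mult)
  next
    case (add x N)
    show ?case
    proof (rule add.IH[OF _ refl])
      fix i
      have "smult c (\<Prod>x\<in>#M. [:-x, 1:]) = [:-x, 1:] * smult c (\<Prod>x\<in>#M' + N. [:-x, 1:])"
        using add.prems by (simp add: mult_ac)
      then show "algebraic_int (coeff (smult c (\<Prod>x\<in>#M' + N. [:-x, 1:])) i)"
        using add.prems algebraic_int_coeff_linear_factor by metis
    qed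
  qed
qed

lemma algebraic_int_coeff_of_prod_roots:
  fixes k :: complex
  assumes "\<And>M'. M' \<subseteq># M \<Longrightarrow> algebraic_int (k * prod_mset M')"
  shows "algebraic_int (k * coeff (\<Prod>x\<in>#M. [:-x, 1:]) i)"
  using assms
proof (induction M arbitrary: k i)
  case empty
  then show ?case by (auto simp: coeff_pCons split: nat.split)
next
  case (add x M)
  have 1: "algebraic_int (k * coeff (\<Prod>x\<in>#M. [:-x, 1:]) j)" for j
  proof (rule add.IH)
    fix M' assume "M' \<subseteq># M"
    then have "M' \<subseteq># add_mset x M" by (meson subset_mset.order_trans mset_subset_eq_insertD multi_psub_of_add_self subset_mset.less_imp_le)
    then show "algebraic_int (k * prod_mset M')" by (rule add.prems)
  qed
  have 2: "algebraic_int (k * x * coeff (\<Prod>x\<in>#M. [:-x, 1:]) j)" for j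
  proof (rule add.IH)
    fix M' assume "M' \<subseteq># M"
    then have "add_mset x M' \<subseteq># add_mset x M" by simp
    from add.prems[OF this] show "algebraic_int (k * x * prod_mset M')" by (simp add: mult_ac)
  qed
  have "k * coeff (\<Prod>x\<in>#add_mset x M. [:-x, 1:]) i
      = (case i of 0 \<Rightarrow> 0 | Suc j \<Rightarrow> k * coeff (\<Prod>x\<in>#M. [:-x, 1:]) j) - k * x * coeff (\<Prod>x\<in>#M. [:-x, 1:]) i"
    by (cases i) (auto simp: algebra_simps mult_pCons_left)
  then show ?case using 1 2 by (cases i) (auto simp: algebraic_int_diff)
qed

text \<open>Dedekind's Prague theorem, which replaces Gauss's lemma over rings of integers.\<close>

lemma algebraic_int_coeff_mult:
  fixes p q :: "complex poly"
  assumes "\<And>i. algebraic_int (coeff (p * q) i)"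
  shows "algebraic_int (coeff p i * coeff q j)"
proof (cases "p = 0 \<or> q = 0")
  case False
  obtain A where A: "p = smult (lead_coeff p) (\<Prod>x\<in>#A. [:-x, 1:])"
    using alg_closed_imp_factorization[of p] False by blast
  obtain B where B: "q = smult (lead_coeff q) (\<Prod>x\<in>#B. [:-x, 1:])"
    using alg_closed_imp_factorization[of q] False by blast
  let ?a = "lead_coeff p" and ?b = "lead_coeff q"
  have pq: "p * q = smult (?a * ?b) (\<Prod>x\<in>#A + B. [:-x, 1:])"
    by (subst A, subst B) (simp add: mult_ac)
  have 1: "algebraic_int (?a * ?b * prod_mset M')" if "M' \<subseteq># A + B" for M'
    by (rule algebraic_int_prod_roots[OF _ that]) (use assms pq in metis)
  have 2: "algebraic_int (?a * ?b * prod_mset B' * coeff (\<Prod>x\<in>#A. [:-x, 1:]) i)" if "B' \<subseteq># B" for B'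
  proof (rule algebraic_int_coeff_of_prod_roots)
    fix A' assume "A' \<subseteq># A"
    then show "algebraic_int (?a * ?b * prod_mset B' * prod_mset A')"
      using 1[of "A' + B'"] that subset_mset.add_mono by (fastforce simp: mult_ac)
  qed
  have "algebraic_int (?a * ?b * coeff (\<Prod>x\<in>#A. [:-x, 1:]) i * coeff (\<Prod>x\<in>#B. [:-x, 1:]) j)"
    by (rule algebraic_int_coeff_of_prod_roots) (use 2 in \<open>simp add: mult_ac\<close>)
  moreover have "coeff p i = ?a * coeff (\<Prod>x\<in>#A. [:-x, 1:]) i"
    by (subst A) simp
  moreover have "coeff q j = ?b * coeff (\<Prod>x\<in>#B. [:-x, 1:]) j"
    by (subst B) simp
  ultimately show ?thesis by (simp add: mult_ac)
qed auto

lemma algebraic_times_int: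
  assumes "algebraic (x::complex)"
  shows "\<exists>d::nat. d \<ge> 1 \<and> algebraic_int (of_nat d * x)"
proof -
  from assms obtain p where p: "\<forall>i. coeff p i \<in> \<int>" "p \<noteq> 0" "poly p x = 0" by (auto elim: algebraicE)
  from p obtain k where k: "lead_coeff p = of_int k" by (auto elim: Ints_cases)
  then have "k \<noteq> 0" using p by auto
  have "algebraic_int (of_int k * x)"
    using algebraic_int_lead_coeff_mult_root[of p x] p k int_imp_algebraic_int by auto
  then have "algebraic_int (of_nat (nat \<bar>k\<bar>) * x)"
    by (cases "k \<ge> 0") (auto simp: abs_if)
  then show ?thesis using \<open>k \<noteq> 0\<close> by (intro exI[of _ "nat \<bar>k\<bar>"]) auto
qed

lemma algebraic_of_int_mult:
  assumes "algebraic_int (of_nat d * x)" "d \<ge> 1"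
  shows "algebraic (x::complex)"
proof -
  from assms(1) obtain p where p: "lead_coeff p = 1" "\<forall>i. coeff p i \<in> \<int>" "poly p (of_nat d * x) = 0"
    by (auto simp: algebraic_int.simps)
  define q where "q = pcompose p [:0, of_nat d:]"
  have "poly q x = 0" using p by (simp add: q_def poly_pcompose mult.commute)
  moreover have "q \<noteq> 0" using p assms(2) by (auto simp: q_def pcompose_eq_0_iff)
  moreover have "coeff q i \<in> \<int>" for i
    unfolding q_def using p by (intro coeff_pcompose_semiring_closed) (auto simp: coeff_pCons split: nat.split)
  ultimately show ?thesis by (auto intro: algebraicI)
qed

lemma algebraic_add [intro]:
  assumes "algebraic x" "algebraic (y::complex)" shows "algebraic (x + y)"
proof -
  obtain d e where d: "d \<ge> 1" "algebraic_int (of_nat d * x)" and e: "e \<ge> 1" "algebraic_int (of_nat e * y)"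
    using assms algebraic_times_int by blast
  have "algebraic_int (of_nat e * (of_nat d * x) + of_nat d * (of_nat e * y))" using d e by auto
  also have "of_nat e * (of_nat d * x) + of_nat d * (of_nat e * y) = of_nat (d * e) * (x + y)"
    by (simp add: algebra_simps)
  finally show ?thesis using d e by (intro algebraic_of_int_mult[of "d * e"]) auto
qed

lemma algebraic_mult [intro]:
  assumes "algebraic x" "algebraic (y::complex)" shows "algebraic (x * y)"
proof -
  obtain d e where d: "d \<ge> 1" "algebraic_int (of_nat d * x)" and e: "e \<ge> 1" "algebraic_int (of_nat e * y)"
    using assms algebraic_times_int by blast
  have "algebraic_int ((of_nat d * x) * (of_nat e * y))" by (rule algebraic_int_mult[OF d(2) e(2)])
  also have "(of_nat d * x) * (of_nat e * y) = of_nat (d * e) * (x * y)"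
    by (simp add: algebra_simps)
  finally show ?thesis using d e by (intro algebraic_of_int_mult[of "d * e"]) auto
qed

section \<open>Number fields with all their embeddings\<close>

definition subfld :: "complex set \<Rightarrow> bool" where
  "subfld K \<longleftrightarrow> 0 \<in> K \<and> 1 \<in> K \<and> (\<forall>x\<in>K. \<forall>y\<in>K. x + y \<in> K \<and> x * y \<in> K) \<and>
     (\<forall>x\<in>K. - x \<in> K \<and> inverse x \<in> K)"

lemma subfld_closed:
  assumes "subfld K"
  shows "0 \<in> K" "1 \<in> K" "x \<in> K \<Longrightarrow> y \<in> K \<Longrightarrow> x + y \<in> K" "x \<in> K \<Longrightarrow> y \<in> K \<Longrightarrow> x * y \<in> K"
    "x \<in> K \<Longrightarrow> - x \<in> K" "x \<in> K \<Longrightarrow> inverse x \<in> K"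
  using assms by (auto simp: subfld_def)

lemma subfld_diff: "subfld K \<Longrightarrow> x \<in> K \<Longrightarrow> y \<in> K \<Longrightarrow> x - y \<in> K"
  using subfld_closed(3)[of K x "-y"] subfld_closed(5)[of K y] by simp

lemma subfld_divide: "subfld K \<Longrightarrow> x \<in> K \<Longrightarrow> y \<in> K \<Longrightarrow> x / y \<in> K"
  unfolding divide_inverse by (intro subfld_closed)

lemma subfld_sum: "subfld K \<Longrightarrow> (\<And>i. i \<in> I \<Longrightarrow> f i \<in> K) \<Longrightarrow> sum f I \<in> K"
  by (induction I rule: infinite_finite_induct) (auto simp: subfld_closed)

lemma subfld_prod: "subfld K \<Longrightarrow> (\<And>i. i \<in> I \<Longrightarrow> f i \<in> K) \<Longrightarrow> prod f I \<in> K"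
  by (induction I rule: infinite_finite_induct) (auto simp: subfld_closed)

lemma subfld_power: "subfld K \<Longrightarrow> x \<in> K \<Longrightarrow> x ^ n \<in> K"
  by (induction n) (auto simp: subfld_closed)

lemma subfld_of_nat: "subfld K \<Longrightarrow> of_nat n \<in> K"
  by (induction n) (auto simp: subfld_closed)

lemma subfld_of_int: "subfld K \<Longrightarrow> of_int n \<in> K"
  by (cases n rule: int_cases2) (auto simp: subfld_closed subfld_of_nat)

lemma subfld_Rats: "subfld K \<Longrightarrow> x \<in> \<rat> \<Longrightarrow> x \<in> K"
  by (auto elim!: Rats_cases' simp: subfld_divide subfld_of_int)

lemma subfld_rats: "subfld \<rat>"
  by (auto simp: subfld_def)

lemma subfld_algebraic: "subfld {x. algebraic x}"
  by (auto simp: subfld_def intro: algebraic_int_imp_algebraic)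

definition polys_over :: "complex set \<Rightarrow> complex poly set" where
  "polys_over K = {p. \<forall>i. coeff p i \<in> K}"

lemma polys_over_closed:
  assumes "subfld K"
  shows "0 \<in> polys_over K" "1 \<in> polys_over K"
    "p \<in> polys_over K \<Longrightarrow> q \<in> polys_over K \<Longrightarrow> p + q \<in> polys_over K"
    "p \<in> polys_over K \<Longrightarrow> q \<in> polys_over K \<Longrightarrow> p - q \<in> polys_over K"
    "p \<in> polys_over K \<Longrightarrow> q \<in> polys_over K \<Longrightarrow> p * q \<in> polys_over K"
    "p \<in> polys_over K \<Longrightarrow> - p \<in> polys_over K"
    "c \<in> K \<Longrightarrow> monom c n \<in> polys_over K"
    "p \<in> polys_over K \<Longrightarrow> pderiv p \<in> polys_over K"
  using assms
  by (auto simp: polys_over_def subfld_closed subfld_diff coeff_mult coeff_1 coeff_pderiv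
      subfld_of_nat intro!: subfld_sum simp del: of_nat_Suc)

lemma polys_over_pCons: "subfld K \<Longrightarrow> a \<in> K \<Longrightarrow> p \<in> polys_over K \<Longrightarrow> pCons a p \<in> polys_over K"
  by (auto simp: polys_over_def coeff_pCons split: nat.split)

lemma polys_over_pcompose: "subfld K \<Longrightarrow> p \<in> polys_over K \<Longrightarrow> q \<in> polys_over K \<Longrightarrow> pcompose p q \<in> polys_over K"
  unfolding polys_over_def
  by (auto intro!: coeff_pcompose_semiring_closed simp: subfld_closed)

lemma polys_over_mono: "K \<subseteq> L \<Longrightarrow> polys_over K \<subseteq> polys_over L"
  by (auto simp: polys_over_def)

lemma poly_in_subfld: "subfld K \<Longrightarrow> p \<in> polys_over K \<Longrightarrow> x \<in> K \<Longrightarrow> poly p x \<in> K"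
  unfolding poly_altdef by (intro subfld_sum subfld_closed subfld_power) (auto simp: polys_over_def)

lemma polys_over_division:
  assumes K: "subfld K" and "p \<in> polys_over K" and g: "g \<in> polys_over K" "g \<noteq> 0"
  shows "\<exists>q\<in>polys_over K. \<exists>r\<in>polys_over K. p = g * q + r \<and> (r = 0 \<or> degree r < degree g)"
  using assms(2)
proof (induction "if p = 0 then 0 else Suc (degree p)" arbitrary: p rule: less_induct)
  case less
  show ?case
  proof (cases "p = 0 \<or> degree p < degree g")
    case True
    then show ?thesis using less.prems polys_over_closed[OF K]
      by (intro bexI[of _ 0] bexI[of _ p]) auto
  next
    case False
    define m where "m = monom (lead_coeff p / lead_coeff g) (degree p - degree g)"
    have m: "m \<in> polys_over K" unfolding m_def
      using K less.prems g by (intro polys_over_closed subfld_divide) (auto simp: polys_over_def)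
    define p' where "p' = p - g * m"
    have p': "p' \<in> polys_over K" unfolding p'_def using less.prems g m K by (intro polys_over_closed)
    have "p' = 0 \<or> degree p' < degree p"
    proof -
      have "degree (g * m) \<le> degree p"
      proof -
        have "degree g \<le> degree p" using False by simp
        then show ?thesis unfolding m_def
          using degree_mult_le[of g "monom (lead_coeff p / lead_coeff g) (degree p - degree g)"]
            degree_monom_le[of "lead_coeff p / lead_coeff g" "degree p - degree g"] by linarith
      qed
      then have "degree p' \<le> degree p" unfolding p'_def by (intro degree_diff_le) auto
      moreover have "coeff (g * m) (degree p) = lead_coeff p"
        using False g(2) coeff_monom_mult[of "lead_coeff p / lead_coeff g" "degree p - degree g" g "degree p"]
        by (simp add: m_def mult.commute)
      then have "coeff p' (degree p) = 0" by (simp add: p'_def)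
      ultimately show ?thesis
        by (metis False leading_coeff_0_iff le_neq_implies_less)
    qed
    then have "(if p' = 0 then 0 else Suc (degree p')) < (if p = 0 then 0 else Suc (degree p))"
      using False by auto
    from less.hyps[OF this p']
    obtain q r where "q \<in> polys_over K" "r \<in> polys_over K" "p' = g * q + r" "r = 0 \<or> degree r < degree g"
      by blast
    then show ?thesis using m K
      by (intro bexI[of _ "q + m"] bexI[of _ r]) (auto simp: p'_def algebra_simps intro: polys_over_closed)
  qed
qed

lemma polys_over_dvd:
  assumes K: "subfld K" and p: "p \<in> polys_over K" and g: "g \<in> polys_over K" "g dvd p"
  shows "\<exists>q\<in>polys_over K. p = g * q"
proof (cases "g = 0")
  case False
  obtain q r where qr: "q \<in> polys_over K" "p = g * q + r" "r = 0 \<or> degree r < degree g"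
    using polys_over_division[OF K p g(1) False] by blast
  have "g dvd r" using g(2) qr(2) by (metis dvd_add_right_iff dvd_triv_left)
  then have "r = 0" using qr(3) by (metis dvd_imp_degree_le not_le)
  then show ?thesis using qr by auto
qed (use g polys_over_closed[OF K] in auto)

text \<open>Irreducibility over \<open>K\<close>, phrased through roots.\<close>

definition irr_over :: "complex set \<Rightarrow> complex poly \<Rightarrow> bool" where
  "irr_over K m \<longleftrightarrow> m \<in> polys_over K \<and> degree m > 0 \<and>
     (\<forall>p\<in>polys_over K. \<forall>y. poly m y = 0 \<longrightarrow> poly p y = 0 \<longrightarrow> m dvd p)"

lemma irr_overD:
  assumes "irr_over K m"
  shows "m \<in> polys_over K" "degree m > 0" "m \<noteq> 0"
    "p \<in> polys_over K \<Longrightarrow> poly m y = 0 \<Longrightarrow> poly p y = 0 \<Longrightarrow> m dvd p"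
  using assms by (auto simp: irr_over_def)

lemma minimal_poly_exists:
  assumes K: "subfld K" and "p0 \<in> polys_over K" "p0 \<noteq> 0" "poly p0 x = 0"
  shows "\<exists>m\<in>polys_over K. degree m > 0 \<and> poly m x = 0 \<and> (\<forall>p\<in>polys_over K. poly p x = 0 \<longrightarrow> m dvd p)"
proof -
  define P where "P = (\<lambda>p. p \<in> polys_over K \<and> p \<noteq> 0 \<and> poly p x = 0)"
  have "P p0" using assms by (simp add: P_def)
  then obtain m where m: "P m" "\<And>p. P p \<Longrightarrow> degree m \<le> degree p"
    using ex_has_least_nat[of P p0 degree] by blast
  have "m dvd p" if p: "p \<in> polys_over K" "poly p x = 0" for p
  proof -
    obtain q r where qr: "r \<in> polys_over K" "p = m * q + r" "r = 0 \<or> degree r < degree m"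
      using polys_over_division[OF K p(1), of m] m(1) by (auto simp: P_def)
    have "poly r x = 0" using qr(2) p(2) m(1) by (simp add: P_def)
    then have "r = 0" using m(2)[of r] qr by (cases "r = 0") (auto simp: P_def)
    then show ?thesis using qr by auto
  qed
  moreover have "degree m > 0"
  proof (rule ccontr)
    assume "\<not> degree m > 0"
    then obtain c where "m = [:c:]" using degree_eq_zeroE by auto
    then show False using m(1) by (auto simp: P_def)
  qed
  ultimately show ?thesis using m(1) by (auto simp: P_def)
qed

lemma irr_over_exists:
  assumes K: "subfld K" and "p0 \<in> polys_over K" "p0 \<noteq> 0" "poly p0 x = 0"
  shows "\<exists>m. irr_over K m \<and> poly m x = 0"
proof -
  obtain m where m: "m \<in> polys_over K" "degree m > 0" "poly m x = 0"
    "\<And>p. p \<in> polys_over K \<Longrightarrow> poly p x = 0 \<Longrightarrow> m dvd p"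
    using minimal_poly_exists[OF assms] by blast
  have "m dvd p" if p: "p \<in> polys_over K" "poly m y = 0" "poly p y = 0" for p y
  proof -
    have m0: "m \<noteq> 0" using m(2) by auto
    obtain n where n: "n \<in> polys_over K" "degree n > 0" "poly n y = 0"
      "\<And>p. p \<in> polys_over K \<Longrightarrow> poly p y = 0 \<Longrightarrow> n dvd p"
      using minimal_poly_exists[OF K m(1) m0 p(2)] by blast
    have "n dvd m" using n(4) m(1) p by blast
    then obtain e where e: "e \<in> polys_over K" "m = n * e" using polys_over_dvd[OF K m(1) n(1)] by blast
    have "poly e x \<noteq> 0"
    proof
      assume "poly e x = 0"
      then have "m dvd e" using m(4) e by blast
      moreover have "e \<noteq> 0" "n \<noteq> 0" using e m0 by auto
      ultimately have "degree m \<le> degree e" by (intro dvd_imp_degree_le)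
      then show False using e n(2) \<open>e \<noteq> 0\<close> \<open>n \<noteq> 0\<close> by (simp add: degree_mult_eq)
    qed
    then have "poly n x = 0" using m(3) e by auto
    then have "m dvd n" using m(4) n(1) by blast
    then show ?thesis using n(4)[OF p(1,3)] dvd_trans by blast
  qed
  then show ?thesis using m by (auto simp: irr_over_def)
qed

lemma irr_over_separable:
  assumes K: "subfld K" and m: "irr_over K m" and y: "poly m y = 0"
  shows "poly (pderiv m) y \<noteq> 0"
proof
  assume "poly (pderiv m) y = 0"
  then have "m dvd pderiv m"
    using irr_overD(4)[OF m polys_over_closed(8)[OF K irr_overD(1)[OF m]] y] by simp
  moreover have "pderiv m \<noteq> 0" using irr_overD(2)[OF m] by (auto simp: pderiv_eq_0_iff)
  ultimately have "degree m \<le> degree (pderiv m)" by (intro dvd_imp_degree_le)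
  then show False using irr_overD(2)[OF m] by (simp add: degree_pderiv)
qed

lemma dvd_of_simple_roots:
  fixes m g :: "complex poly"
  assumes "m \<noteq> 0" "\<And>a. poly m a = 0 \<Longrightarrow> poly (pderiv m) a \<noteq> 0" "\<And>a. poly m a = 0 \<Longrightarrow> poly g a = 0"
  shows "m dvd g"
  using assms
proof (induction "degree m" arbitrary: m g rule: less_induct)
  case less
  show ?case
  proof (cases "degree m = 0")
    case True
    then obtain c where "m = [:c:]" using degree_eq_zeroE by auto
    then show ?thesis using less.prems by (auto simp: const_poly_dvd_iff dvd_field_iff)
  next
    case False
    then obtain a where a: "poly m a = 0" using alg_closed_imp_poly_has_root[of m] by auto
    then obtain n where n: "m = [:-a, 1:] * n" using poly_eq_0_iff_dvd by (metis dvdE)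
    obtain h where h: "g = [:-a, 1:] * h" using poly_eq_0_iff_dvd less.prems(3)[OF a] by (metis dvdE)
    have n0: "n \<noteq> 0" using n less.prems by auto
    have d: "pderiv m = n + [:-a, 1:] * pderiv n"
      unfolding n pderiv_mult by (simp add: pderiv_pCons algebra_simps)
    have na: "poly n a \<noteq> 0" using less.prems(2)[OF a] by (simp add: d)
    have "n dvd h"
    proof (rule less.hyps)
      show "degree n < degree m" using n0 unfolding n by (subst degree_mult_eq) auto
      fix b assume b: "poly n b = 0"
      then have "b \<noteq> a" using na by auto
      have mb: "poly m b = 0" using b by (simp add: n)
      show "poly (pderiv n) b \<noteq> 0" using less.prems(2)[OF mb] b by (simp add: d)
      show "poly h b = 0" using less.prems(3)[OF mb] \<open>b \<noteq> a\<close> by (simp add: h)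
    qed (rule n0)
    then show ?thesis unfolding n h by (rule mult_dvd_mono[OF dvd_refl])
  qed
qed

lemma irr_over_rats_exists:
  assumes "algebraic x"
  shows "\<exists>m. irr_over \<rat> m \<and> poly m x = 0"
proof -
  obtain p where "\<forall>i. coeff p i \<in> \<rat>" "p \<noteq> 0" "poly p x = 0" using assms by (auto simp: algebraic_altdef)
  then show ?thesis using irr_over_exists[OF subfld_rats, of p x] by (auto simp: polys_over_def)
qed

definition adj :: "complex \<Rightarrow> complex set" where
  "adj \<theta> = (\<lambda>p. poly p \<theta>) ` polys_over \<rat>"

lemma algebraic_poly:
  assumes "p \<in> polys_over \<rat>" "algebraic x"
  shows "algebraic (poly p x)"
  using poly_in_subfld[OF subfld_algebraic, of p x] assms subfld_Rats[OF subfld_algebraic]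
  by (auto simp: polys_over_def)

lemma subfld_adj:
  assumes "algebraic \<theta>"
  shows "subfld (adj \<theta>)"
proof -
  note cl = polys_over_closed[OF subfld_rats]
  have inv: "inverse (poly p \<theta>) \<in> adj \<theta>" if p: "p \<in> polys_over \<rat>" for p
  proof (cases "poly p \<theta> = 0")
    case True
    then show ?thesis using cl by (auto simp: adj_def intro: image_eqI[of _ _ 0])
  next
    case False
    define y where "y = poly p \<theta>"
    obtain m where m: "irr_over \<rat> m" "poly m y = 0"
      using irr_over_rats_exists[OF algebraic_poly[OF p assms]] by (auto simp: y_def)
    obtain c n where mc: "m = pCons c n" by (cases m)
    have "c \<noteq> 0"
    proof
      assume "c = 0"
      then have "poly m 0 = 0" by (simp add: mc)
      moreover have "[:0, 1:] \<in> polys_over \<rat>"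
        using subfld_rats cl by (intro polys_over_pCons) auto
      ultimately have "m dvd [:0, 1:]" using irr_overD(4)[OF m(1)] by auto
      then have "poly [:0, 1:] y = 0" using m(2) by (meson dvd_trans poly_eq_0_iff_dvd)
      then show False using False by (simp add: y_def)
    qed
    have "coeff m i \<in> \<rat>" for i using irr_overD(1)[OF m(1)] by (simp add: polys_over_def)
    from this[of 0] this[of "Suc _"] have n: "c \<in> \<rat>" "n \<in> polys_over \<rat>"
      by (auto simp: mc polys_over_def)
    have "c + y * poly n y = 0" using m(2) by (simp add: mc)
    then have "inverse y = - inverse c * poly n y"
      using \<open>c \<noteq> 0\<close> False unfolding y_def[symmetric]
      by (simp add: field_simps eq_neg_iff_add_eq_0)
    also have "\<dots> = poly (monom (- inverse c) 0 * pcompose n p) \<theta>"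
      by (simp add: poly_pcompose y_def poly_monom)
    also have "\<dots> \<in> adj \<theta>" unfolding adj_def
      using n p subfld_rats by (intro imageI polys_over_closed polys_over_pcompose) auto
    finally show ?thesis by (simp add: y_def)
  qed
  show ?thesis
    unfolding subfld_def
  proof (intro conjI ballI)
    show "0 \<in> adj \<theta>" "1 \<in> adj \<theta>" using cl(1,2) by (auto simp: adj_def intro: image_eqI[of _ _ 0] image_eqI[of _ _ 1])
    fix x assume "x \<in> adj \<theta>"
    then obtain p where p: "p \<in> polys_over \<rat>" "x = poly p \<theta>" by (auto simp: adj_def)
    show "- x \<in> adj \<theta>" using cl(6)[OF p(1)] p(2) by (auto simp: adj_def intro!: image_eqI[of _ _ "- p"])
    show "inverse x \<in> adj \<theta>" using inv p by simp
    fix y assume "y \<in> adj \<theta>"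
    then obtain q where q: "q \<in> polys_over \<rat>" "y = poly q \<theta>" by (auto simp: adj_def)
    show "x + y \<in> adj \<theta>" using cl(3)[OF p(1) q(1)] p(2) q(2) by (auto simp: adj_def intro!: image_eqI[of _ _ "p + q"])
    show "x * y \<in> adj \<theta>" using cl(5)[OF p(1) q(1)] p(2) q(2) by (auto simp: adj_def intro!: image_eqI[of _ _ "p * q"])
  qed
qed

lemma adj_self: "\<theta> \<in> adj \<theta>"
proof -
  have "[:0, 1:] \<in> polys_over \<rat>"
    using subfld_rats polys_over_closed[OF subfld_rats] by (intro polys_over_pCons) auto
  then show ?thesis by (force simp: adj_def)
qed

lemma adj_minimal: "subfld L \<Longrightarrow> \<theta> \<in> L \<Longrightarrow> adj \<theta> \<subseteq> L"
  using poly_in_subfld[of L] subfld_Rats[of L] polys_over_mono[of \<rat> L] by (auto simp: adj_def)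

lemma primitive_element_two:
  assumes a: "algebraic a" and b: "algebraic b"
  shows "\<exists>n::nat. a \<in> adj (a + of_nat n * b) \<and> b \<in> adj (a + of_nat n * b)"
proof -
  obtain f where f: "irr_over \<rat> f" "poly f a = 0" using irr_over_rats_exists[OF a] by blast
  obtain g where g: "irr_over \<rat> g" "poly g b = 0" using irr_over_rats_exists[OF b] by blast
  define bad where "bad = (\<lambda>(a', b'). (a' - a) / (b - b')) ` ({y. poly f y = 0} \<times> {y. poly g y = 0})"
  have finbad: "finite bad" unfolding bad_def using irr_overD(3)[OF f(1)] irr_overD(3)[OF g(1)]
    by (intro finite_imageI finite_cartesian_product poly_roots_finite)
  have "infinite (range (of_nat :: nat \<Rightarrow> complex))" by (intro range_inj_infinite injI) simp
  then have "\<not> range (of_nat :: nat \<Rightarrow> complex) \<subseteq> bad"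
    using finite_subset[OF _ finbad] by metis
  then obtain n :: nat where n: "of_nat n \<notin> bad" by auto
  define \<theta> where "\<theta> = a + of_nat n * b"
  have "algebraic \<theta>" unfolding \<theta>_def
    by (intro algebraic_add algebraic_mult algebraic_int_imp_algebraic algebraic_int_of_nat a b)
  then have K: "subfld (adj \<theta>)" by (rule subfld_adj)
  have sub: "\<rat> \<subseteq> adj \<theta>" using subfld_Rats[OF K] by auto
  define h where "h = pcompose f [:\<theta>, - of_nat n:]"
  have fK: "f \<in> polys_over (adj \<theta>)" and gK: "g \<in> polys_over (adj \<theta>)"
    using irr_overD(1)[OF f(1)] irr_overD(1)[OF g(1)] polys_over_mono[OF sub] by auto
  have hK: "h \<in> polys_over (adj \<theta>)" unfolding h_def
    using fK K adj_self subfld_of_nat[OF K]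
    by (intro polys_over_pcompose polys_over_pCons polys_over_closed subfld_closed(5)) auto
  obtain d where d: "irr_over (adj \<theta>) d" "poly d b = 0"
    using irr_over_exists[OF K gK _ g(2)] irr_overD(3)[OF g(1)] by blast
  have "poly h b = 0" by (simp add: h_def poly_pcompose \<theta>_def f(2) mult.commute)
  then have dvd: "d dvd g" "d dvd h" using irr_overD(4)[OF d(1)] gK hK g(2) d(2) by blast+
  have only: "y = b" if "poly d y = 0" for y
  proof (rule ccontr)
    assume "y \<noteq> b"
    have "poly g y = 0" "poly h y = 0" using dvd that by (auto elim!: dvdE)
    then have "poly f (\<theta> - of_nat n * y) = 0" by (simp add: h_def poly_pcompose mult.commute)
    then have "((\<theta> - of_nat n * y) - a) / (b - y) \<in> bad"
      unfolding bad_def using \<open>poly g y = 0\<close> by force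
    moreover have "((\<theta> - of_nat n * y) - a) / (b - y) = of_nat n"
      using \<open>y \<noteq> b\<close> by (simp add: \<theta>_def field_simps)
    ultimately show False using n by simp
  qed
  have "d dvd [:-b, 1:]"
    using irr_over_separable[OF K d(1)] only irr_overD(3)[OF d(1)] by (intro dvd_of_simple_roots) auto
  then have "degree d \<le> 1" using dvd_imp_degree_le[of d "[:-b, 1:]"] by simp
  then have "degree d = 1" using irr_overD(2)[OF d(1)] by simp
  then obtain u v where uv: "d = [:u, v:]" "v \<noteq> 0" using degree1_coeffs by blast
  have "coeff d i \<in> adj \<theta>" for i using irr_overD(1)[OF d(1)] by (simp add: polys_over_def)
  from this[of 0] this[of 1] have uvK: "u \<in> adj \<theta>" "v \<in> adj \<theta>" by (auto simp: uv)
  have "b = - (u / v)" using d(2) uv by (simp add: field_simps eq_neg_iff_add_eq_0)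
  then have bK: "b \<in> adj \<theta>" using uvK K by (simp add: subfld_closed subfld_divide)
  have "a = \<theta> - of_nat n * b" by (simp add: \<theta>_def)
  then have "a \<in> adj \<theta>" using bK K adj_self subfld_of_nat[OF K] by (metis subfld_diff subfld_closed(4))
  then show ?thesis using bK unfolding \<theta>_def by blast
qed

lemma primitive_element:
  assumes "finite B" "\<And>b. b \<in> B \<Longrightarrow> algebraic b"
  shows "\<exists>\<theta>. algebraic \<theta> \<and> B \<subseteq> adj \<theta> \<and> (\<forall>L. subfld L \<longrightarrow> B \<subseteq> L \<longrightarrow> \<theta> \<in> L)"
  using assms
proof (induction B rule: finite_induct)
  case empty
  then show ?case by (intro exI[of _ 0]) (auto simp: subfld_closed)
next
  case (insert b B)
  then obtain a where a: "algebraic a" "B \<subseteq> adj a" "\<And>L. subfld L \<Longrightarrow> B \<subseteq> L \<Longrightarrow> a \<in> L" by auto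
  have b: "algebraic b" using insert.prems by auto
  obtain n :: nat where n: "a \<in> adj (a + of_nat n * b)" "b \<in> adj (a + of_nat n * b)"
    using primitive_element_two[OF a(1) b] by blast
  have alg: "algebraic (a + of_nat n * b)"
    by (intro algebraic_add algebraic_mult algebraic_int_imp_algebraic algebraic_int_of_nat a b)
  have "B \<subseteq> adj (a + of_nat n * b)" using adj_minimal[OF subfld_adj[OF alg] n(1)] a(2) by blast
  moreover have "a + of_nat n * b \<in> L" if "subfld L" "insert b B \<subseteq> L" for L
    using that a(3)[of L] by (auto intro!: subfld_closed(3,4) subfld_of_nat)
  ultimately show ?case using n alg by (intro exI[of _ "a + of_nat n * b"]) auto
qed

definition emb :: "complex set \<Rightarrow> (complex \<Rightarrow> complex) \<Rightarrow> bool" where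
  "emb K \<sigma> \<longleftrightarrow> \<sigma> 1 = 1 \<and> (\<forall>x\<in>K. \<forall>y\<in>K. \<sigma> (x + y) = \<sigma> x + \<sigma> y \<and> \<sigma> (x * y) = \<sigma> x * \<sigma> y)"

context
  fixes K \<sigma> assumes K: "subfld K" and e: "emb K \<sigma>"
begin

lemma emb_add: "x \<in> K \<Longrightarrow> y \<in> K \<Longrightarrow> \<sigma> (x + y) = \<sigma> x + \<sigma> y"
  and emb_mult: "x \<in> K \<Longrightarrow> y \<in> K \<Longrightarrow> \<sigma> (x * y) = \<sigma> x * \<sigma> y"
  and emb_1: "\<sigma> 1 = 1"
  using e by (auto simp: emb_def)

lemma emb_0: "\<sigma> 0 = 0"
  using emb_add[of 0 0] K by (simp add: subfld_closed)

lemma emb_minus: "x \<in> K \<Longrightarrow> \<sigma> (- x) = - \<sigma> x"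
  using emb_add[of x "-x"] K emb_0 by (simp add: subfld_closed eq_neg_iff_add_eq_0 add.commute)

lemma emb_diff: "x \<in> K \<Longrightarrow> y \<in> K \<Longrightarrow> \<sigma> (x - y) = \<sigma> x - \<sigma> y"
  using emb_add[of x "-y"] emb_minus[of y] K by (simp add: subfld_closed)

lemma emb_sum: "(\<And>i. i \<in> I \<Longrightarrow> f i \<in> K) \<Longrightarrow> \<sigma> (sum f I) = (\<Sum>i\<in>I. \<sigma> (f i))"
  by (induction I rule: infinite_finite_induct) (auto simp: emb_0 emb_add subfld_sum[OF K])

lemma emb_prod: "(\<And>i. i \<in> I \<Longrightarrow> f i \<in> K) \<Longrightarrow> \<sigma> (prod f I) = (\<Prod>i\<in>I. \<sigma> (f i))"
  by (induction I rule: infinite_finite_induct) (auto simp: emb_1 emb_mult subfld_prod[OF K])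

lemma emb_power: "x \<in> K \<Longrightarrow> \<sigma> (x ^ n) = \<sigma> x ^ n"
  by (induction n) (auto simp: emb_1 emb_mult subfld_power[OF K])

lemma emb_nonzero: "x \<in> K \<Longrightarrow> x \<noteq> 0 \<Longrightarrow> \<sigma> x \<noteq> 0"
  using emb_mult[of x "inverse x"] K emb_1 by (auto simp: subfld_closed)

lemma emb_of_nat: "\<sigma> (of_nat n) = of_nat n"
  by (induction n) (auto simp: emb_0 emb_1 emb_add subfld_closed[OF K] subfld_of_nat[OF K])

lemma emb_of_int: "\<sigma> (of_int n) = of_int n"
  by (cases n rule: int_cases2) (auto simp: emb_of_nat emb_minus subfld_of_nat[OF K])

lemma emb_Rats:
  assumes "r \<in> \<rat>" shows "\<sigma> r = r"
proof -
  obtain a b :: int where ab: "b > 0" "r = of_int a / of_int b" using assms by (auto elim: Rats_cases')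
  have "\<sigma> r * of_int b = \<sigma> (r * of_int b)"
    using emb_mult[OF subfld_Rats[OF K assms] subfld_of_int[OF K]] emb_of_int by simp
  also have "r * of_int b = of_int a" using ab by simp
  also have "\<sigma> (of_int a) = of_int a" by (rule emb_of_int)
  finally have "\<sigma> r * of_int b = r * of_int b" using ab by simp
  then show ?thesis using ab(1) by (metis mult_cancel_right of_int_eq_0_iff less_irrefl)
qed

lemma emb_poly: "p \<in> polys_over \<rat> \<Longrightarrow> x \<in> K \<Longrightarrow> \<sigma> (poly p x) = poly p (\<sigma> x)"
  unfolding poly_altdef polys_over_def using subfld_Rats[OF K]
  by (auto simp: emb_sum emb_mult emb_power emb_Rats subfld_closed[OF K] subfld_power[OF K])

lemma emb_algebraic_int:
  assumes "x \<in> K" "algebraic_int x" shows "algebraic_int (\<sigma> x)"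
proof -
  obtain p where p: "lead_coeff p = 1" "\<forall>i. coeff p i \<in> \<int>" "poly p x = 0"
    using assms by (auto simp: algebraic_int.simps)
  then have "p \<in> polys_over \<rat>" using Ints_subset_Rats by (auto simp: polys_over_def)
  then have "poly p (\<sigma> x) = 0" using emb_poly[of p x] assms p(3) emb_0 by simp
  then show ?thesis using p by (auto simp: algebraic_int.simps)
qed

end

text \<open>Of the Galois group \<open>S\<close> of \<open>K\<close> over the rationals only the rationality of norms is recorded.\<close>

definition galois_field :: "complex set \<Rightarrow> (complex \<Rightarrow> complex) set \<Rightarrow> bool" where
  "galois_field K S \<longleftrightarrow> subfld K \<and> (\<forall>x\<in>K. algebraic x) \<and> finite S \<and> (\<forall>\<sigma>\<in>S. emb K \<sigma>) \<and>
     (\<exists>\<sigma>\<in>S. \<forall>x\<in>K. \<sigma> x = x) \<and> (\<forall>x\<in>K. (\<Prod>\<sigma>\<in>S. \<sigma> x) \<in> \<rat>)"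

lemma rational_of_conjugates:
  assumes m: "irr_over \<rat> m" "poly m \<theta> = 0" and p: "p \<in> polys_over \<rat>"
    and fixed: "\<And>y. poly m y = 0 \<Longrightarrow> poly p y = c"
  shows "c \<in> \<rat>"
proof -
  obtain q r where qr: "r \<in> polys_over \<rat>" "p = m * q + r" "r = 0 \<or> degree r < degree m"
    using polys_over_division[OF subfld_rats p irr_overD(1,3)[OF m(1)]] by blast
  have "m dvd r - [:c:]"
    using irr_over_separable[OF subfld_rats m(1)] fixed irr_overD(3)[OF m(1)] qr(2)
    by (intro dvd_of_simple_roots) auto
  moreover have "degree (r - [:c:]) < degree m"
    using qr(3) irr_overD(2)[OF m(1)] by (auto intro: degree_diff_less)
  ultimately have "r - [:c:] = 0" by (metis dvd_imp_degree_le not_le)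
  then have "coeff r 0 = c" by simp
  then show ?thesis using qr(1) by (auto simp: polys_over_def)
qed

lemma galois_field_exists:
  assumes "finite A" "\<And>a. a \<in> A \<Longrightarrow> algebraic a"
  shows "\<exists>K S. galois_field K S \<and> A \<subseteq> K"
proof -
  obtain pol where pol: "\<And>a. a \<in> A \<Longrightarrow> irr_over \<rat> (pol a) \<and> poly (pol a) a = 0"
    using irr_over_rats_exists assms(2) by metis
  define B where "B = (\<Union>a\<in>A. {y. poly (pol a) y = 0})"
  have finB: "finite B" unfolding B_def using assms(1) pol irr_overD(3) by (auto intro!: poly_roots_finite)
  have algB: "algebraic b" if "b \<in> B" for b
  proof -
    from that obtain a where "a \<in> A" "poly (pol a) b = 0" by (auto simp: B_def)
    then show ?thesis using pol[of a] irr_overD[of \<rat> "pol a"] unfolding algebraic_altdef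
      by (intro exI[of _ "pol a"]) (auto simp: polys_over_def)
  qed
  obtain \<theta> where "algebraic \<theta> \<and> B \<subseteq> adj \<theta> \<and> (\<forall>L. subfld L \<longrightarrow> B \<subseteq> L \<longrightarrow> \<theta> \<in> L)"
    using primitive_element[OF finB algB] ..
  then have th: "algebraic \<theta>" "B \<subseteq> adj \<theta>" "\<And>L. subfld L \<Longrightarrow> B \<subseteq> L \<Longrightarrow> \<theta> \<in> L" by simp_all
  define K where "K = adj \<theta>"
  have K: "subfld K" unfolding K_def using th by (intro subfld_adj)
  obtain m where m: "irr_over \<rat> m" "poly m \<theta> = 0" using irr_over_rats_exists[OF th(1)] by blast
  define R where "R = {y. poly m y = 0}"
  have finR: "finite R" unfolding R_def using irr_overD(3)[OF m(1)] by (rule poly_roots_finite)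
  define \<sigma> where "\<sigma> = (\<lambda>y x. poly (SOME p. p \<in> polys_over \<rat> \<and> poly p \<theta> = x) y)"
  have s: "\<sigma> y (poly p \<theta>) = poly p y" if "p \<in> polys_over \<rat>" "y \<in> R" for p y
  proof -
    define q where "q = (SOME q. q \<in> polys_over \<rat> \<and> poly q \<theta> = poly p \<theta>)"
    have q: "q \<in> polys_over \<rat> \<and> poly q \<theta> = poly p \<theta>"
      unfolding q_def by (rule someI[of _ p]) (use that in auto)
    then have "m dvd p - q"
      using irr_overD(4)[OF m(1), of "p - q" \<theta>] m(2) that polys_over_closed[OF subfld_rats] by auto
    then obtain k where "p - q = m * k" by (elim dvdE)
    then have "poly (p - q) y = 0" using that(2) by (simp add: R_def del: poly_diff)
    then show ?thesis by (simp add: \<sigma>_def q_def)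
  qed
  note cl = polys_over_closed[OF subfld_rats]
  have emb: "emb K (\<sigma> y)" if y: "y \<in> R" for y
    unfolding emb_def
  proof (intro conjI ballI)
    show "\<sigma> y 1 = 1" using s[OF cl(2) y] by simp
    fix a b assume "a \<in> K" "b \<in> K"
    then obtain p q where pq: "p \<in> polys_over \<rat>" "q \<in> polys_over \<rat>" "a = poly p \<theta>" "b = poly q \<theta>"
      by (auto simp: K_def adj_def)
    show "\<sigma> y (a + b) = \<sigma> y a + \<sigma> y b"
      using s[OF cl(3)[OF pq(1,2)] y] s[OF pq(1) y] s[OF pq(2) y] pq by simp
    show "\<sigma> y (a * b) = \<sigma> y a * \<sigma> y b"
      using s[OF cl(5)[OF pq(1,2)] y] s[OF pq(1) y] s[OF pq(2) y] pq by simp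
  qed
  have X: "[:0, 1:] \<in> polys_over \<rat>" using subfld_rats cl by (intro polys_over_pCons) auto
  have s\<theta>: "\<sigma> y \<theta> = y" if "y \<in> R" for y using s[OF X that] by simp
  have RK: "y \<in> K" if y: "y \<in> R" for y
  proof -
    define L where "L = {x\<in>K. \<sigma> y x \<in> K}"
    have sinv: "\<sigma> y (inverse x) = inverse (\<sigma> y x)" if "x \<in> K" for x
    proof (cases "x = 0")
      case True then show ?thesis using emb_0[OF K emb[OF y]] by simp
    next
      case False
      then have "\<sigma> y x * \<sigma> y (inverse x) = 1"
        using emb_mult[OF K emb[OF y], of x "inverse x"] that K emb_1[OF K emb[OF y]] by (simp add: subfld_closed)
      then show ?thesis by (metis inverse_unique)
    qed
    then have "subfld L" unfolding L_def subfld_def using subfld_closed[OF K]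
      by (auto simp: emb_0[OF K emb[OF y]] emb_1[OF K emb[OF y]] emb_add[OF K emb[OF y]]
          emb_mult[OF K emb[OF y]] emb_minus[OF K emb[OF y]])
    moreover have "B \<subseteq> L"
    proof
      fix b assume b: "b \<in> B"
      then obtain a where a: "a \<in> A" "poly (pol a) b = 0" by (auto simp: B_def)
      have bK: "b \<in> K" using b th(2) by (auto simp: K_def)
      have "pol a \<in> polys_over \<rat>" using pol[OF a(1)] irr_overD(1) by blast
      then have "poly (pol a) (\<sigma> y b) = 0"
        using emb_poly[OF K emb[OF y] _ bK, of "pol a"] a(2) emb_0[OF K emb[OF y]] by simp
      then have "\<sigma> y b \<in> B" using a(1) by (auto simp: B_def)
      then show "b \<in> L" using th(2) bK by (auto simp: L_def K_def)
    qed
    ultimately have "\<theta> \<in> L" by (rule th(3))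
    then show ?thesis using s\<theta>[OF y] by (simp add: L_def)
  qed
  have perm: "bij_betw (\<sigma> y) R R" if y: "y \<in> R" for y
  proof -
    have "\<sigma> y ` R \<subseteq> R"
    proof
      fix z assume "z \<in> \<sigma> y ` R"
      then obtain x where x: "x \<in> R" "z = \<sigma> y x" by auto
      have "poly m (\<sigma> y x) = \<sigma> y (poly m x)"
        using emb_poly[OF K emb[OF y] irr_overD(1)[OF m(1)] RK[OF x(1)]] by simp
      then show "z \<in> R" using x emb_0[OF K emb[OF y]] by (simp add: R_def)
    qed
    moreover have "inj_on (\<sigma> y) R"
    proof (rule inj_onI)
      fix u v assume uv: "u \<in> R" "v \<in> R" "\<sigma> y u = \<sigma> y v"
      then have "\<sigma> y (u - v) = 0" using emb_diff[OF K emb[OF y]] RK by simp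
      then show "u = v" using emb_nonzero[OF K emb[OF y], of "u - v"] RK uv K subfld_diff[OF K] by auto
    qed
    ultimately show ?thesis using finR by (simp add: bij_betw_def endo_inj_surj)
  qed
  have norm: "(\<Prod>z\<in>R. \<sigma> z x) \<in> \<rat>" if xK: "x \<in> K" for x
  proof -
    obtain p where p: "p \<in> polys_over \<rat>" "x = poly p \<theta>" using xK by (auto simp: K_def adj_def)
    have pR: "poly p z \<in> K" if "z \<in> R" for z
      using poly_in_subfld[OF K _ RK[OF that], of p] p(1) polys_over_mono[of \<rat> K] subfld_Rats[OF K] by blast
    define N where "N = (\<Prod>z\<in>R. poly p z)"
    have N: "N = (\<Prod>z\<in>R. \<sigma> z x)" using s[OF p(1)] by (simp add: N_def p(2))
    have "N \<in> K" unfolding N_def using pR by (intro subfld_prod[OF K])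
    then obtain q where q: "q \<in> polys_over \<rat>" "N = poly q \<theta>" by (auto simp: K_def adj_def)
    have "poly q y = N" if "poly m y = 0" for y
    proof -
      have y: "y \<in> R" using that by (simp add: R_def)
      have "poly q y = \<sigma> y N" using s[OF q(1) y] q(2) by simp
      also have "\<dots> = (\<Prod>z\<in>R. \<sigma> y (poly p z))"
        unfolding N_def using emb_prod[OF K emb[OF y]] pR by blast
      also have "\<dots> = (\<Prod>z\<in>R. poly p (\<sigma> y z))"
        using emb_poly[OF K emb[OF y] p(1) RK] by simp
      also have "\<dots> = N"
        unfolding N_def using perm[OF y] by (rule prod.reindex_bij_betw)
      finally show ?thesis .
    qed
    then show ?thesis using rational_of_conjugates[OF m q(1)] N by simp
  qed
  have inj: "inj_on \<sigma> R" by (rule inj_onI) (metis s\<theta>)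
  have tR: "\<theta> \<in> R" using m(2) by (simp add: R_def)
  have "galois_field K (\<sigma> ` R)"
    unfolding galois_field_def
  proof (intro conjI)
    show "\<forall>x\<in>K. algebraic x" unfolding K_def adj_def using algebraic_poly th(1) by auto
    show "\<exists>s\<in>\<sigma> ` R. \<forall>x\<in>K. s x = x"
      by (rule bexI[of _ "\<sigma> \<theta>"]) (use tR s in \<open>auto simp: K_def adj_def\<close>)
    show "\<forall>x\<in>K. (\<Prod>s\<in>\<sigma> ` R. s x) \<in> \<rat>" using norm by (simp add: prod.reindex[OF inj])
  qed (use K finR emb in auto)
  moreover have "A \<subseteq> K" unfolding K_def using th(2) pol by (auto simp: B_def)
  ultimately show ?thesis by blast
qed

lemma galois_conjugate_emb:
  assumes K: "subfld K" and e: "emb K \<sigma>" and x: "x \<in> K" "algebraic x"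
  shows "galois_conjugate x (\<sigma> x)"
proof -
  obtain m where m: "irr_over \<rat> m" "poly m x = 0" using irr_over_rats_exists[OF x(2)] by blast
  have mQ: "coeff m i \<in> \<rat>" for i using irr_overD(1)[OF m(1)] by (simp add: polys_over_def)
  have "\<forall>i. \<exists>q::rat. of_rat q = coeff m i"
    using mQ by (metis Rats_cases)
  then obtain r :: "nat \<Rightarrow> rat" where r: "\<And>i. of_rat (r i) = coeff m i" by metis
  define p where "p = Abs_poly r"
  have "coeff p i = r i" for i
  proof -
    have "r j = 0" if "j > degree m" for j using r[of j] that by (simp add: coeff_eq_0)
    then show ?thesis unfolding p_def by (subst coeff_Abs_poly[of "degree m"]) auto
  qed
  then have mp: "map_poly of_rat p = m" by (intro poly_eqI) (simp add: coeff_map_poly r)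
  have deg: "degree (map_poly (of_rat :: rat \<Rightarrow> complex) q) = degree q" for q
    by (rule degree_map_poly) auto
  have hom: "map_poly (of_rat :: rat \<Rightarrow> complex) (a * b) = map_poly of_rat a * map_poly of_rat b" for a b
    by (intro poly_eqI) (simp add: coeff_map_poly coeff_mult of_rat_sum of_rat_mult)
  have key: "degree b = 0" if ab: "p = a * b" "poly (map_poly of_rat a) x = 0" for a b :: "rat poly"
  proof -
    have "map_poly of_rat a \<in> polys_over \<rat>" by (auto simp: polys_over_def coeff_map_poly)
    then have "m dvd map_poly of_rat a" using irr_overD(4)[OF m(1)] m(2) ab(2) by blast
    moreover have nz: "a \<noteq> 0" "b \<noteq> 0" using ab(1) irr_overD(3)[OF m(1)] mp by auto
    moreover have "map_poly (of_rat :: rat \<Rightarrow> complex) a \<noteq> 0"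
    proof
      assume "map_poly (of_rat :: rat \<Rightarrow> complex) a = 0"
      then have "coeff (map_poly (of_rat :: rat \<Rightarrow> complex) a) (degree a) = 0" by simp
      then show False using nz by (simp add: coeff_map_poly)
    qed
    ultimately have "degree m \<le> degree a" using dvd_imp_degree_le deg by metis
    moreover have "degree m = degree p" using deg[of p] by (simp add: mp)
    ultimately show ?thesis using nz ab(1) by (simp add: degree_mult_eq)
  qed
  have "irreducible p"
  proof (rule irreducibleI)
    show "p \<noteq> 0" using irr_overD(3)[OF m(1)] mp by auto
    show "\<not> p dvd 1" using irr_overD(2)[OF m(1)] deg[of p] by (auto simp: mp is_unit_iff_degree poly_dvd_1)
    fix a b assume ab: "p = a * b"
    then have "poly (map_poly of_rat a) x * poly (map_poly of_rat b) x = 0"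
      using m(2) hom[of a b] by (simp add: mp[symmetric])
    then have "degree b = 0 \<or> degree a = 0" using key[of a b] key[of b a] ab by (auto simp: mult.commute)
    moreover have "a \<noteq> 0" "b \<noteq> 0" using \<open>p \<noteq> 0\<close> ab by auto
    ultimately show "a dvd 1 \<or> b dvd 1" by (auto simp: is_unit_iff_degree)
  qed
  moreover have "poly m (\<sigma> x) = 0"
    using emb_poly[OF K e irr_overD(1)[OF m(1)] x(1)] m(2) emb_0[OF K e] by simp
  ultimately show ?thesis unfolding galois_conjugate_def using m(2) mp by blast
qed

lemma galois_norm:
  assumes G: "galois_field K S" and x: "x \<in> K" "algebraic_int x" "x \<noteq> 0"
    and B: "\<And>\<sigma>. \<sigma> \<in> S \<Longrightarrow> cmod (\<sigma> x) \<le> B"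
  shows "\<exists>q::nat. q \<ge> 1 \<and> real q \<le> B ^ card S \<and> algebraic_int (of_nat q / x)"
proof -
  have K: "subfld K" and S: "finite S" "\<And>\<sigma>. \<sigma> \<in> S \<Longrightarrow> emb K \<sigma>" using G by (auto simp: galois_field_def)
  obtain s where s: "s \<in> S" "\<And>x. x \<in> K \<Longrightarrow> s x = x" using G by (auto simp: galois_field_def)
  define N where "N = (\<Prod>\<sigma>\<in>S. \<sigma> x)"
  have int: "algebraic_int (\<sigma> x)" if "\<sigma> \<in> S" for \<sigma> using emb_algebraic_int[OF K S(2)[OF that] x(1,2)] .
  have "N \<in> \<rat>" using G x by (auto simp: galois_field_def N_def)
  moreover have "algebraic_int N" unfolding N_def using int by (rule algebraic_int_prod)
  ultimately have "N \<in> \<int>" using rational_algebraic_int_is_int by blast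
  then obtain k where k: "N = of_int k" by (auto elim: Ints_cases)
  have "N \<noteq> 0" unfolding N_def using S emb_nonzero[OF K S(2) x(1,3)] by simp
  then have "k \<noteq> 0" using k by auto
  have "N / x = (\<Prod>\<sigma>\<in>S - {s}. \<sigma> x)"
    unfolding N_def using prod.remove[OF S(1) s(1), of "\<lambda>\<sigma>. \<sigma> x"] s(2)[OF x(1)] x(3) by simp
  then have "algebraic_int (N / x)" using int by (auto intro!: algebraic_int_prod)
  moreover have "of_nat (nat \<bar>k\<bar>) / x = N / x \<or> of_nat (nat \<bar>k\<bar>) / x = - (N / x)"
    unfolding k by (cases "k \<ge> 0") auto
  ultimately have "algebraic_int (of_nat (nat \<bar>k\<bar>) / x)" by (metis algebraic_int_minus)
  moreover have "real (nat \<bar>k\<bar>) = cmod N" by (simp add: k)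
  moreover have "cmod N \<le> B ^ card S"
    unfolding N_def prod_norm[symmetric] using B prod_mono[of S "\<lambda>\<sigma>. cmod (\<sigma> x)" "\<lambda>_. B"] by simp
  ultimately show ?thesis using \<open>k \<noteq> 0\<close> by (intro exI[of _ "nat \<bar>k\<bar>"]) auto
qed

lemma galois_small_zero:
  assumes G: "galois_field K S" and x: "x \<in> K" "algebraic_int x"
    and B: "\<And>\<sigma>. \<sigma> \<in> S \<Longrightarrow> cmod (\<sigma> x) < 1"
  shows "x = 0"
proof (rule ccontr)
  assume nz: "x \<noteq> 0"
  have fin: "finite S" and ne: "S \<noteq> {}" using G by (auto simp: galois_field_def)
  define b where "b = Max ((\<lambda>\<sigma>. cmod (\<sigma> x)) ` S)"
  have "b \<in> (\<lambda>\<sigma>. cmod (\<sigma> x)) ` S" unfolding b_def using fin ne by (intro Max_in) auto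
  then have b: "b < 1" "b \<ge> 0" using B by auto
  have "cmod (\<sigma> x) \<le> b" if "\<sigma> \<in> S" for \<sigma> unfolding b_def using fin that by auto
  then obtain q :: nat where "q \<ge> 1" "real q \<le> b ^ card S" using galois_norm[OF G x nz] by blast
  moreover have "b ^ card S < 1" using b fin ne by (intro power_less_one_iff[THEN iffD2]) (auto simp: card_gt_0_iff)
  ultimately show False by simp
qed

section \<open>Siegel's lemma with rational integer unknowns\<close>

lemma floor_eq_imp_close:
  fixes x y :: real
  assumes "\<lfloor>2 * x\<rfloor> = \<lfloor>2 * y\<rfloor>" shows "\<bar>x - y\<bar> < 1 / 2"
  using assms floor_correct[of "2 * x"] floor_correct[of "2 * y"] by linarith

lemma siegel:
  fixes \<alpha> :: "'i \<Rightarrow> nat \<Rightarrow> complex" and A n :: nat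
  assumes G: "galois_field K S" and I: "finite I"
    and aK: "\<And>i k. i \<in> I \<Longrightarrow> k < n \<Longrightarrow> \<alpha> i k \<in> K \<and> algebraic_int (\<alpha> i k)"
    and aA: "\<And>i k \<sigma>. i \<in> I \<Longrightarrow> k < n \<Longrightarrow> \<sigma> \<in> S \<Longrightarrow> cmod (\<sigma> (\<alpha> i k)) \<le> real A"
    and A: "A \<ge> 1" and n: "n > 0" "4 * card S * card I \<le> n"
  shows "\<exists>q::nat \<Rightarrow> int. (\<exists>k<n. q k \<noteq> 0) \<and> (\<forall>k. \<bar>q k\<bar> \<le> int (7 * n * A)) \<and>
           (\<forall>i\<in>I. (\<Sum>k<n. of_int (q k) * \<alpha> i k) = 0)"
proof -
  have K: "subfld K" and S: "finite S" "\<And>\<sigma>. \<sigma> \<in> S \<Longrightarrow> emb K \<sigma>" using G by (auto simp: galois_field_def)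
  define H where "H = 7 * n * A"
  define c where "c = int (2 * n * H * A + 1)"
  define D where "D = PiE {..<n} (\<lambda>_. {0..H})"
  define C where "C = PiE (I \<times> S \<times> (UNIV :: bool set)) (\<lambda>_. {-c..c})"
  define L where "L = (\<lambda>(q::nat \<Rightarrow> nat) i. (\<Sum>k<n. of_nat (q k) * \<alpha> i k))"
  define F where "F = (\<lambda>q. \<lambda>(i,\<sigma>,b)\<in>I \<times> S \<times> (UNIV :: bool set). \<lfloor>2 * (if b then Re else Im) (\<sigma> (L q i))\<rfloor>)"
  have Hge: "H \<ge> 1" using A n by (simp add: H_def)
  have sL: "\<sigma> (L q i) = (\<Sum>k<n. of_nat (q k) * \<sigma> (\<alpha> i k))" if "\<sigma> \<in> S" "i \<in> I" for \<sigma> q i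
  proof -
    have "\<sigma> (L q i) = (\<Sum>k<n. \<sigma> (of_nat (q k) * \<alpha> i k))"
      unfolding L_def using aK[OF that(2)] subfld_of_nat[OF K] K
      by (intro emb_sum[OF K S(2)[OF that(1)]]) (auto intro!: subfld_closed)
    then show ?thesis using aK[OF that(2)] subfld_of_nat[OF K]
      by (simp add: emb_mult[OF K S(2)[OF that(1)]] emb_of_nat[OF K S(2)[OF that(1)]])
  qed
  have bound: "cmod (\<sigma> (L q i)) \<le> real (n * H * A)" if "\<sigma> \<in> S" "i \<in> I" "q \<in> D" for \<sigma> q i
  proof -
    have "cmod (\<sigma> (L q i)) \<le> (\<Sum>k<n. real H * real A)"
      unfolding sL[OF that(1,2)]
    proof (rule sum_norm_le)
      fix k assume k: "k \<in> {..<n}"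
      then have "q k \<le> H" using that(3) by (auto simp: D_def PiE_def Pi_def)
      then show "cmod (of_nat (q k) * \<sigma> (\<alpha> i k)) \<le> real H * real A"
        using aA[OF that(2) _ that(1), of k] k by (auto simp: norm_mult intro!: mult_mono)
    qed
    then show ?thesis by simp
  qed
  have FC: "F q \<in> C" if q: "q \<in> D" for q
  proof -
    have "\<lfloor>2 * (if b then Re else Im) (\<sigma> (L q i))\<rfloor> \<in> {-c..c}" if "\<sigma> \<in> S" "i \<in> I" for \<sigma> i b
    proof -
      have "\<bar>(if b then Re else Im) (\<sigma> (L q i))\<bar> \<le> real (n * H * A)"
        using bound[OF that q] abs_Re_le_cmod[of "\<sigma> (L q i)"] abs_Im_le_cmod[of "\<sigma> (L q i)"] by auto
      moreover have "real_of_int c = 2 * real (n * H * A) + 1" by (simp add: c_def)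
      ultimately show ?thesis by (auto simp: floor_le_iff le_floor_iff abs_le_iff)
    qed
    then show ?thesis by (auto simp: F_def C_def PiE_def Pi_def)
  qed
  have "card C < card D"
  proof -
    have "card C = (nat (2 * c + 1)) ^ (card I * card S * 2)"
      unfolding C_def using I S by (subst card_PiE) (auto simp: card_cartesian_product mult_ac)
    also have "nat (2 * c + 1) \<le> H * H"
    proof -
      have "nat (2 * c + 1) = 4 * (n * A * H) + 3" by (simp add: c_def nat_add_distrib nat_mult_distrib)
      also have "\<dots> \<le> 7 * (n * A * H)" using Hge A n by simp
      also have "\<dots> = H * H" by (simp add: H_def algebra_simps)
      finally show ?thesis .
    qed
    then have "(nat (2 * c + 1)) ^ (card I * card S * 2) \<le> (H * H) ^ (card I * card S * 2)"
      by (rule power_mono) simp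
    also have "\<dots> = H ^ (4 * card S * card I)"
      by (simp flip: power2_eq_square power_mult add: mult_ac)
    also have "\<dots> \<le> H ^ n" using Hge n by (intro power_increasing)
    also have "\<dots> < (H + 1) ^ n" using n by (intro power_strict_mono) auto
    also have "\<dots> = card D" unfolding D_def by (subst card_PiE) auto
    finally show ?thesis .
  qed
  moreover have "finite C" unfolding C_def using I S by (intro finite_PiE) auto
  ultimately have "\<not> inj_on F D" using FC card_inj_on_le[of F D C] by auto
  then obtain q r where qr: "q \<in> D" "r \<in> D" "q \<noteq> r" "F q = F r" by (auto simp: inj_on_def)
  define p where "p = (\<lambda>k. if k < n then int (q k) - int (r k) else 0)"
  have "\<exists>k<n. p k \<noteq> 0"
  proof (rule ccontr)
    assume "\<not> ?thesis"
    then have "q k = r k" if "k < n" for k using that by (auto simp: p_def)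
    then have "q = r" using qr(1,2) unfolding D_def by (intro PiE_ext[of q]) auto
    then show False using qr by simp
  qed
  moreover have "\<bar>p k\<bar> \<le> int H" for k
    using qr(1,2) by (auto simp: p_def D_def PiE_def Pi_def abs_le_iff)
  moreover have "(\<Sum>k<n. of_int (p k) * \<alpha> i k) = 0" if i: "i \<in> I" for i
  proof (rule galois_small_zero[OF G])
    have e: "(\<Sum>k<n. of_int (p k) * \<alpha> i k) = L q i - L r i"
      by (simp add: L_def p_def algebra_simps flip: sum_subtractf)
    have LK: "L q i \<in> K" for q unfolding L_def using aK[OF i] subfld_of_nat[OF K] K
      by (intro subfld_sum) (auto intro!: subfld_closed)
    show "(\<Sum>k<n. of_int (p k) * \<alpha> i k) \<in> K" unfolding e using LK K by (intro subfld_diff)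
    show "algebraic_int (\<Sum>k<n. of_int (p k) * \<alpha> i k)"
      using aK[OF i] by (intro algebraic_int_sum algebraic_int_mult) auto
    fix \<sigma> assume s: "\<sigma> \<in> S"
    have fl: "\<lfloor>2 * (if b then Re else Im) (\<sigma> (L q i))\<rfloor> = \<lfloor>2 * (if b then Re else Im) (\<sigma> (L r i))\<rfloor>" for b
      using fun_cong[OF qr(4), of "(i, \<sigma>, b)"] i s by (simp add: F_def)
    let ?z = "\<sigma> (L q i) - \<sigma> (L r i)"
    have "\<bar>Re ?z\<bar> < 1 / 2" "\<bar>Im ?z\<bar> < 1 / 2"
      using floor_eq_imp_close[OF fl[of True, simplified]] floor_eq_imp_close[OF fl[of False, simplified]] by simp_all
    then have "cmod ?z < 1" using cmod_le[of ?z] by simp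
    then show "cmod (\<sigma> (\<Sum>k<n. of_int (p k) * \<alpha> i k)) < 1"
      unfolding e using emb_diff[OF K S(2)[OF s] LK LK] by simp
  qed
  ultimately show ?thesis unfolding H_def by blast
qed

section \<open>Supports and integrality of Laurent series\<close>

definition ordge :: "int \<Rightarrow> complex fls \<Rightarrow> bool" where
  "ordge a g \<longleftrightarrow> (\<forall>k<a. fls_nth g k = 0)"

definition pdeg :: "int \<Rightarrow> complex fls \<Rightarrow> bool" where
  "pdeg e g \<longleftrightarrow> (\<forall>k. fls_nth g k \<noteq> 0 \<longrightarrow> 0 \<le> k \<and> k \<le> e)"

definition int_fls :: "complex fls set" where
  "int_fls = {g. \<forall>k. algebraic_int (fls_nth g k)}"

lemma ordge_subdegree: "g \<noteq> 0 \<Longrightarrow> ordge a g \<Longrightarrow> a \<le> fls_subdegree g"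
  unfolding ordge_def by (metis not_le nth_fls_subdegree_nonzero)

lemma ordge_mono: "ordge a g \<Longrightarrow> b \<le> a \<Longrightarrow> ordge b g"
  by (auto simp: ordge_def)

lemma ordge_exists: "\<exists>a\<le>0. ordge a g"
  by (rule exI[of _ "min 0 (fls_subdegree g)"]) (auto simp: ordge_def)

lemma fls_mult_nth_ordge:
  assumes "ordge a f" "ordge b g"
  shows "fls_nth (f * g) n = (\<Sum>i=a..n-b. fls_nth f i * fls_nth g (n - i))"
proof (cases "f = 0 \<or> g = 0")
  case False
  then have "a \<le> fls_subdegree f" "b \<le> fls_subdegree g" using assms ordge_subdegree by auto
  then show ?thesis unfolding fls_times_nth(2)
    by (intro sum.mono_neutral_left) (force simp: not_le)+
qed auto

lemma ordge_mult: "ordge a f \<Longrightarrow> ordge b g \<Longrightarrow> ordge (a + b) (f * g)"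
  using fls_mult_nth_ordge[of a f b g] by (auto simp: ordge_def)

lemma ordge_mult_nth: "ordge a f \<Longrightarrow> ordge b g \<Longrightarrow> fls_nth (f * g) (a + b) = fls_nth f a * fls_nth g b"
  using fls_mult_nth_ordge[of a f b g "a + b"] by simp

lemma ordge_closed:
  "ordge a 0" "ordge a f \<Longrightarrow> ordge a g \<Longrightarrow> ordge a (f + g)"
  "ordge a f \<Longrightarrow> ordge a g \<Longrightarrow> ordge a (f - g)"
  "ordge a f \<Longrightarrow> ordge (a - 1) (fls_deriv f)"
  by (auto simp: ordge_def)

lemma ordge0_deriv:
  assumes "ordge 0 f" shows "ordge 0 (fls_deriv f)"
  unfolding ordge_def
proof (intro allI impI)
  fix k :: int assume "k < 0"
  then show "fls_nth (fls_deriv f) k = 0"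
    using assms by (cases "k = -1") (auto simp: ordge_def)
qed

lemma ordge_sum: "(\<And>i. i \<in> I \<Longrightarrow> ordge a (f i)) \<Longrightarrow> ordge a (sum f I)"
  by (auto simp: ordge_def fls_nth_sum intro!: sum.neutral)

lemma ordge_mult0: "ordge 0 f \<Longrightarrow> ordge a g \<Longrightarrow> ordge a (f * g)"
  using ordge_mult[of 0 f a g] by simp

lemma ordge_fls_of_nat: "ordge 0 (of_nat n)"
  by (simp add: ordge_def fls_of_nat_nth)

lemma pdeg_ordge: "pdeg e g \<Longrightarrow> ordge 0 g"
  by (auto simp: ordge_def pdeg_def)

lemma pdeg_closed:
  "pdeg e 0" "pdeg e f \<Longrightarrow> pdeg e g \<Longrightarrow> pdeg e (f + g)" "pdeg e f \<Longrightarrow> pdeg e g \<Longrightarrow> pdeg e (f - g)"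
  "pdeg 0 (of_nat n)"
proof -
  show "pdeg e f \<Longrightarrow> pdeg e g \<Longrightarrow> pdeg e (f + g)" "pdeg e f \<Longrightarrow> pdeg e g \<Longrightarrow> pdeg e (f - g)"
    unfolding pdeg_def by (metis add.right_neutral fls_plus_nth add_0, metis diff_zero fls_minus_nth diff_self)
qed (auto simp: pdeg_def fls_of_nat_nth)

lemma pdeg_deriv: "pdeg e f \<Longrightarrow> pdeg e (fls_deriv f)"
proof (unfold pdeg_def, intro allI impI)
  fix k assume f: "\<forall>k. fls_nth f k \<noteq> 0 \<longrightarrow> 0 \<le> k \<and> k \<le> e" and "fls_nth (fls_deriv f) k \<noteq> 0"
  then have "fls_nth f (k + 1) \<noteq> 0" by auto
  moreover have "k \<noteq> -1" using \<open>fls_nth (fls_deriv f) k \<noteq> 0\<close> by (intro notI) simp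
  ultimately show "0 \<le> k \<and> k \<le> e" using f by force
qed

lemma pdeg_mono: "pdeg e f \<Longrightarrow> e \<le> e' \<Longrightarrow> pdeg e' f"
  by (force simp: pdeg_def)

lemma pdeg_mult:
  assumes "pdeg a f" "pdeg b g" shows "pdeg (a + b) (f * g)"
proof (unfold pdeg_def, intro allI impI)
  fix n assume "fls_nth (f * g) n \<noteq> 0"
  then have "(\<Sum>i=0..n-0. fls_nth f i * fls_nth g (n - i)) \<noteq> 0"
    using fls_mult_nth_ordge[OF pdeg_ordge[OF assms(1)] pdeg_ordge[OF assms(2)]] by simp
  then obtain i where i: "i \<in> {0..n}" "fls_nth f i * fls_nth g (n - i) \<noteq> 0"
    by (metis (no_types, lifting) diff_zero sum.neutral)
  then have "i \<le> a" "n - i \<le> b" using assms by (auto simp: pdeg_def)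
  then show "0 \<le> n \<and> n \<le> a + b" using i by auto
qed

lemma pdeg_sum: "(\<And>i. i \<in> I \<Longrightarrow> pdeg a (f i)) \<Longrightarrow> pdeg a (sum f I)"
  by (induction I rule: infinite_finite_induct) (auto intro: pdeg_closed)

lemma fls_of_poly_nth: "fls_nth (fls_of_poly p) k = (if k < 0 then 0 else coeff p (nat k))"
  by (simp add: fls_of_poly_def)

lemma fls_of_poly_hom:
  "fls_of_poly 0 = 0" "fls_of_poly 1 = 1" "fls_of_poly (p + q) = fls_of_poly p + fls_of_poly q"
  "fls_of_poly (p - q) = fls_of_poly p - fls_of_poly q" "fls_of_poly (- p) = - fls_of_poly p"
  "fls_of_poly (p * q) = fls_of_poly p * fls_of_poly q"
  by (simp_all add: fls_of_poly_def fps_of_poly_add fps_of_poly_diff fps_of_poly_uminus fps_of_poly_mult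
      fls_times_fps_to_fls)

lemma fls_of_poly_inj: "fls_of_poly p = fls_of_poly q \<longleftrightarrow> p = q"
  by (simp add: fls_of_poly_def)

lemma fls_of_poly_eq_0: "fls_of_poly p = 0 \<longleftrightarrow> p = 0"
  using fls_of_poly_inj[of p 0] by (simp add: fls_of_poly_hom)

lemma fls_of_poly_deriv: "fls_deriv (fls_of_poly p) = fls_of_poly (pderiv p)"
  by (simp add: fls_of_poly_def fls_deriv_fps_to_fls fps_of_poly_pderiv)

lemma pdeg_fls_of_poly: "pdeg (int (degree p)) (fls_of_poly p)"
  by (auto simp: pdeg_def fls_of_poly_nth le_degree split: if_splits) (metis le_degree nat_le_iff)

lemma pdeg_imp_poly:
  assumes "pdeg e g"
  shows "\<exists>p. g = fls_of_poly p"
proof -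
  define p where "p = Abs_poly (\<lambda>i. fls_nth g (int i))"
  have "coeff p i = fls_nth g (int i)" for i
    unfolding p_def using assms by (subst coeff_Abs_poly[of "nat e"]) (auto simp: pdeg_def)
  then have "g = fls_of_poly p" using assms
    by (intro fls_eqI) (auto simp: fls_of_poly_nth pdeg_def)
  then show ?thesis ..
qed

lemma algebraic_int_fls_nth_mult:
  assumes "pdeg e f" "pdeg e' g" "f * g \<in> int_fls"
  shows "algebraic_int (fls_nth f i * fls_nth g j)"
proof -
  obtain p q where pq: "f = fls_of_poly p" "g = fls_of_poly q" using assms pdeg_imp_poly by blast
  have "algebraic_int (coeff (p * q) k)" for k
    using assms(3) unfolding pq fls_of_poly_hom(6)[symmetric] int_fls_def
    by (auto simp: fls_of_poly_nth dest!: spec[of _ "int k"])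
  from algebraic_int_coeff_mult[OF this] show ?thesis by (auto simp: pq fls_of_poly_nth)
qed

lemma int_fls_closed:
  "0 \<in> int_fls" "f \<in> int_fls \<Longrightarrow> g \<in> int_fls \<Longrightarrow> f + g \<in> int_fls"
  "f \<in> int_fls \<Longrightarrow> g \<in> int_fls \<Longrightarrow> f - g \<in> int_fls" "of_int k \<in> int_fls" "of_nat n \<in> int_fls" "1 \<in> int_fls"
  by (auto simp: int_fls_def fls_of_int_nth fls_of_nat_nth)

lemma int_fls_mult: "f \<in> int_fls \<Longrightarrow> g \<in> int_fls \<Longrightarrow> f * g \<in> int_fls"
  by (auto simp: int_fls_def fls_times_nth(2) intro!: algebraic_int_sum algebraic_int_mult)

lemma int_fls_sum: "(\<And>i. i \<in> I \<Longrightarrow> f i \<in> int_fls) \<Longrightarrow> sum f I \<in> int_fls"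
  by (induction I rule: infinite_finite_induct) (auto intro: int_fls_closed)

lemma int_fls_prod: "(\<And>i. i \<in> I \<Longrightarrow> f i \<in> int_fls) \<Longrightarrow> prod f I \<in> int_fls"
  by (induction I rule: infinite_finite_induct) (auto intro: int_fls_closed int_fls_mult)

lemma int_fls_power: "f \<in> int_fls \<Longrightarrow> f ^ n \<in> int_fls"
  by (induction n) (auto intro: int_fls_closed int_fls_mult)

lemma fls_fact: "(fact n :: complex fls) = fls_const (fact n)"
  using fls_of_nat[of "fact n", where 'a = complex] by simp

lemma fls_fact_nz: "(fact n :: complex fls) \<noteq> 0"
  unfolding fls_fact by (metis fact_nonzero fls_const_0 fls_const_nonzero)

lemma fls_nth_divide_fact:
  fixes g :: "complex fls"
  shows "fls_nth (g / fact n) k = fls_nth g k / fact n"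
proof -
  have "fls_nth ((g / fact n) * fact n) k = fls_nth (g / fact n) k * fact n"
    by (metis fls_fact fls_mult_const_nth(2))
  then show ?thesis using fls_fact_nz[of n] by simp
qed

lemma fls_deriv_divide_fact:
  fixes g :: "complex fls"
  shows "fls_deriv (g / fact n) = fls_deriv g / fact n"
  by (rule fls_eqI) (simp add: fls_nth_divide_fact)

lemma ordge_divide_fact: "ordge a g \<Longrightarrow> ordge a (g / fact n)"
  by (simp add: ordge_def fls_nth_divide_fact)

lemma pdeg_divide_fact: "pdeg a g \<Longrightarrow> pdeg a (g / fact n)"
  by (simp add: pdeg_def fls_nth_divide_fact)

section \<open>Divided derivatives\<close>

definition hasse :: "nat \<Rightarrow> complex fls \<Rightarrow> complex fls" where
  "hasse k g = (fls_deriv ^^ k) g / fact k"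

lemma hasse_0 [simp]: "hasse 0 g = g"
  by (simp add: hasse_def)

lemma fls_nth_higher_deriv:
  fixes g :: "complex fls"
  shows "fls_nth ((fls_deriv ^^ k) g) l = pochhammer (of_int (l + 1)) k * fls_nth g (l + int k)"
proof (induction k arbitrary: l)
  case (Suc k)
  have "fls_nth ((fls_deriv ^^ Suc k) g) l = of_int (l + 1) * fls_nth ((fls_deriv ^^ k) g) (l + 1)" by simp
  also have "\<dots> = of_int (l + 1) * pochhammer (of_int (l + 1) + 1) k * fls_nth g (l + 1 + int k)"
    unfolding Suc.IH by simp
  also have "of_int (l + 1) * pochhammer (of_int (l + 1) + 1) k = pochhammer (of_int (l + 1) :: complex) (Suc k)"
    by (simp add: pochhammer_rec)
  finally show ?case by (simp add: add_ac)
qed simp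

lemma fls_nth_hasse:
  "\<exists>c::int. fls_nth (hasse k g) l = of_int c * fls_nth g (l + int k)"
proof -
  obtain c where c: "pochhammer (l + 1) k = fact k * c" using fact_dvd_pochhammer[of k "l + 1"] by (elim dvdE)
  have "pochhammer (of_int (l + 1) :: complex) k = of_int (pochhammer (l + 1) k)"
    by (rule pochhammer_of_int)
  also have "\<dots> = fact k * of_int c" by (simp add: c)
  finally show ?thesis by (intro exI[of _ c]) (simp add: hasse_def fls_nth_divide_fact fls_nth_higher_deriv del: of_int_add)
qed

lemma hasse_int: "g \<in> int_fls \<Longrightarrow> hasse k g \<in> int_fls"
  unfolding int_fls_def using fls_nth_hasse by (auto intro!: algebraic_int_mult) (metis algebraic_int_mult algebraic_int_of_int)

lemma higher_deriv_mult:
  fixes f g :: "complex fls"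
  shows "(fls_deriv ^^ k) (f * g) = (\<Sum>i\<le>k. of_nat (k choose i) * (fls_deriv ^^ i) f * (fls_deriv ^^ (k - i)) g)"
proof (induction k)
  case (Suc k)
  let ?F = "\<lambda>i j. (fls_deriv ^^ i) f * (fls_deriv ^^ j) g"
  have "(fls_deriv ^^ Suc k) (f * g) = (\<Sum>i\<le>k. of_nat (k choose i) * (?F (Suc i) (k - i) + ?F i (Suc k - i)))"
    by (auto simp: Suc.IH fls_deriv_sum Suc_diff_le algebra_simps intro!: sum.cong)
  also have "\<dots> = (\<Sum>i\<le>k. of_nat (k choose i) * ?F (Suc i) (k - i)) + (\<Sum>i\<le>k. of_nat (k choose i) * ?F i (Suc k - i))"
    by (simp add: distrib_left sum.distrib)
  also have "(\<Sum>i\<le>k. of_nat (k choose i) * ?F i (Suc k - i)) = (\<Sum>i\<le>Suc k. of_nat (k choose i) * ?F i (Suc k - i))"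
    by simp
  also have "\<dots> = ?F 0 (Suc k) + (\<Sum>i\<le>k. of_nat (k choose Suc i) * ?F (Suc i) (k - i))"
    by (subst sum.atMost_Suc_shift) simp
  also have "(\<Sum>i\<le>k. of_nat (k choose i) * ?F (Suc i) (k - i)) + (?F 0 (Suc k) + (\<Sum>i\<le>k. of_nat (k choose Suc i) * ?F (Suc i) (k - i)))
      = (\<Sum>i\<le>Suc k. of_nat (Suc k choose i) * ?F i (Suc k - i))"
    by (subst sum.atMost_Suc_shift) (simp add: sum.distrib algebra_simps)
  finally show ?case by (simp add: mult.assoc)
qed simp

lemma hasse_mult: "hasse k (f * g) = (\<Sum>i\<le>k. hasse i f * hasse (k - i) g)"
proof -
  have "of_nat (k choose i) * x * y / fact k = (x / fact i) * (y / fact (k - i))" if "i \<le> k" for i and x y :: "complex fls"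
  proof -
    have "(fact k :: complex fls) = fact i * fact (k - i) * of_nat (k choose i)"
      using binomial_fact_lemma[OF that] by (metis of_nat_fact of_nat_mult)
    moreover have "of_nat (k choose i) \<noteq> (0 :: complex fls)" using that by simp
    ultimately show ?thesis using fls_fact_nz by (simp add: field_simps)
  qed
  then show ?thesis
    unfolding hasse_def higher_deriv_mult by (simp add: sum_divide_distrib)
qed

lemma hasse_integral_pole:
  assumes T: "T \<in> int_fls"
  shows "T ^ m * g \<in> int_fls \<Longrightarrow> T ^ (m + k) * hasse k g \<in> int_fls"
proof (induction m arbitrary: g k)
  case 0
  then show ?case using T by (auto intro!: int_fls_mult int_fls_power hasse_int)
next
  case (Suc m)
  have u: "T ^ m * (T * g) \<in> int_fls" using Suc.prems by (simp add: mult_ac)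
  show ?case
  proof (induction k rule: less_induct)
    case (less k)
    have "hasse k (T * g) = T * hasse k g + (\<Sum>i=1..k. hasse i T * hasse (k - i) g)"
      unfolding hasse_mult by (simp add: atMost_atLeast0 sum.atLeast_Suc_atMost)
    then have "T ^ (m + k) * (T * hasse k g) =
        T ^ (m + k) * hasse k (T * g) - (\<Sum>i=1..k. T ^ (m + k) * (hasse i T * hasse (k - i) g))"
      by (simp add: algebra_simps sum_distrib_left)
    moreover have "T ^ (m + k) * (hasse i T * hasse (k - i) g) \<in> int_fls" if "i \<in> {1..k}" for i
    proof -
      have e1: "T ^ (m + k) * (hasse i T * hasse (k - i) g)
          = T ^ (i - 1) * hasse i T * (T ^ (Suc m + (k - i)) * hasse (k - i) g)"
      proof -
        have e: "m + k = (i - 1) + (Suc m + (k - i))" using that by auto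
        show ?thesis by (subst e) (simp only: power_add mult_ac)
      qed
      show ?thesis unfolding e1
        by (rule int_fls_mult[OF int_fls_mult[OF int_fls_power[OF T] hasse_int[OF T]]], rule less.IH)
          (use that in auto)
    qed
    ultimately have "T ^ (m + k) * (T * hasse k g) \<in> int_fls"
      using Suc.IH[OF u, of k] by (auto intro!: int_fls_closed int_fls_sum)
    then show ?case by (simp add: mult_ac)
  qed
qed

section \<open>The connection attached to the system\<close>

definition vderiv :: "complex fls ^ 'n \<Rightarrow> complex fls ^ 'n" where
  "vderiv w = (\<chi> i. fls_deriv (w $ i))"

definition nabla :: "complex fls ^ 'n ^ 'n \<Rightarrow> complex fls ^ 'n \<Rightarrow> complex fls ^ 'n" where
  "nabla G w = vderiv w - G *v w"

lemma vderiv_add: "vderiv (v + w) = vderiv v + vderiv w"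
  and vderiv_diff: "vderiv (v - w) = vderiv v - vderiv w"
  and vderiv_of_int: "vderiv (of_int c *s w) = of_int c *s vderiv w"
  and vderiv_scale: "vderiv (g *s w) = fls_deriv g *s w + g *s vderiv w"
  by (auto simp: vderiv_def vec_eq_iff algebra_simps)

lemma vderiv_sum: "vderiv (\<Sum>i\<in>I. w i) = (\<Sum>i\<in>I. vderiv (w i))"
  by (induction I rule: infinite_finite_induct) (auto simp: vderiv_add, auto simp: vderiv_def vec_eq_iff)

lemma vderiv_mult_vec: "vderiv (A *v w) = matrix_deriv A *v w + A *v vderiv w"
  by (auto simp: vderiv_def matrix_deriv_def matrix_vector_mult_def vec_eq_iff fls_deriv_sum sum.distrib)

lemma vderiv_funpow_nth: "(vderiv ^^ k) w $ i = (fls_deriv ^^ k) (w $ i)"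
  by (induction k) (auto simp: vderiv_def)

lemma nabla_diff: "nabla G (v - w) = nabla G v - nabla G w"
  and nabla_scale: "nabla G (g *s w) = fls_deriv g *s w + g *s nabla G w"
  by (auto simp: nabla_def vderiv_add vderiv_diff vderiv_scale matrix_vector_right_distrib
      matrix_vector_mult_diff_distrib vector_scalar_commute vector_ssub_ldistrib algebra_simps)

lemma nabla_funpow_diff: "(nabla G ^^ k) (v - w) = (nabla G ^^ k) v - (nabla G ^^ k) w"
  by (induction k) (auto simp: nabla_diff)

lemma nabla_funpow_solution:
  assumes "nabla G f = 0"
  shows "(nabla G ^^ k) (g *s f) = (fls_deriv ^^ k) g *s f"
  by (induction k) (auto simp: nabla_scale assms)

lemma alternating_binomial_step:
  fixes F :: "nat \<Rightarrow> nat \<Rightarrow> complex fls ^ 'n"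
  shows "(\<Sum>j\<le>s. of_int ((-1) ^ j * int (s choose j)) *s F (Suc (s - j)) j)
      - (\<Sum>j\<le>s. of_int ((-1) ^ j * int (s choose j)) *s F (s - j) (Suc j))
      = (\<Sum>j\<le>Suc s. of_int ((-1) ^ j * int (Suc s choose j)) *s F (Suc s - j) j)"
proof -
  have "(\<Sum>j\<le>s. of_int ((-1) ^ j * int (s choose j)) *s F (Suc (s - j)) j)
      = (\<Sum>j\<le>Suc s. of_int ((-1) ^ j * int (s choose j)) *s F (Suc s - j) j)"
    by (simp add: Suc_diff_le binomial_eq_0)
  also have "\<dots> = F (Suc s) 0 + (\<Sum>j\<le>s. of_int ((-1) ^ Suc j * int (s choose Suc j)) *s F (s - j) (Suc j))"
    by (subst sum.atMost_Suc_shift) simp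
  finally have 1: "(\<Sum>j\<le>s. of_int ((-1) ^ j * int (s choose j)) *s F (Suc (s - j)) j)
     = F (Suc s) 0 + (\<Sum>j\<le>s. of_int ((-1) ^ Suc j * int (s choose Suc j)) *s F (s - j) (Suc j))" .
  show ?thesis unfolding 1
    by (subst sum.atMost_Suc_shift)
      (simp add: vec_eq_iff algebra_simps flip: sum_subtractf sum.distrib)
qed

text \<open>The iterated matrix represents \<open>(vderiv - nabla) ^^ s\<close>, with the derivations ordered to the left.\<close>

lemma iterated_matrix_mult_vec:
  "iterated_matrix G s *v w =
    (\<Sum>j\<le>s. of_int ((-1) ^ j * int (s choose j)) *s (vderiv ^^ (s - j)) ((nabla G ^^ j) w))"
proof (induction s arbitrary: w)
  case (Suc s)
  have "iterated_matrix G (Suc s) *v w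
      = iterated_matrix G s *v (G *v w) + matrix_deriv (iterated_matrix G s) *v w"
    by (simp add: matrix_vector_mult_add_rdistrib matrix_vector_mul_assoc)
  also have "\<dots> = vderiv (iterated_matrix G s *v w) - iterated_matrix G s *v nabla G w"
    by (simp add: vderiv_mult_vec nabla_def matrix_vector_mult_diff_distrib algebra_simps)
  also have "vderiv (iterated_matrix G s *v w)
      = (\<Sum>j\<le>s. of_int ((-1) ^ j * int (s choose j)) *s (vderiv ^^ Suc (s - j)) ((nabla G ^^ j) w))"
    by (simp only: Suc.IH vderiv_sum vderiv_of_int funpow.simps o_apply)
  also have "iterated_matrix G s *v nabla G w
      = (\<Sum>j\<le>s. of_int ((-1) ^ j * int (s choose j)) *s (vderiv ^^ (s - j)) ((nabla G ^^ Suc j) w))"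
    by (simp add: Suc.IH funpow_swap1)
  also note alternating_binomial_step[of s "\<lambda>i j. (vderiv ^^ i) ((nabla G ^^ j) w)"]
  finally show ?case .
qed simp

definition nabla_divided :: "complex fls ^ 'n ^ 'n \<Rightarrow> nat \<Rightarrow> complex fls ^ 'n \<Rightarrow> complex fls ^ 'n" where
  "nabla_divided G m w = (\<chi> i. (nabla G ^^ m) w $ i / fact m)"

lemma iterated_matrix_nabla_divided:
  "(iterated_matrix G s *v nabla_divided G h w) $ i / fact s =
    (\<Sum>j\<le>s. of_int ((-1) ^ j * int ((h + j) choose j)) * hasse (s - j) (nabla_divided G (h + j) w $ i))"
proof -
  let ?c = "(1 / fact h) :: complex fls"
  have scale: "(nabla G ^^ j) (?c *s v) = ?c *s (nabla G ^^ j) v" for j v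
  proof -
    have "fls_deriv ?c = 0" by (metis fls_deriv_divide_fact fls_deriv_one div_0)
    then show ?thesis by (induction j) (auto simp: nabla_scale)
  qed
  have Dscale: "(fls_deriv ^^ j) (x / fact h) = (fls_deriv ^^ j) x / fact h" for j and x :: "complex fls"
    by (induction j) (auto simp: fls_deriv_divide_fact)
  have nd: "nabla_divided G h w = ?c *s (nabla G ^^ h) w"
    by (simp add: nabla_divided_def vec_eq_iff)
  have "(iterated_matrix G s *v nabla_divided G h w) $ i / fact s
     = (\<Sum>j\<le>s. of_int ((-1) ^ j * int (s choose j)) * ((fls_deriv ^^ (s - j)) ((nabla G ^^ (j + h)) w $ i) / fact h) / fact s)"
    unfolding iterated_matrix_mult_vec nabla_divided_def
    by (simp add: sum_divide_distrib vderiv_funpow_nth)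
       (simp add: nabla_divided_def[symmetric] nd scale Dscale funpow_add o_def)
  also have "\<dots> = (\<Sum>j\<le>s. of_int ((-1) ^ j * int ((h + j) choose j)) * hasse (s - j) (nabla_divided G (h + j) w $ i))"
  proof (rule sum.cong[OF refl])
    fix j assume "j \<in> {..s}"
    then have j: "j \<le> s" by simp
    let ?x = "(fls_deriv ^^ (s - j)) ((nabla G ^^ (j + h)) w $ i)"
    have "(fls_deriv ^^ k) (x / fact m) = (fls_deriv ^^ k) x / fact m" for k m and x :: "complex fls"
      by (induction k) (auto simp: fls_deriv_divide_fact)
    then have "hasse (s - j) (nabla_divided G (h + j) w $ i) = ?x / fact (h + j) / fact (s - j)"
      by (simp add: hasse_def nabla_divided_def add.commute)
    moreover have "of_nat (s choose j) * (?x / fact h) / fact s = of_nat ((h + j) choose j) * (?x / fact (h + j) / fact (s - j))"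
    proof -
      have "(fact s :: complex fls) = fact j * fact (s - j) * of_nat (s choose j)"
        using binomial_fact_lemma[OF j] by (metis of_nat_fact of_nat_mult)
      moreover have "(fact (h + j) :: complex fls) = fact j * fact h * of_nat ((h + j) choose j)"
        using binomial_fact_lemma[of j "h + j"] by (metis add_diff_cancel_right' le_add2 of_nat_fact of_nat_mult)
      moreover have "of_nat (s choose j) \<noteq> (0 :: complex fls)" "of_nat ((h + j) choose j) \<noteq> (0 :: complex fls)"
        using j by simp_all
      ultimately show ?thesis using fls_fact_nz by (simp add: field_simps)
    qed
    moreover have "of_int ((-1) ^ j * int (s choose j)) * (?x / fact h) / fact s
        = of_int ((-1) ^ j) * (of_nat (s choose j) * (?x / fact h) / fact s)"
      by simp
    ultimately show "of_int ((-1) ^ j * int (s choose j)) * (?x / fact h) / fact s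
      = of_int ((-1) ^ j * int ((h + j) choose j)) * hasse (s - j) (nabla_divided G (h + j) w $ i)"
      by (simp only: of_int_mult of_int_of_nat_eq mult.assoc)
  qed
  finally show ?thesis .
qed

lemma power_nabla_Suc:
  "T ^ Suc m * (nabla G ^^ Suc m) w $ i = T * fls_deriv (T ^ m * (nabla G ^^ m) w $ i)
     - of_nat m * fls_deriv T * (T ^ m * (nabla G ^^ m) w $ i)
     - (\<Sum>j\<in>UNIV. T * G $ i $ j * (T ^ m * (nabla G ^^ m) w $ j))"
proof -
  have T: "T * fls_deriv (T ^ m) = of_nat m * T ^ m * fls_deriv T"
    by (subst fls_deriv_power) (cases m; simp add: mult_ac)
  have key: "T * fls_deriv (T ^ m * x) = of_nat m * fls_deriv T * (T ^ m * x) + T ^ Suc m * fls_deriv x" for x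
    using arg_cong[OF T, of "\<lambda>y. y * x"] by (simp add: algebra_simps)
  then show ?thesis
    by (simp add: key) (simp add: nabla_def vderiv_def matrix_vector_mult_def right_diff_distrib sum_distrib_left mult_ac)
qed

lemma pdeg_power_nabla:
  assumes T: "pdeg t T" and TG: "\<And>i j. pdeg t (T * G $ i $ j)" and w: "\<And>i. pdeg N (w $ i)"
  shows "pdeg (N + int m * t) (T ^ m * (nabla G ^^ m) w $ i)"
proof (induction m arbitrary: i)
  case (Suc m)
  have e: "N + int (Suc m) * t = t + (N + int m * t)" by (simp add: algebra_simps)
  have "pdeg (0 + t) (of_nat m * fls_deriv T)"
    by (rule pdeg_mult[OF pdeg_closed(4) pdeg_deriv[OF T]])
  then show ?case unfolding power_nabla_Suc e
    by (intro pdeg_closed pdeg_sum pdeg_mult T TG Suc.IH pdeg_deriv) auto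
qed (use w in simp)

lemma ordge_power_nabla:
  assumes T: "ordge 0 T" and TG: "\<And>i j. ordge 0 (T * G $ i $ j)" and w: "\<And>i. ordge a (w $ i)"
  shows "ordge (a - int m) (T ^ m * (nabla G ^^ m) w $ i)"
proof (induction m arbitrary: i)
  case (Suc m)
  have e: "a - int (Suc m) = a - int m - 1" by simp
  have T': "ordge 0 (of_nat m * fls_deriv T)"
    using ordge_mult0[OF ordge_fls_of_nat ordge0_deriv[OF T]] .
  have le: "a - int m - 1 \<le> a - int m" by simp
  show ?case unfolding power_nabla_Suc e
    by (intro ordge_closed ordge_sum ordge_mult0 T TG T' Suc.IH ordge_mono[OF Suc.IH le])
qed (use w in simp)

section \<open>The field of rational functions with algebraic coefficients\<close>

lemma alg_polys_eq: "alg_polys = polys_over {x. algebraic x}"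
  by (simp add: alg_polys_def polys_over_def)

lemmas alg_polys_closed = polys_over_closed[OF subfld_algebraic, folded alg_polys_eq]

lemma alg_ratfunsI:
  "p \<in> alg_polys \<Longrightarrow> q \<in> alg_polys \<Longrightarrow> q \<noteq> 0 \<Longrightarrow> fls_of_poly p / fls_of_poly q \<in> alg_ratfuns"
  by (auto simp: alg_ratfuns_def)

lemma alg_ratfunsE:
  assumes "x \<in> alg_ratfuns"
  obtains p q where "p \<in> alg_polys" "q \<in> alg_polys" "q \<noteq> 0" "x = fls_of_poly p / fls_of_poly q"
  using assms by (auto simp: alg_ratfuns_def)

lemma alg_ratfuns_of_poly: "p \<in> alg_polys \<Longrightarrow> fls_of_poly p \<in> alg_ratfuns"
  using alg_ratfunsI[of p 1] alg_polys_closed by (auto simp: fls_of_poly_hom)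

lemma alg_ratfuns_closed:
  "0 \<in> alg_ratfuns" "1 \<in> alg_ratfuns"
  "x \<in> alg_ratfuns \<Longrightarrow> y \<in> alg_ratfuns \<Longrightarrow> x + y \<in> alg_ratfuns"
  "x \<in> alg_ratfuns \<Longrightarrow> y \<in> alg_ratfuns \<Longrightarrow> x * y \<in> alg_ratfuns"
  "x \<in> alg_ratfuns \<Longrightarrow> - x \<in> alg_ratfuns"
  "x \<in> alg_ratfuns \<Longrightarrow> inverse x \<in> alg_ratfuns"
proof -
  show "0 \<in> alg_ratfuns" "1 \<in> alg_ratfuns"
    using alg_ratfuns_of_poly[of 0] alg_ratfuns_of_poly[of 1] alg_polys_closed by (auto simp: fls_of_poly_hom)
  show "- x \<in> alg_ratfuns" if "x \<in> alg_ratfuns"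
    using that
  proof (elim alg_ratfunsE)
    fix p q assume "p \<in> alg_polys" "q \<in> alg_polys" "q \<noteq> 0" "x = fls_of_poly p / fls_of_poly q"
    then show ?thesis using alg_ratfunsI[of "-p" q] alg_polys_closed by (simp add: fls_of_poly_hom)
  qed
  show "inverse x \<in> alg_ratfuns" if "x \<in> alg_ratfuns"
    using that
  proof (elim alg_ratfunsE)
    fix p q assume "p \<in> alg_polys" "q \<in> alg_polys" "q \<noteq> 0" "x = fls_of_poly p / fls_of_poly q"
    then show ?thesis using alg_ratfunsI[of q p] \<open>0 \<in> alg_ratfuns\<close>
      by (cases "p = 0") (auto simp: fls_of_poly_hom)
  qed
  have "x + y \<in> alg_ratfuns \<and> x * y \<in> alg_ratfuns" if "x \<in> alg_ratfuns" "y \<in> alg_ratfuns"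
    using that
  proof (elim alg_ratfunsE)
    fix p q p' q' assume 1: "p \<in> alg_polys" "q \<in> alg_polys" "q \<noteq> 0" "x = fls_of_poly p / fls_of_poly q"
      and 2: "p' \<in> alg_polys" "q' \<in> alg_polys" "q' \<noteq> 0" "y = fls_of_poly p' / fls_of_poly q'"
    have "x + y = fls_of_poly (p * q' + p' * q) / fls_of_poly (q * q')"
      using 1 2 by (simp add: fls_of_poly_hom fls_of_poly_eq_0 field_simps)
    also have "\<dots> \<in> alg_ratfuns" using 1 2 by (intro alg_ratfunsI alg_polys_closed) auto
    finally have sum: "x + y \<in> alg_ratfuns" .
    have "x * y = fls_of_poly (p * p') / fls_of_poly (q * q')"
      using 1 2 by (simp add: fls_of_poly_hom)
    also have "\<dots> \<in> alg_ratfuns" using 1 2 by (intro alg_ratfunsI alg_polys_closed) auto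
    finally show ?thesis using sum by blast
  qed
  then show "x \<in> alg_ratfuns \<Longrightarrow> y \<in> alg_ratfuns \<Longrightarrow> x + y \<in> alg_ratfuns"
    "x \<in> alg_ratfuns \<Longrightarrow> y \<in> alg_ratfuns \<Longrightarrow> x * y \<in> alg_ratfuns" by blast+
qed

lemma alg_ratfuns_minus: "x \<in> alg_ratfuns \<Longrightarrow> y \<in> alg_ratfuns \<Longrightarrow> x - y \<in> alg_ratfuns"
  using alg_ratfuns_closed(3)[of x "-y"] alg_ratfuns_closed(5)[of y] by simp

lemma alg_ratfuns_divide: "x \<in> alg_ratfuns \<Longrightarrow> y \<in> alg_ratfuns \<Longrightarrow> x / y \<in> alg_ratfuns"
  unfolding divide_inverse by (intro alg_ratfuns_closed)

lemma alg_ratfuns_deriv: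
  assumes "x \<in> alg_ratfuns" shows "fls_deriv x \<in> alg_ratfuns"
proof -
  obtain p q where pq: "p \<in> alg_polys" "q \<in> alg_polys" "q \<noteq> 0" "x = fls_of_poly p / fls_of_poly q"
    using assms by (elim alg_ratfunsE)
  have "x * fls_of_poly q = fls_of_poly p" using pq by (simp add: fls_of_poly_eq_0)
  then have "fls_deriv (x * fls_of_poly q) = fls_deriv (fls_of_poly p)" by simp
  then have "fls_deriv x = (fls_of_poly (pderiv p) - x * fls_of_poly (pderiv q)) / fls_of_poly q"
    using pq(3) by (simp add: fls_of_poly_deriv fls_of_poly_eq_0 field_simps)
  then show ?thesis using pq assms
    by (auto intro!: alg_ratfuns_divide alg_ratfuns_minus alg_ratfuns_closed alg_ratfuns_of_poly alg_polys_closed)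
qed

typedef ratfun = alg_ratfuns
  morphisms rf Abs_ratfun
  using alg_ratfuns_closed(1) by blast

setup_lifting type_definition_ratfun

instantiation ratfun :: field
begin

lift_definition zero_ratfun :: ratfun is 0 by (rule alg_ratfuns_closed)
lift_definition one_ratfun :: ratfun is 1 by (rule alg_ratfuns_closed)
lift_definition plus_ratfun :: "ratfun \<Rightarrow> ratfun \<Rightarrow> ratfun" is "(+)" by (rule alg_ratfuns_closed)
lift_definition times_ratfun :: "ratfun \<Rightarrow> ratfun \<Rightarrow> ratfun" is "(*)" by (rule alg_ratfuns_closed)
lift_definition uminus_ratfun :: "ratfun \<Rightarrow> ratfun" is uminus by (rule alg_ratfuns_closed)
lift_definition inverse_ratfun :: "ratfun \<Rightarrow> ratfun" is inverse by (rule alg_ratfuns_closed)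
lift_definition minus_ratfun :: "ratfun \<Rightarrow> ratfun \<Rightarrow> ratfun" is "(-)" by (rule alg_ratfuns_minus)
lift_definition divide_ratfun :: "ratfun \<Rightarrow> ratfun \<Rightarrow> ratfun" is "(/)" by (rule alg_ratfuns_divide)

instance
  by standard (transfer; simp add: algebra_simps divide_inverse)+

end

lift_definition rderiv :: "ratfun \<Rightarrow> ratfun" is fls_deriv by (rule alg_ratfuns_deriv)

lemma rf_simps [simp]:
  "rf 0 = 0" "rf 1 = 1" "rf (x + y) = rf x + rf y" "rf (x - y) = rf x - rf y" "rf (- x) = - rf x"
  "rf (x * y) = rf x * rf y" "rf (rderiv x) = fls_deriv (rf x)"
  by (transfer; simp)+

lemma rf_inject0 [simp]: "rf x = 0 \<longleftrightarrow> x = 0"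
  by transfer simp

lemma rf_sum [simp]: "rf (sum g I) = (\<Sum>i\<in>I. rf (g i))"
  by (induction I rule: infinite_finite_induct) auto

lemma rf_prod [simp]: "rf (prod g I) = (\<Prod>i\<in>I. rf (g i))"
  by (induction I rule: infinite_finite_induct) auto

lemma rderiv_simps [simp]:
  "rderiv 0 = 0" "rderiv (x + y) = rderiv x + rderiv y" "rderiv (x * y) = rderiv x * y + x * rderiv y"
  by (transfer; simp add: algebra_simps)+

lemma rderiv_sum: "rderiv (sum g I) = (\<Sum>i\<in>I. rderiv (g i))"
  by (induction I rule: infinite_finite_induct) auto

lemma rf_exists: "x \<in> alg_ratfuns \<Longrightarrow> \<exists>r. rf r = x"
  using Abs_ratfun_inverse by blast

section \<open>Indicial equation of a linear differential operator\<close>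

definition diffop :: "(nat \<Rightarrow> complex fls) \<Rightarrow> nat \<Rightarrow> complex fls \<Rightarrow> complex fls" where
  "diffop c r v = (\<Sum>k\<le>r. c k * (fls_deriv ^^ k) v)"

lemma higher_deriv_diff: "(fls_deriv ^^ k) (u - v) = (fls_deriv ^^ k) u - (fls_deriv ^^ k) (v :: complex fls)"
  by (induction k) auto

lemma diffop_diff: "diffop c r (u - v) = diffop c r u - diffop c r v"
  by (simp add: diffop_def higher_deriv_diff algebra_simps sum_subtractf)

lemma fls_nth_higher_deriv_falling:
  fixes v :: "complex fls"
  shows "fls_nth ((fls_deriv ^^ k) v) (m - int k) = (\<Prod>i<k. of_int m - of_nat i) * fls_nth v m"
  by (induction k) (auto simp: algebra_simps)

lemma ordge_higher_deriv: "ordge m v \<Longrightarrow> ordge (m - int k) ((fls_deriv ^^ k) v)"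
proof (induction k)
  case (Suc k)
  have e: "m - int (Suc k) = m - int k - 1" by simp
  show ?case unfolding e using ordge_closed(4)[OF Suc.IH[OF Suc.prems]] by simp
qed simp

lemma finite_int_zeros_falling:
  fixes a :: "nat \<Rightarrow> complex"
  assumes "k0 \<le> r" "a k0 \<noteq> 0"
  shows "finite {m::int. (\<Sum>k\<le>r. a k * (\<Prod>i<k. of_int m - of_nat i)) = 0}"
proof -
  define p where "p = (\<Sum>k\<le>r. smult (a k) (\<Prod>i<k. [:- of_nat i, 1:]))"
  have ev: "poly p x = (\<Sum>k\<le>r. a k * (\<Prod>i<k. x - of_nat i))" for x
    by (simp add: p_def poly_sum poly_prod)
  define j where "j = (LEAST k. a k \<noteq> 0)"
  have j: "a j \<noteq> 0" "\<And>k. k < j \<Longrightarrow> a k = 0" "j \<le> r"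
    unfolding j_def using assms LeastI[of "\<lambda>k. a k \<noteq> 0" k0] not_less_Least Least_le[of "\<lambda>k. a k \<noteq> 0" k0]
    by (auto intro: order_trans)
  have "poly p (of_nat j) = (\<Sum>k\<in>{j}. a k * (\<Prod>i<k. of_nat j - of_nat i))"
    unfolding ev
  proof (rule sum.mono_neutral_right)
    show "\<forall>k\<in>{..r} - {j}. a k * (\<Prod>i<k. of_nat j - of_nat i :: complex) = 0"
    proof
      fix k assume "k \<in> {..r} - {j}"
      then consider "k < j" | "j < k" by fastforce
      then show "a k * (\<Prod>i<k. of_nat j - of_nat i :: complex) = 0"
        by cases (use j(2) in \<open>auto intro!: prod_zero bexI[of _ j]\<close>)
    qed
  qed (use j in auto)
  also have "\<dots> \<noteq> 0" using j(1) by (auto simp flip: of_nat_diff)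
  finally have "p \<noteq> 0" by auto
  then have "finite {x. poly p x = 0}" by (rule poly_roots_finite)
  then have "finite ((of_int :: int \<Rightarrow> complex) -` {x. poly p x = 0})"
    by (rule finite_vimageI) (auto simp: inj_on_def)
  then show ?thesis by (simp add: vimage_def ev)
qed

lemma indicial:
  fixes c :: "nat \<Rightarrow> complex fls"
  assumes "\<exists>k\<le>r. c k \<noteq> 0"
  shows "\<exists>e \<kappa>. finite {m::int. \<kappa> m = 0} \<and>
    (\<forall>v m. ordge m v \<longrightarrow> fls_nth (diffop c r v) (m + e) = \<kappa> m * fls_nth v m) \<and>
    (\<forall>K m. subfld K \<longrightarrow> (\<forall>k\<le>r. \<forall>j. fls_nth (c k) j \<in> K) \<longrightarrow> \<kappa> m \<in> K)"
proof -
  define I where "I = {k. k \<le> r \<and> c k \<noteq> 0}"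
  have I: "finite I" "I \<noteq> {}" using assms by (auto simp: I_def)
  define e where "e = Min ((\<lambda>k. fls_subdegree (c k) - int k) ` I)"
  have "e \<in> (\<lambda>k. fls_subdegree (c k) - int k) ` I" unfolding e_def using I by (intro Min_in) auto
  then obtain k0 where k0: "k0 \<in> I" "fls_subdegree (c k0) = e + int k0" by auto
  have nz: "fls_nth (c k0) (e + int k0) \<noteq> 0" using k0 by (metis (mono_tags, lifting) I_def mem_Collect_eq nth_fls_subdegree_nonzero)
  have ord: "ordge (e + int k) (c k)" if "k \<le> r" for k
  proof (cases "c k = 0")
    case False
    then have "e \<le> fls_subdegree (c k) - int k" unfolding e_def using I that by (intro Min_le) (auto simp: I_def)
    then show ?thesis by (auto simp: ordge_def)
  qed (simp add: ordge_closed)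
  define \<kappa> where "\<kappa> = (\<lambda>m::int. \<Sum>k\<le>r. fls_nth (c k) (e + int k) * (\<Prod>i<k. of_int m - of_nat i))"
  have "finite {m. \<kappa> m = 0}"
    unfolding \<kappa>_def by (rule finite_int_zeros_falling[of k0]) (use k0 nz in \<open>auto simp: I_def\<close>)
  moreover have "fls_nth (diffop c r v) (m + e) = \<kappa> m * fls_nth v m" if "ordge m v" for v m
  proof -
    have "fls_nth (c k * (fls_deriv ^^ k) v) (m + e) = fls_nth (c k) (e + int k) * (\<Prod>i<k. of_int m - of_nat i) * fls_nth v m"
      if "k \<le> r" for k
      using ordge_mult_nth[OF ord[OF that] ordge_higher_deriv[OF \<open>ordge m v\<close>, of k]]
      by (simp add: fls_nth_higher_deriv_falling mult_ac add_ac)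
    then show ?thesis by (simp add: diffop_def fls_nth_sum \<kappa>_def sum_distrib_right)
  qed
  moreover have "\<kappa> m \<in> K" if "subfld K" "\<forall>k\<le>r. \<forall>j. fls_nth (c k) j \<in> K" for K m
    unfolding \<kappa>_def using that
    by (intro subfld_sum subfld_closed(4) subfld_prod subfld_diff subfld_of_int subfld_of_nat) auto
  ultimately show ?thesis by blast
qed

lemma fls_nth_mult_subfld:
  assumes "subfld K" "\<And>j. fls_nth f j \<in> K" "\<And>j. fls_nth g j \<in> K"
  shows "fls_nth (f * g) n \<in> K"
  unfolding fls_times_nth(2) using assms by (intro subfld_sum subfld_closed(4))

lemma fls_nth_deriv_subfld: "subfld K \<Longrightarrow> (\<And>j. fls_nth f j \<in> K) \<Longrightarrow> fls_nth ((fls_deriv ^^ k) f) n \<in> K"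
  by (induction k arbitrary: n) (auto intro!: subfld_closed simp: subfld_of_int)

lemma coeffs_subfld_of_diffop:
  fixes c :: "nat \<Rightarrow> complex fls"
  assumes c0: "\<exists>k\<le>r. c k \<noteq> 0"
  shows "\<exists>m0. \<forall>K v. subfld K \<longrightarrow> (\<forall>k\<le>r. \<forall>j. fls_nth (c k) j \<in> K) \<longrightarrow>
    (\<forall>j. fls_nth (diffop c r v) j \<in> K) \<longrightarrow> (\<forall>m<m0. fls_nth v m \<in> K) \<longrightarrow> (\<forall>m. fls_nth v m \<in> K)"
proof -
  obtain e \<kappa> where "finite {m::int. \<kappa> m = 0} \<and>
    (\<forall>v m. ordge m v \<longrightarrow> fls_nth (diffop c r v) (m + e) = \<kappa> m * fls_nth v m) \<and>
    (\<forall>K m. subfld K \<longrightarrow> (\<forall>k\<le>r. \<forall>j. fls_nth (c k) j \<in> K) \<longrightarrow> \<kappa> m \<in> K)"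
    using indicial[OF c0] by (elim exE) (rule that)
  then have e: "finite {m::int. \<kappa> m = 0}"
    "\<And>v m. ordge m v \<Longrightarrow> fls_nth (diffop c r v) (m + e) = \<kappa> m * fls_nth v m"
    "\<And>K m. subfld K \<Longrightarrow> (\<And>k j. k \<le> r \<Longrightarrow> fls_nth (c k) j \<in> K) \<Longrightarrow> \<kappa> m \<in> K"
    by simp_all
  obtain m0 where m0: "\<And>m. m \<ge> m0 \<Longrightarrow> \<kappa> m \<noteq> 0"
  proof (cases "{m. \<kappa> m = 0} = {}")
    case False
    have "\<kappa> m \<noteq> 0" if "m \<ge> Max {m. \<kappa> m = 0} + 1" for m using Max_ge[OF e(1), of m] that by auto
    then show ?thesis using that by blast
  qed (use that in auto)
  have "fls_nth v m \<in> K" if K: "subfld K" and c: "\<And>k j. k \<le> r \<Longrightarrow> fls_nth (c k) j \<in> K"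
    and v: "\<And>j. fls_nth (diffop c r v) j \<in> K" "\<And>m. m < m0 \<Longrightarrow> fls_nth v m \<in> K" for K v m
  proof (induction "nat (m - m0)" arbitrary: m rule: less_induct)
    case less
    show ?case
    proof (cases "m < m0")
      case False
      have below: "fls_nth v l \<in> K" if "l < m" for l
        using less.hyps[of l] v(2)[of l] that by (cases "l < m0") auto
      define a where "a = Abs_fls (\<lambda>k. if k < m then fls_nth v k else 0)"
      have a: "fls_nth a k = (if k < m then fls_nth v k else 0)" for k
        unfolding a_def by (subst nth_Abs_fls_lower_bound[of "fls_subdegree v"]) auto
      have aK: "fls_nth (diffop c r a) j \<in> K" for j
        unfolding diffop_def fls_nth_sum using below K c
        by (intro subfld_sum fls_nth_mult_subfld fls_nth_deriv_subfld) (auto simp: a subfld_closed)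
      have "\<kappa> m * fls_nth v m = fls_nth (diffop c r (v - a)) (m + e)"
        by (subst e(2)) (auto simp: ordge_def a)
      also have "\<dots> \<in> K" unfolding diffop_diff using v(1) aK K by (auto intro: subfld_diff)
      finally have "inverse (\<kappa> m) * (\<kappa> m * fls_nth v m) \<in> K"
        using K e(3)[of K m] c by (auto intro: subfld_closed(4) subfld_closed(6))
      moreover have "inverse (\<kappa> m) * (\<kappa> m * fls_nth v m) = fls_nth v m"
        using m0[of m] False by (simp flip: mult.assoc)
      ultimately show ?thesis by simp
    qed (use v(2) in blast)
  qed
  then show ?thesis by blast
qed

lemma alg_ratfuns_nth_algebraic:
  assumes "x \<in> alg_ratfuns" shows "algebraic (fls_nth x k)"
proof -
  obtain p q where pq: "p \<in> alg_polys" "q \<in> alg_polys" "q \<noteq> 0" "x = fls_of_poly p / fls_of_poly q"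
    using assms by (elim alg_ratfunsE)
  have coeffs: "fls_nth (fls_of_poly p) j \<in> {x. algebraic x}" if "p \<in> alg_polys" for p j
    using that by (auto simp: fls_of_poly_nth alg_polys_def)
  have op: "diffop (\<lambda>_. fls_of_poly q) 0 v = fls_of_poly q * v" for v by (simp add: diffop_def)
  have "\<exists>k\<le>0::nat. fls_of_poly q \<noteq> 0" using pq(3) by (simp add: fls_of_poly_eq_0)
  from coeffs_subfld_of_diffop[where c = "\<lambda>_. fls_of_poly q", OF this]
  obtain m0 where "\<forall>K v. subfld K \<longrightarrow> (\<forall>k\<le>0::nat. \<forall>j. fls_nth (fls_of_poly q) j \<in> K) \<longrightarrow>
      (\<forall>j. fls_nth (fls_of_poly q * v) j \<in> K) \<longrightarrow> (\<forall>m<m0. fls_nth v m \<in> K) \<longrightarrow> (\<forall>m. fls_nth v m \<in> K)"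
    unfolding op ..
  then have m0: "fls_nth v m \<in> {x. algebraic x}" if "\<And>j. fls_nth (fls_of_poly q * v) j \<in> {x. algebraic x}"
    "\<And>m. m < m0 \<Longrightarrow> fls_nth v m \<in> {x. algebraic x}" for v m
    using that subfld_algebraic coeffs[OF pq(2)] by (elim allE[of _ "{x. algebraic x}"] allE[of _ v]) simp
  define d where "d = nat (fls_subdegree x - m0) + nat (m0 - fls_subdegree x)"
  define X where "X = fls_of_poly (monom 1 d)"
  have "fls_nth (X * x) n = fls_nth x (n - int d)" for n
  proof -
    have "fls_nth (X * x) n = (\<Sum>i\<in>{0..n - fls_subdegree x}. fls_nth X i * fls_nth x (n - i))"
      by (rule fls_mult_nth_ordge) (auto simp: ordge_def X_def fls_of_poly_nth)
    also have "\<dots> = (\<Sum>i\<in>{0..n - fls_subdegree x} \<inter> {int d}. fls_nth x (n - i))"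
      by (rule sum.mono_neutral_cong_right) (auto simp: X_def fls_of_poly_nth split: if_splits)
    also have "\<dots> = fls_nth x (n - int d)"
      by (cases "int d \<le> n - fls_subdegree x") auto
    finally show ?thesis .
  qed
  then have shift: "fls_nth x n = fls_nth (X * x) (n + int d)" for n by simp
  have "fls_nth (X * x) m \<in> {x. algebraic x}" for m
  proof (rule m0)
    have "fls_of_poly q * (X * x) = fls_of_poly (monom 1 d * p)"
      using pq by (simp add: X_def fls_of_poly_hom fls_of_poly_eq_0)
    moreover have "monom 1 d * p \<in> alg_polys" using pq by (intro alg_polys_closed) auto
    ultimately show "fls_nth (fls_of_poly q * (X * x)) j \<in> {x. algebraic x}" for j
      using coeffs by metis
    fix m assume "m < m0"
    then have "m - int d < fls_subdegree x" by (auto simp: d_def)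
    then show "fls_nth (X * x) m \<in> {x. algebraic x}" using shift[of "m - int d"] by simp
  qed
  then show ?thesis using shift by auto
qed

section \<open>Stable subspaces of the dual connection\<close>

definition dconn :: "ratfun ^ 'n ^ 'n \<Rightarrow> ratfun ^ 'n \<Rightarrow> ratfun ^ 'n" where
  "dconn G l = (\<chi> j. rderiv (l $ j) + (\<Sum>i\<in>UNIV. l $ i * G $ i $ j))"

definition dop :: "ratfun ^ 'n ^ 'n \<Rightarrow> (nat \<Rightarrow> ratfun) \<Rightarrow> nat \<Rightarrow> ratfun ^ 'n \<Rightarrow> ratfun ^ 'n" where
  "dop G c r l = (\<Sum>k\<le>r. c k *s (dconn G ^^ k) l)"

definition dstable :: "ratfun ^ 'n ^ 'n \<Rightarrow> (ratfun ^ 'n) set \<Rightarrow> bool" where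
  "dstable G U \<longleftrightarrow> vec.subspace U \<and> (\<forall>l\<in>U. dconn G l \<in> U)"

lemma dconn_add: "dconn G (l + m) = dconn G l + dconn G m"
  by (simp add: dconn_def vec_eq_iff algebra_simps sum.distrib)

lemma dconn_scale: "dconn G (a *s l) = rderiv a *s l + a *s dconn G l"
  by (simp add: dconn_def vec_eq_iff algebra_simps sum_distrib_left)

lemma dconn_funpow_add: "(dconn G ^^ k) (l + m) = (dconn G ^^ k) l + (dconn G ^^ k) m"
  by (induction k) (auto simp: dconn_add)

lemma dconn_funpow_const: "rderiv a = 0 \<Longrightarrow> (dconn G ^^ k) (a *s l) = a *s (dconn G ^^ k) l"
  by (induction k) (auto simp: dconn_scale)

lemma dop_add: "dop G c r (l + m) = dop G c r l + dop G c r m"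
  by (simp add: dop_def dconn_funpow_add vector_add_ldistrib sum.distrib)

lemma dop_const: "rderiv a = 0 \<Longrightarrow> dop G c r (a *s l) = a *s dop G c r l"
  by (simp add: dop_def dconn_funpow_const vec.scale_sum_right mult.commute)

lemma dstable_funpow: "dstable G U \<Longrightarrow> l \<in> U \<Longrightarrow> (dconn G ^^ k) l \<in> U"
  by (induction k) (auto simp: dstable_def)

lemma dstable_dop: "dstable G U \<Longrightarrow> l \<in> U \<Longrightarrow> dop G c r l \<in> U"
  unfolding dop_def using dstable_funpow[of G U l]
  by (auto simp: dstable_def intro!: vec.subspace_sum vec.subspace_scale)

lemma dstable_Int: "dstable G U \<Longrightarrow> dstable G V \<Longrightarrow> dstable G (U \<inter> V)"
  by (auto simp: dstable_def vec.subspace_inter)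

lemma dstable_sums: "dstable G U \<Longrightarrow> dstable G V \<Longrightarrow> dstable G {u + v |u v. u \<in> U \<and> v \<in> V}"
  unfolding dstable_def by (auto simp: vec.subspace_sums dconn_add) blast

definition socle_gen :: "ratfun ^ 'n ^ 'n \<Rightarrow> (ratfun ^ 'n) set \<Rightarrow> (ratfun ^ 'n) set \<Rightarrow> bool" where
  "socle_gen G A Z \<longleftrightarrow> finite A \<and> (\<forall>U. dstable G U \<longrightarrow> U \<subseteq> Z \<longrightarrow> U \<noteq> {0} \<longrightarrow>
     (\<exists>s\<in>A. \<exists>l\<in>U. l \<noteq> 0 \<and> (\<forall>c r. dop G c r s = 0 \<longrightarrow> dop G c r l = 0)))"

lemma dstable_nonzero: "dstable G U \<Longrightarrow> U \<noteq> {0} \<Longrightarrow> \<exists>l\<in>U. l \<noteq> 0"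
  unfolding dstable_def using vec.subspace_0 by blast

lemma simple_dstable_exists:
  assumes "dstable G U" "U \<noteq> {0}"
  shows "\<exists>S. dstable G S \<and> S \<subseteq> U \<and> S \<noteq> {0} \<and> (\<forall>V. dstable G V \<longrightarrow> V \<subseteq> S \<longrightarrow> V \<noteq> {0} \<longrightarrow> V = S)"
proof -
  obtain S where S: "dstable G S \<and> S \<subseteq> U \<and> S \<noteq> {0}"
    "\<And>V. dstable G V \<and> V \<subseteq> U \<and> V \<noteq> {0} \<Longrightarrow> vec.dim S \<le> vec.dim V"
    using ex_has_least_nat[of "\<lambda>V. dstable G V \<and> V \<subseteq> U \<and> V \<noteq> {0}" U vec.dim] assms by blast
  have "V = S" if V: "dstable G V" "V \<subseteq> S" "V \<noteq> {0}" for V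
  proof (rule vec.subspace_dim_equal)
    show "vec.dim S \<le> vec.dim V" using S V by blast
  qed (use S V in \<open>auto simp: dstable_def\<close>)
  then show ?thesis using S by blast
qed

text \<open>If \<open>U\<close> meets \<open>Z\<close> trivially, the projection to the simple summand \<open>S\<close> identifies \<open>U\<close> with \<open>S\<close>
  compatibly with the connection.\<close>

lemma socle_gen_step:
  assumes Z: "dstable G Z" "socle_gen G A Z" and S: "dstable G S" "s \<in> S" "s \<noteq> 0"
    and simple: "\<And>V. dstable G V \<Longrightarrow> V \<subseteq> S \<Longrightarrow> V \<noteq> {0} \<Longrightarrow> V = S"
  shows "socle_gen G (insert s A) {u + v |u v. u \<in> Z \<and> v \<in> S}"
  unfolding socle_gen_def
proof (intro conjI allI impI)
  show "finite (insert s A)" using Z by (simp add: socle_gen_def)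
  fix U assume U: "dstable G U" "U \<subseteq> {u + v |u v. u \<in> Z \<and> v \<in> S}" "U \<noteq> {0}"
  show "\<exists>s'\<in>insert s A. \<exists>l\<in>U. l \<noteq> 0 \<and> (\<forall>c r. dop G c r s' = 0 \<longrightarrow> dop G c r l = 0)"
  proof (cases "U \<inter> Z = {0}")
    case False
    with dstable_Int[OF U(1) Z(1)] Z(2) show ?thesis unfolding socle_gen_def by blast
  next
    case True
    have sub: "vec.subspace U" "vec.subspace Z" "vec.subspace S"
      using U Z S by (auto simp: dstable_def)
    define V where "V = S \<inter> {v. \<exists>u\<in>Z. u + v \<in> U}"
    have "dstable G V"
      unfolding dstable_def vec.subspace_def
    proof (intro conjI ballI allI)
      show "0 \<in> V" using sub by (auto simp: V_def vec.subspace_0 intro!: bexI[of _ 0])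
      fix x assume "x \<in> V"
      then obtain u where u: "u \<in> Z" "u + x \<in> U" "x \<in> S" by (auto simp: V_def)
      show "dconn G x \<in> V" using u U(1) Z(1) S(1)
        by (auto simp: V_def dstable_def intro!: bexI[of _ "dconn G u"]) (metis dconn_add)
      show "c *s x \<in> V" for c using u sub
        by (auto simp: V_def intro!: vec.subspace_scale bexI[of _ "c *s u"])
           (metis vec.subspace_scale vector_add_ldistrib)
      fix y assume "y \<in> V"
      then obtain w where w: "w \<in> Z" "w + y \<in> U" "y \<in> S" by (auto simp: V_def)
      have "(u + w) + (x + y) = (u + x) + (w + y)" by (simp add: algebra_simps)
      then have "(u + w) + (x + y) \<in> U" using u w sub by (metis vec.subspace_add)
      then show "x + y \<in> V" using u w sub by (auto simp: V_def intro!: vec.subspace_add)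
    qed
    moreover have "V \<subseteq> S" by (auto simp: V_def)
    moreover have "V \<noteq> {0}"
    proof
      assume V0: "V = {0}"
      obtain l where l: "l \<in> U" "l \<noteq> 0" using dstable_nonzero[OF U(1,3)] by blast
      then obtain u v where uv: "u \<in> Z" "v \<in> S" "l = u + v" using U(2) by blast
      then have "v \<in> V" using l by (auto simp: V_def)
      then have "l \<in> Z" using V0 uv by simp
      then show False using True l by blast
    qed
    ultimately have "V = S" by (rule simple)
    then have "s \<in> V" using S by simp
    then obtain u where u: "u \<in> Z" "u + s \<in> U" by (auto simp: V_def)
    have "u + s \<noteq> 0"
    proof
      assume "u + s = 0"
      then have e: "s = - u" by (simp add: eq_neg_iff_add_eq_0 add.commute)
      then have "s \<in> Z" using u sub by (simp add: vec.subspace_neg)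
      then have SZ: "dstable G (S \<inter> Z)" "S \<inter> Z \<subseteq> S" "S \<inter> Z \<noteq> {0}" using dstable_Int[OF S(1) Z(1)] S by auto
      then have "S \<subseteq> Z" using simple by blast
      then have "U \<subseteq> Z" using U(2) sub(2) by (auto intro: vec.subspace_add)
      then show False using True U(3) by blast
    qed
    moreover have "dop G c r (u + s) = 0" if "dop G c r s = 0" for c r
    proof -
      have "dop G c r (u + s) = dop G c r u" using that by (simp add: dop_add)
      moreover have "dop G c r u \<in> Z" "dop G c r (u + s) \<in> U" using dstable_dop u U(1) Z(1) by blast+
      ultimately show ?thesis using True by auto
    qed
    ultimately show ?thesis using u by blast
  qed
qed

lemma socle_gen_exists:
  fixes G :: "ratfun ^ 'n ^ 'n"
  shows "\<exists>A. socle_gen G A UNIV"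
proof -
  define P where "P = (\<lambda>Z. dstable G Z \<and> (\<exists>A. socle_gen G A Z))"
  have "P {0}" unfolding P_def
    by (auto simp: dstable_def socle_gen_def dconn_def vec_eq_iff intro!: exI[of _ "{}"])
      (auto simp: dstable_def dest: vec.subspace_0)
  moreover have "vec.dim Z \<le> CARD('n)" for Z :: "(ratfun ^ 'n) set"
    using vec.dim_subset[of Z UNIV, OF subset_UNIV] unfolding vec_dim_card .
  then have "\<forall>Z. P Z \<longrightarrow> vec.dim Z < CARD('n) + 1" by (simp add: less_Suc_eq_le)
  ultimately obtain Z where Z: "P Z" "\<And>Y. P Y \<Longrightarrow> vec.dim Y \<le> vec.dim Z"
    using ex_has_greatest_nat[of P "{0}" vec.dim "CARD('n) + 1"] by blast
  then obtain A where A: "dstable G Z" "socle_gen G A Z" by (auto simp: P_def)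
  have "socle_gen G A UNIV"
    unfolding socle_gen_def
  proof (intro conjI allI impI)
    show "finite A" using A by (simp add: socle_gen_def)
    fix U assume U: "dstable G U" "U \<noteq> {0}"
    obtain S where S: "dstable G S" "S \<subseteq> U" "S \<noteq> {0}" "\<And>V. dstable G V \<Longrightarrow> V \<subseteq> S \<Longrightarrow> V \<noteq> {0} \<Longrightarrow> V = S"
      using simple_dstable_exists[OF U] by blast
    obtain s where s: "s \<in> S" "s \<noteq> 0" using dstable_nonzero[OF S(1,3)] by blast
    define Y where "Y = {u + v |u v. u \<in> Z \<and> v \<in> S}"
    have "P Y" unfolding P_def Y_def using dstable_sums[OF A(1) S(1)] socle_gen_step[OF A S(1) s S(4)] by blast
    then have dim: "vec.dim Y \<le> vec.dim Z" by (rule Z(2))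
    have sub: "vec.subspace Z" "vec.subspace S" "vec.subspace Y"
      using A S \<open>P Y\<close> by (auto simp: dstable_def P_def)
    have "z + 0 \<in> Y" if "z \<in> Z" for z unfolding Y_def using that vec.subspace_0[OF sub(2)] by blast
    moreover have "0 + z \<in> Y" if "z \<in> S" for z unfolding Y_def using that vec.subspace_0[OF sub(1)] by blast
    ultimately have "Z \<subseteq> Y" "S \<subseteq> Y" by auto
    then have "Z = Y" using vec.subspace_dim_equal[OF sub(1,3)] dim by blast
    then have "S \<subseteq> Z" using \<open>S \<subseteq> Y\<close> by simp
    then show "\<exists>s\<in>A. \<exists>l\<in>U. l \<noteq> 0 \<and> (\<forall>c r. dop G c r s = 0 \<longrightarrow> dop G c r l = 0)"
      using A(2) S(1-3) unfolding socle_gen_def by blast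
  qed
  then show ?thesis ..
qed

lemma span_image_lessThan:
  fixes g :: "nat \<Rightarrow> ratfun ^ 'n"
  assumes "x \<in> vec.span (g ` {..<r})"
  shows "\<exists>c. x = (\<Sum>k<r. c k *s g k)"
  using assms
proof (induction rule: vec.span_induct_alt)
  case base
  show ?case by (rule exI[of _ "\<lambda>_. 0"]) simp
next
  case (step a y z)
  then obtain c k where c: "z = (\<Sum>k<r. c k *s g k)" "k < r" "y = g k" by auto
  have "a *s y + z = (\<Sum>j<r. (if j = k then a else 0) *s g j) + z"
    using c(2,3) by (simp add: if_distrib[of "\<lambda>a. a *s _"] cong: if_cong)
  also have "\<dots> = (\<Sum>j<r. ((if j = k then a else 0) + c j) *s g j)"
    unfolding c(1) by (simp add: vec.scale_left_distrib sum.distrib)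
  finally show ?case by (intro exI)
qed

lemma annihilator_exists:
  fixes s :: "ratfun ^ 'n"
  shows "\<exists>c r. (\<exists>k\<le>r. c k \<noteq> 0) \<and> dop G c r s = 0"
proof -
  define g where "g = (\<lambda>k. (dconn G ^^ k) s)"
  have "\<exists>r. g r \<in> vec.span (g ` {..<r})"
  proof (rule ccontr)
    assume *: "\<not> ?thesis"
    have "vec.independent (g ` {..<r}) \<and> card (g ` {..<r}) = r" for r
    proof (induction r)
      case (Suc r)
      have "g r \<notin> vec.span (g ` {..<r})" using * by blast
      moreover have "g r \<notin> g ` {..<r}" using calculation vec.span_base[of "g r" "g ` {..<r}"] by metis
      ultimately show ?case using Suc by (simp add: lessThan_Suc vec.independent_insertI)
    qed (simp add: vec.independent_empty)
    then have ind: "vec.independent (g ` {..<CARD('n) + 1})" "card (g ` {..<CARD('n) + 1}) = CARD('n) + 1"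
      by blast+
    have "card (g ` {..<CARD('n) + 1}) \<le> vec.dim (UNIV :: (ratfun ^ 'n) set)"
      using ind(1) by (intro vec.independent_card_le_dim) auto
    also have "\<dots> = CARD('n)" by (rule vec_dim_card)
    finally show False using ind(2) by simp
  qed
  then obtain r c where c: "g r = (\<Sum>k<r. c k *s g k)" using span_image_lessThan by blast
  have "dop G (\<lambda>k. if k < r then - c k else 1) r s = (\<Sum>k<r. - c k *s g k) + g r"
    unfolding dop_def g_def
    by (simp add: lessThan_Suc_atMost[symmetric])
  also have "\<dots> = 0" unfolding c by (simp add: vec.scale_minus_left sum_negf)
  finally show ?thesis by (intro exI[of _ "\<lambda>k. if k < r then - c k else 1"] exI[of _ r]) auto
qed

section \<open>Evaluation of linear forms at the solution\<close>

definition linform :: "complex fls ^ 'n \<Rightarrow> ratfun ^ 'n \<Rightarrow> complex fls" where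
  "linform f l = (\<Sum>i\<in>UNIV. rf (l $ i) * f $ i)"

lemma linform_scale: "linform f (a *s l) = rf a * linform f l"
  and linform_add: "linform f (l + m) = linform f l + linform f m"
  by (simp_all add: linform_def algebra_simps sum_subtractf sum.distrib sum_distrib_left)

lemma linform_0 [simp]: "linform f 0 = 0"
  by (simp add: linform_def)

lemma linform_sum: "linform f (\<Sum>k\<in>I. l k) = (\<Sum>k\<in>I. linform f (l k))"
  by (induction I rule: infinite_finite_induct) (auto simp: linform_add)

definition rf_mat :: "ratfun ^ 'n ^ 'n \<Rightarrow> complex fls ^ 'n ^ 'n" where
  "rf_mat G = (\<chi> i j. rf (G $ i $ j))"

definition rf_vec :: "ratfun ^ 'n \<Rightarrow> complex fls ^ 'n" where
  "rf_vec w = (\<chi> i. rf (w $ i))"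

lemma linform_dconn:
  assumes "nabla (rf_mat G) f = 0"
  shows "linform f (dconn G l) = fls_deriv (linform f l)"
proof -
  have d: "fls_deriv (f $ i) = (\<Sum>j\<in>UNIV. rf (G $ i $ j) * f $ j)" for i
    using assms by (auto simp: nabla_def vderiv_def rf_mat_def matrix_vector_mult_def vec_eq_iff)
  have "(\<Sum>j\<in>UNIV. (\<Sum>i\<in>UNIV. rf (l $ i) * rf (G $ i $ j)) * f $ j)
      = (\<Sum>i\<in>UNIV. rf (l $ i) * (\<Sum>j\<in>UNIV. rf (G $ i $ j) * f $ j))"
    unfolding sum_distrib_left sum_distrib_right mult.assoc by (rule sum.swap)
  then show ?thesis
    by (simp add: linform_def dconn_def fls_deriv_sum d distrib_right sum.distrib add.commute)
qed

lemma linform_dop: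
  assumes "nabla (rf_mat G) f = 0"
  shows "linform f (dop G c r l) = diffop (\<lambda>k. rf (c k)) r (linform f l)"
proof -
  have "linform f ((dconn G ^^ k) l) = (fls_deriv ^^ k) (linform f l)" for k
    by (induction k) (auto simp: linform_dconn[OF assms])
  then show ?thesis by (simp add: dop_def diffop_def linform_sum linform_scale)
qed

lemma rf_const_exists:
  assumes "algebraic a"
  shows "\<exists>r. rf r = fls_const a \<and> rderiv r = 0"
proof -
  have "fls_of_poly [:a:] = fls_const a"
    by (rule fls_eqI) (auto simp: fls_of_poly_nth coeff_pCons split: nat.split)
  moreover have "[:a:] \<in> alg_polys" using assms by (auto simp: alg_polys_def coeff_pCons split: nat.split)
  ultimately have "fls_const a \<in> alg_ratfuns" using alg_ratfuns_of_poly by metis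
  then obtain r where r: "rf r = fls_const a" using rf_exists by blast
  then have "rf (rderiv r) = 0" by simp
  then have "rderiv r = 0" by (metis rf_inject0)
  with r show ?thesis by blast
qed

text \<open>The solutions in question form a finite-dimensional space over the constants, because the orders
  of nonzero solutions are roots of an indicial equation.\<close>

lemma solution_forms_bounded:
  fixes f :: "complex fls ^ 'n"
  assumes f: "nabla (rf_mat G) f = 0" and inj: "\<And>l. linform f l = 0 \<Longrightarrow> l = 0"
    and alg: "\<And>i k. algebraic (fls_nth (f $ i) k)"
  shows "\<exists>b. \<forall>l. l \<noteq> 0 \<longrightarrow> (\<forall>c r. dop G c r s = 0 \<longrightarrow> dop G c r l = 0) \<longrightarrow>
    fls_subdegree (linform f l) \<le> b \<and> (\<forall>i. ordge (- b) (rf (l $ i)))"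
proof -
  define X where "X = {l. \<forall>c r. dop G c r s = 0 \<longrightarrow> dop G c r l = 0}"
  have Xadd: "l + m \<in> X" if "l \<in> X" "m \<in> X" for l m using that by (auto simp: X_def dop_add)
  have Xscale: "a *s l \<in> X" if "l \<in> X" "rderiv a = 0" for a l using that by (auto simp: X_def dop_const)
  obtain c r where cr: "\<exists>k\<le>r. c k \<noteq> 0" "dop G c r s = 0" using annihilator_exists by blast
  have "\<exists>k\<le>r. rf (c k) \<noteq> 0" using cr(1) by simp
  from indicial[OF this] obtain e \<kappa> where fin: "finite {m::int. \<kappa> m = 0}"
    and ek: "\<And>v m. ordge m v \<Longrightarrow> fls_nth (diffop (\<lambda>k. rf (c k)) r v) (m + e) = \<kappa> m * fls_nth v m"
    by blast
  have sd: "\<kappa> (fls_subdegree (linform f l)) = 0" if l: "l \<in> X" "l \<noteq> 0" for l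
  proof -
    have nz: "linform f l \<noteq> 0" using inj l(2) by blast
    have "diffop (\<lambda>k. rf (c k)) r (linform f l) = 0"
      using linform_dop[OF f, of c r l] l(1) cr(2) by (simp add: X_def)
    then have "\<kappa> (fls_subdegree (linform f l)) * fls_nth (linform f l) (fls_subdegree (linform f l)) = 0"
      using ek[of "fls_subdegree (linform f l)" "linform f l"] by (simp add: ordge_def)
    then show ?thesis using nz by simp
  qed
  obtain M where M: "\<And>m. \<kappa> m = 0 \<Longrightarrow> m < M"
  proof (cases "{m. \<kappa> m = 0} = {}")
    case False
    have "m < Max {m. \<kappa> m = 0} + 1" if "\<kappa> m = 0" for m using Max_ge[OF fin, of m] that by auto
    then show ?thesis using that by blast
  qed (use that in auto)
  obtain L where L: "\<And>m. \<kappa> m = 0 \<Longrightarrow> L < m"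
  proof (cases "{m. \<kappa> m = 0} = {}")
    case False
    have "Min {m. \<kappa> m = 0} - 1 < m" if "\<kappa> m = 0" for m using Min_le[OF fin, of m] that by auto
    then show ?thesis using that by blast
  qed (use that in auto)
  have algl: "algebraic (fls_nth (linform f l) k)" for l k
  proof -
    have "fls_nth (linform f l) k \<in> {x. algebraic x}"
      unfolding linform_def fls_nth_sum using alg alg_ratfuns_nth_algebraic[OF rf]
      by (intro subfld_sum[OF subfld_algebraic] fls_nth_mult_subfld[OF subfld_algebraic]) auto
    then show ?thesis by simp
  qed
  have claim: "\<exists>b. \<forall>l\<in>X. ordge (M - int j) (linform f l) \<longrightarrow> (\<forall>i. ordge (- b) (rf (l $ i)))" for j
  proof (induction j)
    case 0
    have l0: "l = 0" if "l \<in> X" "ordge M (linform f l)" for l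
    proof (rule ccontr)
      assume "l \<noteq> 0"
      then have "linform f l \<noteq> 0" using inj by blast
      then have "M \<le> fls_subdegree (linform f l)" using that ordge_subdegree by blast
      then show False using M[OF sd[OF that(1) \<open>l \<noteq> 0\<close>]] by simp
    qed
    then have "rf (l $ i) = 0" if "l \<in> X" "ordge M (linform f l)" for l i
      using l0[OF that] by simp
    then show ?case by (intro exI[of _ 0]) (simp add: ordge_closed)
  next
    case (Suc j)
    then obtain b where b: "\<And>l i. l \<in> X \<Longrightarrow> ordge (M - int j) (linform f l) \<Longrightarrow> ordge (- b) (rf (l $ i))" by blast
    define m where "m = M - int (Suc j)"
    have next_ord: "ordge (M - int j) v" if "ordge m v" "fls_nth v m = 0" for v
      unfolding ordge_def
    proof (intro allI impI)
      fix k assume "k < M - int j"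
      then have "k < m \<or> k = m" by (auto simp: m_def)
      then show "fls_nth v k = 0" using that by (auto simp: ordge_def)
    qed
    show ?case
    proof (cases "\<exists>u\<in>X. ordge m (linform f u) \<and> fls_nth (linform f u) m \<noteq> 0")
      case False
      then show ?thesis using b next_ord unfolding m_def[symmetric] by blast
    next
      case True
      then obtain u where u: "u \<in> X" "ordge m (linform f u)" "fls_nth (linform f u) m \<noteq> 0" by blast
      have "\<exists>b'. \<forall>i. ordge (- b') (rf (u $ i))"
      proof -
        have "\<forall>i. \<exists>a. a \<le> 0 \<and> ordge a (rf (u $ i))" using ordge_exists by blast
        then obtain g where g: "\<And>i. g i \<le> 0 \<and> ordge (g i) (rf (u $ i))" by metis
        have "ordge (- (\<Sum>i\<in>UNIV. - g i)) (rf (u $ i))" for i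
        proof (rule ordge_mono)
          show "- (\<Sum>i\<in>UNIV. - g i) \<le> g i"
            using member_le_sum[of i UNIV "\<lambda>i. - g i"] g by simp
        qed (use g in blast)
        then show ?thesis by blast
      qed
      then obtain b' where b': "\<And>i. ordge (- b') (rf (u $ i))" by blast
      have "ordge (- max b b') (rf (l $ i))" if l: "l \<in> X" "ordge m (linform f l)" for l i
      proof -
        define a where "a = fls_nth (linform f l) m / fls_nth (linform f u) m"
        have "a \<in> {x. algebraic x}" unfolding a_def using algl by (intro subfld_divide[OF subfld_algebraic]) auto
        then obtain ra where ra: "rf ra = fls_const a" "rderiv ra = 0" using rf_const_exists by auto
        define w where "w = l + (- ra) *s u"
        have "rderiv (- ra) = 0" using ra(2) by (metis add.right_inverse add.left_neutral rderiv_simps(1,2))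
        then have wX: "w \<in> X" unfolding w_def using l u by (intro Xadd Xscale)
        have fw: "linform f w = linform f l - fls_const a * linform f u"
          by (simp only: w_def linform_add linform_scale rf_simps ra) simp
        have "ordge (M - int j) (linform f w)"
        proof (rule next_ord)
          show "ordge m (linform f w)" using l(2) u(2) unfolding fw by (simp add: ordge_def)
          show "fls_nth (linform f w) m = 0" unfolding fw using u(3) by (simp add: a_def)
        qed
        then have "ordge (- b) (rf (w $ i))" using b wX by blast
        moreover have "rf (l $ i) = rf (w $ i) + fls_const a * rf (u $ i)"
          by (simp add: w_def ra)
        moreover have "ordge (- b') (fls_const a * rf (u $ i))" using b'[of i] by (simp add: ordge_def)
        ultimately show ?thesis by (auto intro!: ordge_closed(2) elim!: ordge_mono)
      qed
      then show ?thesis unfolding m_def[symmetric] by blast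
    qed
  qed
  from claim[of "nat (M - L)"] obtain b where
    b: "\<And>l i. l \<in> X \<Longrightarrow> ordge (M - int (nat (M - L))) (linform f l) \<Longrightarrow> ordge (- b) (rf (l $ i))" by blast
  have "fls_subdegree (linform f l) \<le> max b M \<and> (\<forall>i. ordge (- max b M) (rf (l $ i)))"
    if l: "l \<noteq> 0" "l \<in> X" for l
  proof
    show "fls_subdegree (linform f l) \<le> max b M" using M[OF sd[OF l(2,1)]] by simp
    have "M - int (nat (M - L)) \<le> fls_subdegree (linform f l)"
      using L[OF sd[OF l(2,1)]] M[OF sd[OF l(2,1)]] by simp
    then have "ordge (M - int (nat (M - L))) (linform f l)" by (simp add: ordge_def)
    from ordge_mono[OF b[OF l(2) this]] show "\<forall>i. ordge (- max b M) (rf (l $ i))" by simp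
  qed
  then show ?thesis unfolding X_def by blast
qed

lemma dstable_contains_bounded_form:
  fixes f :: "complex fls ^ 'n"
  assumes f: "nabla (rf_mat G) f = 0" and inj: "\<And>l. linform f l = 0 \<Longrightarrow> l = 0"
    and alg: "\<And>i k. algebraic (fls_nth (f $ i) k)"
  shows "\<exists>b. \<forall>U. dstable G U \<longrightarrow> U \<noteq> {0} \<longrightarrow>
    (\<exists>l\<in>U. l \<noteq> 0 \<and> fls_subdegree (linform f l) \<le> b \<and> (\<forall>i. ordge (- b) (rf (l $ i))))"
proof -
  obtain A where A: "socle_gen G A UNIV" using socle_gen_exists by blast
  obtain b where b: "\<And>s l. l \<noteq> 0 \<Longrightarrow> (\<And>c r. dop G c r s = 0 \<Longrightarrow> dop G c r l = 0) \<Longrightarrow>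
      fls_subdegree (linform f l) \<le> b s \<and> (\<forall>i. ordge (- b s) (rf (l $ i)))"
    using solution_forms_bounded[OF f inj alg] by metis
  define B where "B = Max (insert 0 (b ` A))"
  have bB: "b s \<le> B" if "s \<in> A" for s unfolding B_def using A that by (intro Max_ge) (auto simp: socle_gen_def)
  have "\<exists>l\<in>U. l \<noteq> 0 \<and> fls_subdegree (linform f l) \<le> B \<and> (\<forall>i. ordge (- B) (rf (l $ i)))"
    if U: "dstable G U" "U \<noteq> {0}" for U
  proof -
    obtain s l where sl: "s \<in> A" "l \<in> U" "l \<noteq> 0" "\<And>c r. dop G c r s = 0 \<Longrightarrow> dop G c r l = 0"
      using A U unfolding socle_gen_def by blast
    have "fls_subdegree (linform f l) \<le> b s \<and> (\<forall>i. ordge (- b s) (rf (l $ i)))" using b[OF sl(3,4)] .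
    then show ?thesis using sl(2,3) bB[OF sl(1)] by (intro bexI[of _ l]) (auto intro: ordge_mono)
  qed
  then show ?thesis by blast
qed

section \<open>Zero estimate\<close>

definition rnabla :: "ratfun ^ 'n ^ 'n \<Rightarrow> ratfun ^ 'n \<Rightarrow> ratfun ^ 'n" where
  "rnabla G w = (\<chi> i. rderiv (w $ i) - (\<Sum>j\<in>UNIV. G $ i $ j * w $ j))"

definition rdot :: "ratfun ^ 'n \<Rightarrow> ratfun ^ 'n \<Rightarrow> ratfun" where
  "rdot l w = (\<Sum>i\<in>UNIV. l $ i * w $ i)"

lemma rf_vec_rnabla: "rf_vec (rnabla G w) = nabla (rf_mat G) (rf_vec w)"
  by (simp add: rf_vec_def rf_mat_def rnabla_def nabla_def vderiv_def matrix_vector_mult_def vec_eq_iff)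

lemma rf_vec_rnabla_funpow: "rf_vec ((rnabla G ^^ k) w) = (nabla (rf_mat G) ^^ k) (rf_vec w)"
  by (induction k) (auto simp: rf_vec_rnabla)

lemma rderiv_rdot: "rderiv (rdot l w) = rdot (dconn G l) w + rdot l (rnabla G w)"
proof -
  have "(\<Sum>j\<in>UNIV. (\<Sum>i\<in>UNIV. l $ i * G $ i $ j) * w $ j) = (\<Sum>i\<in>UNIV. l $ i * (\<Sum>j\<in>UNIV. G $ i $ j * w $ j))"
    unfolding sum_distrib_left sum_distrib_right mult.assoc by (rule sum.swap)
  then show ?thesis
    by (simp add: rdot_def dconn_def rnabla_def rderiv_sum distrib_right right_diff_distrib
        sum.distrib sum_subtractf)
qed

lemma rdot_add: "rdot (l + m) w = rdot l w + rdot m w"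
  and rdot_scale: "rdot (a *s l) w = a * rdot l w"
  and rdot_0: "rdot 0 w = 0"
  by (simp_all add: rdot_def algebra_simps sum.distrib sum_distrib_left)

text \<open>The spaces of forms annihilating the first \<open>j\<close> iterates decrease with \<open>j\<close>, and the first repetition
  among them is stable.\<close>

lemma annihilator_dstable:
  fixes G :: "ratfun ^ 'n ^ 'n"
  assumes l: "l \<noteq> 0" "\<And>h. h < CARD('n) \<Longrightarrow> rdot l ((rnabla G ^^ h) w) = 0"
  defines "U \<equiv> {l. \<forall>h. rdot l ((rnabla G ^^ h) w) = 0}"
  shows "dstable G U" "U \<noteq> {0}"
proof -
  define A where "A = (\<lambda>j. {l. \<forall>h<j. rdot l ((rnabla G ^^ h) w) = 0})"
  have sub: "vec.subspace (A j)" for j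
    by (auto simp: A_def vec.subspace_def rdot_add rdot_scale rdot_0)
  have shift: "rdot (dconn G l) ((rnabla G ^^ h) w) = rderiv (rdot l ((rnabla G ^^ h) w)) - rdot l ((rnabla G ^^ Suc h) w)"
    for l h using rderiv_rdot[of l "(rnabla G ^^ h) w" G] by simp
  show "dstable G U"
    unfolding dstable_def U_def by (auto simp: vec.subspace_def rdot_add rdot_scale rdot_0 shift simp del: funpow.simps)
  have "\<exists>j<CARD('n). A j = A (Suc j)"
  proof (rule ccontr)
    assume *: "\<not> ?thesis"
    have "j \<le> CARD('n) \<Longrightarrow> vec.dim (A j) + j \<le> CARD('n)" for j
    proof (induction j)
      case 0
      show ?case using vec.dim_subset[of "A 0" UNIV, OF subset_UNIV] unfolding vec_dim_card by simp
    next
      case (Suc j)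
      have ss: "A (Suc j) \<subseteq> A j" by (auto simp: A_def)
      have "vec.dim (A (Suc j)) < vec.dim (A j)"
      proof (rule ccontr)
        assume "\<not> ?thesis"
        then have "A (Suc j) = A j" using vec.subspace_dim_equal[OF sub sub ss] by simp
        moreover have "j < CARD('n)" using Suc.prems by simp
        ultimately show False using * by metis
      qed
      then show ?case using Suc by simp
    qed
    from this[of "CARD('n)"] have "vec.dim (A CARD('n)) = 0" by simp
    then have "A CARD('n) \<subseteq> {0}" by (simp add: vec.dim_eq_0)
    then show False using l by (auto simp: A_def)
  qed
  then obtain j where j: "j < CARD('n)" "A j = A (Suc j)" by blast
  have stable: "dconn G m \<in> A j" if "m \<in> A j" for m
  proof -
    have "m \<in> A (Suc j)" using that j by simp
    then show ?thesis by (auto simp: A_def shift simp del: funpow.simps)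
  qed
  have "rdot m ((rnabla G ^^ h) w) = 0" if "m \<in> A j" for m h
    using that
  proof (induction h arbitrary: m)
    case 0
    then have "m \<in> A (Suc j)" using j by simp
    then show ?case by (auto simp: A_def)
  next
    case (Suc h)
    show ?case using shift[of m h] Suc.IH[OF Suc.prems] Suc.IH[OF stable[OF Suc.prems]] by simp
  qed
  moreover have "l \<in> A j" using l j(1) by (auto simp: A_def)
  ultimately show "U \<noteq> {0}" using l(1) by (auto simp: U_def)
qed

lemma rf_of_int: "rf (of_int k) = of_int k"
proof -
  have n: "rf (of_nat m) = of_nat m" for m by (induction m) auto
  show ?thesis by (cases k rule: int_cases2) (auto simp: n)
qed

lemma det_rf_mat: "det (rf_mat B) = rf (det B)"
  by (simp add: det_def rf_mat_def rf_of_int)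

lemma det_mul_columns:
  fixes A :: "'a::comm_ring_1 ^ 'n ^ 'n"
  shows "det (\<chi> i j. c j * A $ i $ j) = prod c UNIV * det A"
proof -
  have e: "transpose (\<chi> i j. c j * A $ i $ j) = (\<chi> j. c j *s transpose A $ j)"
    by (simp add: transpose_def vec_eq_iff)
  have "det (\<chi> i j. c j * A $ i $ j) = det (transpose (\<chi> i j. c j * A $ i $ j))" by simp
  also have "\<dots> = prod c UNIV * det (\<chi> j. transpose A $ j)" unfolding e by (simp add: det_rows_mul)
  finally show ?thesis by simp
qed

lemma det_0_imp_left_kernel:
  fixes B :: "'a::field ^ 'n ^ 'n"
  assumes "det B = 0"
  shows "\<exists>l. l \<noteq> 0 \<and> (\<forall>j. (\<Sum>i\<in>UNIV. l $ i * B $ i $ j) = 0)"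
proof -
  have "\<not> invertible (transpose B)" using assms by (simp add: invertible_det_nz)
  then obtain l where "transpose B *v l = 0" "l \<noteq> 0"
    unfolding invertible_left_inverse matrix_left_invertible_ker by blast
  then show ?thesis by (intro exI[of _ l]) (auto simp: transpose_def matrix_vector_mult_def vec_eq_iff mult.commute)
qed

lemma approximant_det_nonzero:
  fixes f :: "complex fls ^ 'n"
  assumes f: "nabla (rf_mat G) f = 0" and inj: "\<And>l. linform f l = 0 \<Longrightarrow> l = 0"
    and alg: "\<And>i k. algebraic (fls_nth (f $ i) k)"
  shows "\<exists>b. \<forall>N M Q P T e. Q \<noteq> 0 \<longrightarrow> fls_subdegree Q \<le> N \<longrightarrow> (\<forall>i. ordge (N + M + 1) (Q * f $ i - rf (P $ i))) \<longrightarrow>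
     b \<le> M \<longrightarrow> T \<noteq> 0 \<longrightarrow> bij_betw e UNIV {..<CARD('n)} \<longrightarrow>
     det (\<chi> i j. T ^ e j * nabla_divided (rf_mat G) (e j) (rf_vec P) $ i) \<noteq> 0"
proof -
  obtain b where b: "\<And>U. dstable G U \<Longrightarrow> U \<noteq> {0} \<Longrightarrow>
    \<exists>l\<in>U. l \<noteq> 0 \<and> fls_subdegree (linform f l) \<le> b \<and> (\<forall>i. ordge (- b) (rf (l $ i)))"
    using dstable_contains_bounded_form[OF f inj alg] by blast
  have "det (\<chi> i j. T ^ e j * nabla_divided (rf_mat G) (e j) (rf_vec P) $ i) \<noteq> 0"
    if Q: "Q \<noteq> 0" "fls_subdegree Q \<le> N" and R: "\<And>i. ordge (N + M + 1) (Q * f $ i - rf (P $ i))"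
      and M: "2 * b \<le> M" and T: "T \<noteq> 0" and e: "bij_betw e UNIV {..<CARD('n)}"
    for N M Q P T and e :: "'n \<Rightarrow> nat"
  proof
    assume det0: "det (\<chi> i j. T ^ e j * nabla_divided (rf_mat G) (e j) (rf_vec P) $ i) = 0"
    define B where "B = (\<chi> i j. (rnabla G ^^ e j) P $ i)"
    have "(nabla (rf_mat G) ^^ h) (rf_vec P) $ i = rf ((rnabla G ^^ h) P $ i)" for h i
      unfolding rf_vec_rnabla_funpow[symmetric] by (simp add: rf_vec_def)
    then have "(\<chi> i j. T ^ e j * nabla_divided (rf_mat G) (e j) (rf_vec P) $ i)
        = (\<chi> i j. (T ^ e j / fact (e j)) * rf_mat B $ i $ j)"
      by (simp add: nabla_divided_def B_def rf_mat_def vec_eq_iff)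
    then have "(\<Prod>j\<in>UNIV. T ^ e j / fact (e j)) * rf (det B) = 0"
      using det0 by (simp only: det_mul_columns det_rf_mat)
    moreover have "(\<Prod>j\<in>UNIV. T ^ e j / fact (e j)) \<noteq> 0" using T fls_fact_nz by simp
    ultimately have "det B = 0" by simp
    then obtain l where l: "l \<noteq> 0" "\<And>j. (\<Sum>i\<in>UNIV. l $ i * B $ i $ j) = 0" using det_0_imp_left_kernel by blast
    have ann: "rdot l ((rnabla G ^^ h) P) = 0" if hn: "h < CARD('n)" for h
    proof -
      have "h \<in> range e" using e hn by (simp add: bij_betw_def)
      then obtain j where "h = e j" by blast
      then show ?thesis using l(2)[of j] by (simp add: rdot_def B_def)
    qed
    have "dstable G {l. \<forall>h. rdot l ((rnabla G ^^ h) P) = 0}" "{l. \<forall>h. rdot l ((rnabla G ^^ h) P) = 0} \<noteq> {0}"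
      using annihilator_dstable[OF l(1)] ann by blast+
    from b[OF this] obtain u where
      uU: "u \<in> {l. \<forall>h. rdot l ((rnabla G ^^ h) P) = 0}" and
      u: "u \<noteq> 0" "fls_subdegree (linform f u) \<le> b" "\<forall>i. ordge (- b) (rf (u $ i))"
      by (elim bexE conjE) (rule that)
    have u0: "rdot u P = 0" using uU by (auto dest: spec[of _ 0])
    have "(\<Sum>i\<in>UNIV. rf (u $ i) * (Q * f $ i - rf (P $ i))) = Q * linform f u - rf (rdot u P)"
      by (simp add: linform_def rdot_def algebra_simps sum_subtractf sum_distrib_left)
    also have "rdot u P = 0" by (rule u0)
    finally have e1: "Q * linform f u = (\<Sum>i\<in>UNIV. rf (u $ i) * (Q * f $ i - rf (P $ i)))" by simp
    have "ordge (- b + (N + M + 1)) (Q * linform f u)"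
      unfolding e1 using u(3) R by (intro ordge_sum ordge_mult) auto
    moreover have nz: "linform f u \<noteq> 0" using inj u(1) by blast
    ultimately have "- b + (N + M + 1) \<le> fls_subdegree (Q * linform f u)"
      using Q(1) by (intro ordge_subdegree) auto
    also have "\<dots> = fls_subdegree Q + fls_subdegree (linform f u)" using Q(1) nz by simp
    finally show False using Q(2) u(2) M by simp
  qed
  then show ?thesis by (intro exI[of _ "2 * b"]) blast
qed

section \<open>Integrality of the approximants\<close>

lemma approximant_coeffs:
  fixes f P :: "complex fls ^ 'n" and N M m t :: nat
  assumes f: "nabla G f = 0" "\<And>i. ordge 0 (f $ i)"
    and T: "pdeg (int t) T" "\<And>i j. pdeg (int t) (T * G $ i $ j)"
    and P: "\<And>i. pdeg (int N) (P $ i)" and R: "\<And>i. ordge (int (N + M + 1)) (Q * f $ i - P $ i)"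
    and m: "m * (t + 1) \<le> M"
  shows "pdeg (int (N + m * t)) (T ^ m * nabla_divided G m P $ i)"
    and "k \<le> int (N + m * t) \<Longrightarrow> fls_nth (T ^ m * nabla_divided G m P $ i) k = fls_nth (T ^ m * hasse m Q * f $ i) k"
proof -
  have eq: "T ^ m * nabla_divided G m w $ i = (T ^ m * (nabla G ^^ m) w $ i) / fact m" for w
    by (simp add: nabla_divided_def)
  show "pdeg (int (N + m * t)) (T ^ m * nabla_divided G m P $ i)"
    unfolding eq using pdeg_divide_fact[OF pdeg_power_nabla[OF T P, of m i]] by simp
  define w where "w = (\<chi> i. Q * f $ i - P $ i)"
  have Pw: "P = Q *s f - w" by (simp add: w_def vec_eq_iff)
  have "(nabla G ^^ m) P $ i = (fls_deriv ^^ m) Q * f $ i - (nabla G ^^ m) w $ i"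
    unfolding Pw nabla_funpow_diff nabla_funpow_solution[OF f(1)] by simp
  then have "T ^ m * nabla_divided G m P $ i = T ^ m * hasse m Q * f $ i - (T ^ m * (nabla G ^^ m) w $ i) / fact m"
    unfolding eq hasse_def by (simp add: right_diff_distrib diff_divide_distrib mult_ac)
  moreover have "ordge (int (N + M + 1) - int m) ((T ^ m * (nabla G ^^ m) w $ i) / fact m)"
    using T pdeg_ordge R by (intro ordge_divide_fact ordge_power_nabla) (auto simp: w_def)
  moreover have "int (N + m * t) < int (N + M + 1) - int m" using m by (simp add: algebra_simps flip: of_nat_add of_nat_mult)
  ultimately show "fls_nth (T ^ m * nabla_divided G m P $ i) k = fls_nth (T ^ m * hasse m Q * f $ i) k"
    if "k \<le> int (N + m * t)" using that by (simp add: ordge_def)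
qed

lemma approximant_int:
  fixes f P :: "complex fls ^ 'n" and N M m t \<delta> :: nat
  assumes f: "nabla G f = 0" "\<And>i. ordge 0 (f $ i)"
    and T: "pdeg (int t) T" "\<And>i j. pdeg (int t) (T * G $ i $ j)" "T \<in> int_fls"
    and P: "\<And>i. pdeg (int N) (P $ i)" and R: "\<And>i. ordge (int (N + M + 1)) (Q * f $ i - P $ i)"
    and Q: "Q \<in> int_fls" "pdeg (int N) Q"
    and d: "\<And>i k. k \<le> int (N + M) \<Longrightarrow> algebraic_int (of_nat \<delta> * fls_nth (f $ i) k)"
    and m: "m * (t + 1) \<le> M"
  shows "of_nat \<delta> * (T ^ m * nabla_divided G m P $ i) \<in> int_fls"
  unfolding int_fls_def
proof (intro CollectI allI)
  fix k
  note ac = approximant_coeffs[OF f T(1,2) P R m]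
  have fn: "fls_nth (of_nat \<delta> * g) k = of_nat \<delta> * fls_nth g k" for g :: "complex fls" by (simp add: fls_of_nat)
  show "algebraic_int (fls_nth (of_nat \<delta> * (T ^ m * nabla_divided G m P $ i)) k)"
  proof (cases "k \<le> int (N + m * t)")
    case True
    have hQ: "hasse m Q \<in> int_fls" "ordge 0 (hasse m Q)"
    proof -
      show "hasse m Q \<in> int_fls" using Q by (intro hasse_int)
      have "ordge 0 ((fls_deriv ^^ m) Q)"
        by (induction m) (auto intro: ordge0_deriv simp: pdeg_ordge[OF Q(2)])
      then show "ordge 0 (hasse m Q)" unfolding hasse_def by (rule ordge_divide_fact)
    qed
    have oT: "ordge 0 (T ^ m)"
      by (induction m) (auto intro: ordge_mult0 pdeg_ordge[OF T(1)], auto simp: ordge_def fls_of_nat_nth)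
    have "fls_nth (T ^ m * hasse m Q * f $ i) k = (\<Sum>j=0..k-0. fls_nth (T ^ m * hasse m Q) j * fls_nth (f $ i) (k - j))"
      by (intro fls_mult_nth_ordge ordge_mult0 oT hQ f)
    then have "of_nat \<delta> * fls_nth (T ^ m * hasse m Q * f $ i) k
        = (\<Sum>j=0..k. fls_nth (T ^ m * hasse m Q) j * (of_nat \<delta> * fls_nth (f $ i) (k - j)))"
      by (simp add: sum_distrib_left mult_ac)
    moreover have co: "algebraic_int (fls_nth (T ^ m * hasse m Q) j)" for j
      using int_fls_mult[OF int_fls_power[OF T(3)] hQ(1)] by (simp add: int_fls_def)
    moreover have "int (N + m * t) \<le> int (N + M)" using m by (simp add: algebra_simps flip: of_nat_add of_nat_mult)
    ultimately show ?thesis unfolding fn ac(2)[OF True] using True d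
      by (auto intro!: algebraic_int_sum algebraic_int_mult[OF co])
  next
    case False
    then have "fls_nth (T ^ m * nabla_divided G m P $ i) k = 0" using ac(1) by (auto simp: pdeg_def)
    then show ?thesis unfolding fn by simp
  qed
qed

lemma pdeg_power_iterated_matrix:
  assumes T: "pdeg t T" and TG: "\<And>i j. pdeg t (T * G $ i $ j)"
  shows "pdeg (int s * t) (T ^ s * iterated_matrix G s $ i $ j)"
proof (induction s arbitrary: i j)
  case 0
  then show ?case by (auto simp: mat_def pdeg_def)
next
  case (Suc s)
  let ?W = "\<lambda>i j. T ^ s * iterated_matrix G s $ i $ j"
  have D: "T * fls_deriv (T ^ s * x) = of_nat s * fls_deriv T * (T ^ s * x) + T ^ Suc s * fls_deriv x" for x
  proof -
    have "T * fls_deriv (T ^ s) = of_nat s * T ^ s * fls_deriv T"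
      by (subst fls_deriv_power) (cases s; simp add: mult_ac)
    from arg_cong[OF this, of "\<lambda>y. y * x"] show ?thesis by (simp add: algebra_simps)
  qed
  have eq: "T ^ Suc s * iterated_matrix G (Suc s) $ i $ j
      = (\<Sum>k\<in>UNIV. ?W i k * (T * G $ k $ j)) + (T * fls_deriv (?W i j) - of_nat s * fls_deriv T * ?W i j)"
    by (simp only: D) (simp add: matrix_matrix_mult_def matrix_deriv_def algebra_simps sum_distrib_left)
  have 1: "pdeg (int s * t + t) (\<Sum>k\<in>UNIV. ?W i k * (T * G $ k $ j))"
    by (intro pdeg_sum pdeg_mult Suc.IH TG)
  have 2: "pdeg (int s * t + t) (T * fls_deriv (?W i j))"
    using pdeg_mult[OF T pdeg_deriv[OF Suc.IH]] by (simp add: add.commute)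
  have 3: "pdeg (int s * t + t) (of_nat s * fls_deriv T * ?W i j)"
    using pdeg_mult[OF pdeg_mult[OF pdeg_closed(4) pdeg_deriv[OF T]] Suc.IH] by (simp add: add.commute)
  have e: "int (Suc s) * t = int s * t + t" by (simp add: algebra_simps)
  show ?case unfolding eq e by (rule pdeg_closed(2)[OF 1 pdeg_closed(3)[OF 2 3]])
qed

lemma int_fls_det:
  assumes "\<And>i j. A $ i $ j \<in> int_fls" shows "det A \<in> int_fls"
proof -
  have "of_int (sign p) * (\<Prod>i\<in>UNIV. A $ i $ p i) \<in> int_fls" for p
    by (rule int_fls_mult[OF int_fls_closed(4) int_fls_prod]) (rule assms)
  then show ?thesis unfolding det_def by (intro int_fls_sum)
qed

lemma det_mult_iterated_matrix_int:
  fixes f P :: "complex fls ^ 'n" and N M s t \<delta> :: nat and e :: "'n \<Rightarrow> nat"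
  assumes f: "nabla G f = 0" "\<And>i. ordge 0 (f $ i)"
    and T: "pdeg (int t) T" "\<And>i j. pdeg (int t) (T * G $ i $ j)" "T \<in> int_fls"
    and P: "\<And>i. pdeg (int N) (P $ i)" and R: "\<And>i. ordge (int (N + M + 1)) (Q * f $ i - P $ i)"
    and Q: "Q \<in> int_fls" "pdeg (int N) Q"
    and d: "\<And>i k. k \<le> int (N + M) \<Longrightarrow> algebraic_int (of_nat \<delta> * fls_nth (f $ i) k)"
    and e: "\<And>j. e j < CARD('n)" and s: "(s + CARD('n)) * (t + 1) \<le> M"
  defines "A \<equiv> \<chi> i j. of_nat \<delta> * (T ^ e j * nabla_divided G (e j) P $ i)"
  assumes det: "det A \<noteq> 0"
  shows "det A * (T ^ s * iterated_matrix G s $ i $ k / fact s) \<in> int_fls"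
proof -
  have int: "of_nat \<delta> * (T ^ m * nabla_divided G m P $ i) \<in> int_fls" if "m \<le> s + CARD('n)" for m i
  proof (rule approximant_int[OF f T P R Q d])
    show "m * (t + 1) \<le> M" using mult_le_mono1[OF that, of "t + 1"] s by linarith
  qed
  define W where "W = (\<chi> i k. T ^ s * iterated_matrix G s $ i $ k / fact s)"
  define B where "B = W ** A"
  have B: "B $ i $ j \<in> int_fls" for i j
  proof -
    have "B $ i $ j = of_nat \<delta> * T ^ (e j + s) * ((iterated_matrix G s *v nabla_divided G (e j) P) $ i / fact s)"
      by (simp add: B_def W_def A_def matrix_matrix_mult_def matrix_vector_mult_def sum_distrib_left
          sum_divide_distrib power_add mult_ac)
    also have "\<dots> = (\<Sum>k\<le>s. of_int ((-1) ^ k * int ((e j + k) choose k)) *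
        (T ^ (e j + k + (s - k)) * (of_nat \<delta> * hasse (s - k) (nabla_divided G (e j + k) P $ i))))"
      unfolding iterated_matrix_nabla_divided sum_distrib_left by (intro sum.cong) (auto simp: mult_ac)
    also have "\<dots> \<in> int_fls"
    proof (intro int_fls_sum int_fls_mult[OF int_fls_closed(4)])
      fix k assume k: "k \<in> {..s}"
      have "of_nat \<delta> * hasse (s - k) g = hasse (s - k) (of_nat \<delta> * g)" for g
      proof -
        have "(fls_deriv ^^ l) (of_nat \<delta> * g) = of_nat \<delta> * (fls_deriv ^^ l) g" for l
          by (induction l) auto
        then show ?thesis by (simp add: hasse_def)
      qed
      moreover have "T ^ (e j + k) * (of_nat \<delta> * nabla_divided G (e j + k) P $ i) \<in> int_fls"
        using int[of "e j + k" i] e[of j] k by (simp add: mult_ac)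
      ultimately show "T ^ (e j + k + (s - k)) * (of_nat \<delta> * hasse (s - k) (nabla_divided G (e j + k) P $ i)) \<in> int_fls"
        using hasse_integral_pole[OF T(3)] by simp
    qed
    finally show ?thesis .
  qed
  have Aint: "A $ i $ j \<in> int_fls" for i j using int[of "e j" i] e[of j] by (simp add: A_def)
  have "transpose A *v (W $ i) = B $ i"
    by (simp add: B_def matrix_matrix_mult_def matrix_vector_mult_def transpose_def vec_eq_iff mult.commute)
  moreover have "det (transpose A) \<noteq> 0" using det by simp
  ultimately have "W $ i = (\<chi> k. det (\<chi> a b. if b = k then B $ i $ a else transpose A $ a $ b) / det (transpose A))"
    using cramer by blast
  then have "W $ i $ k = det (\<chi> a b. if b = k then B $ i $ a else transpose A $ a $ b) / det A"
    by simp
  then have "det A * W $ i $ k = det (\<chi> a b. if b = k then B $ i $ a else transpose A $ a $ b)"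
    using det by simp
  also have "\<dots> \<in> int_fls" using B Aint by (intro int_fls_det) (simp add: transpose_def)
  finally show ?thesis by (simp add: W_def)
qed

section \<open>Sizes of conjugates\<close>

definition cbd :: "complex set \<Rightarrow> (complex \<Rightarrow> complex) set \<Rightarrow> nat \<Rightarrow> real \<Rightarrow> complex fls \<Rightarrow> bool" where
  "cbd K S e B g \<longleftrightarrow> pdeg (int e) g \<and> (\<forall>k. fls_nth g k \<in> K) \<and> (\<forall>\<sigma>\<in>S. \<forall>k. cmod (\<sigma> (fls_nth g k)) \<le> B)"

lemma pdeg_mult_nth:
  assumes g: "pdeg e g" and h: "ordge 0 h"
  shows "fls_nth (g * h) n = (\<Sum>i=0..e. fls_nth g i * fls_nth h (n - i))"
proof -
  have "fls_nth (g * h) n = (\<Sum>i=0..n-0. fls_nth g i * fls_nth h (n - i))"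
    by (rule fls_mult_nth_ordge[OF pdeg_ordge[OF g] h])
  also have "\<dots> = (\<Sum>i=0..max n e. fls_nth g i * fls_nth h (n - i))"
    by (rule sum.mono_neutral_left) (use h in \<open>auto simp: ordge_def\<close>)
  also have "\<dots> = (\<Sum>i=0..e. fls_nth g i * fls_nth h (n - i))"
    by (rule sum.mono_neutral_right) (use g in \<open>auto simp: pdeg_def\<close>)
  finally show ?thesis .
qed

context
  fixes K S assumes gal: "galois_field K S"
begin

lemma gal_K: "subfld K" and gal_S: "finite S" "S \<noteq> {}" and gal_emb: "\<sigma> \<in> S \<Longrightarrow> emb K \<sigma>"
  using gal by (auto simp: galois_field_def)

lemma emb_mult_bound:
  assumes g: "cbd K S e B g" and h: "ordge 0 h" "\<And>k. fls_nth h k \<in> K"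
    and s: "\<sigma> \<in> S" and hB: "\<And>k. k \<le> n \<Longrightarrow> cmod (\<sigma> (fls_nth h k)) \<le> B'"
  shows "cmod (\<sigma> (fls_nth (g * h) n)) \<le> real (e + 1) * B * B'"
proof -
  have K: "subfld K" and e: "emb K \<sigma>" using gal_K gal_emb[OF s] by auto
  have gd: "pdeg (int e) g" and gK: "\<And>k. fls_nth g k \<in> K" and gB: "\<And>k. cmod (\<sigma> (fls_nth g k)) \<le> B"
    using g s by (auto simp: cbd_def)
  have "\<sigma> (fls_nth (g * h) n) = (\<Sum>i=0..int e. \<sigma> (fls_nth g i) * \<sigma> (fls_nth h (n - i)))"
    unfolding pdeg_mult_nth[OF gd h(1)]
    by (subst emb_sum[OF K e]) (auto intro!: subfld_closed(4)[OF K] gK h simp: emb_mult[OF K e gK h(2)])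
  also have "cmod \<dots> \<le> (\<Sum>i=0..int e. B * B')"
  proof (rule sum_norm_le)
    fix i assume "i \<in> {0..int e}"
    then show "cmod (\<sigma> (fls_nth g i) * \<sigma> (fls_nth h (n - i))) \<le> B * B'"
      unfolding norm_mult using gB hB[of "n - i"] by (intro mult_mono) (auto intro: order_trans[OF norm_ge_zero])
  qed
  finally show ?thesis by (simp add: mult.assoc add.commute)
qed

lemma cbd_nonneg: "cbd K S e B g \<Longrightarrow> 0 \<le> B"
  using gal_S unfolding cbd_def by (meson ex_in_conv norm_ge_zero order_trans)

lemma cbd_mono: "cbd K S e B g \<Longrightarrow> e \<le> e' \<Longrightarrow> B \<le> B' \<Longrightarrow> cbd K S e' B' g"
  unfolding cbd_def by (meson of_nat_mono order_trans pdeg_mono)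

lemma cbd_mult:
  assumes g: "cbd K S e B g" and h: "cbd K S e' B' h"
  shows "cbd K S (e + e') (real (e + 1) * B * B') (g * h)"
  unfolding cbd_def
proof (intro conjI ballI allI)
  show "pdeg (int (e + e')) (g * h)" using pdeg_mult[of "int e" g "int e'" h] g h by (simp add: cbd_def)
  show "fls_nth (g * h) k \<in> K" for k using g h gal_K by (intro fls_nth_mult_subfld) (auto simp: cbd_def)
  show "cmod (\<sigma> (fls_nth (g * h) k)) \<le> real (e + 1) * B * B'" if "\<sigma> \<in> S" for \<sigma> k
    using h that by (intro emb_mult_bound[OF g _ _ that]) (auto simp: cbd_def intro: pdeg_ordge)
qed

lemma cbd_1: "cbd K S 0 1 1"
  unfolding cbd_def using gal_K gal_emb
  by (auto simp: pdeg_def subfld_closed emb_1[OF gal_K] emb_0[OF gal_K])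

lemma cbd_power: "cbd K S e B g \<Longrightarrow> cbd K S (m * e) ((real (e + 1) * B) ^ m) (g ^ m)"
proof (induction m)
  case (Suc m)
  then show ?case using cbd_mult[of e B g "m * e" "(real (e + 1) * B) ^ m" "g ^ m"] by (simp add: mult_ac)
qed (use cbd_1 in simp)

lemma cbd_prod:
  "finite I \<Longrightarrow> (\<And>i. i \<in> I \<Longrightarrow> cbd K S e B (g i)) \<Longrightarrow> cbd K S (card I * e) ((real (e + 1) * B) ^ card I) (prod g I)"
proof (induction I rule: finite_induct)
  case (insert i I)
  then show ?case
    using cbd_mult[of e B "g i" "card I * e" "(real (e + 1) * B) ^ card I" "prod g I"] by (simp add: mult_ac)
qed (use cbd_1 in simp)

lemma cbd_add: "cbd K S e B g \<Longrightarrow> cbd K S e B' h \<Longrightarrow> cbd K S e (B + B') (g + h)"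
  unfolding cbd_def using gal_K gal_emb
  by (auto intro!: pdeg_closed subfld_closed(3) norm_triangle_mono simp: emb_add[OF gal_K])

lemma cbd_0: "cbd K S e 0 0"
  unfolding cbd_def using gal_K gal_emb by (auto simp: pdeg_def subfld_closed emb_0[OF gal_K])

lemma cbd_sum: "finite I \<Longrightarrow> (\<And>i. i \<in> I \<Longrightarrow> cbd K S e B (g i)) \<Longrightarrow> cbd K S e (real (card I) * B) (sum g I)"
proof (induction I rule: finite_induct)
  case (insert i I)
  then show ?case using cbd_add[of e B "g i" "real (card I) * B" "sum g I"] by (simp add: algebra_simps)
qed (use cbd_0 in simp)

lemma cbd_of_int: "cbd K S 0 \<bar>real_of_int n\<bar> (of_int n)"
  unfolding cbd_def using gal_K gal_emb
  by (auto simp: pdeg_def fls_of_int_nth subfld_of_int subfld_closed emb_0[OF gal_K] emb_of_int[OF gal_K])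

lemma cbd_of_int_mult: "cbd K S e B g \<Longrightarrow> cbd K S e (\<bar>real_of_int n\<bar> * B) (of_int n * g)"
  using cbd_mult[OF cbd_of_int, of e B g n] by simp

lemma cbd_det:
  fixes A :: "complex fls ^ 'n ^ 'n"
  assumes "\<And>i j. cbd K S e B (A $ i $ j)"
  shows "cbd K S (CARD('n) * e) (fact CARD('n) * (real (e + 1) * B) ^ CARD('n)) (det A)"
proof -
  have fin: "finite {p. p permutes (UNIV :: 'n set)}" by (simp add: finite_permutations)
  have "cbd K S (CARD('n) * e) ((real (e + 1) * B) ^ CARD('n)) (of_int (sign p) * (\<Prod>i\<in>UNIV. A $ i $ p i))" for p
  proof -
    have "\<bar>real_of_int (sign p)\<bar> = 1" by (simp add: sign_def)
    then show ?thesis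
      using cbd_of_int_mult[OF cbd_prod[OF finite_class.finite_UNIV assms], where n = "sign p"] by simp
  qed
  from cbd_sum[OF fin this] show ?thesis
    unfolding det_def by (simp add: card_permutations)
qed

lemma cbd_deriv:
  assumes g: "cbd K S e B g"
  shows "cbd K S e (real (e + 1) * B) (fls_deriv g)"
  unfolding cbd_def
proof (intro conjI ballI allI)
  have gK: "fls_nth g k \<in> K" for k using g by (simp add: cbd_def)
  show "pdeg (int e) (fls_deriv g)" using g by (intro pdeg_deriv) (simp add: cbd_def)
  have "fls_nth (fls_deriv g) k = of_int (k + 1) * fls_nth g (k + 1)" for k by simp
  then show "fls_nth (fls_deriv g) k \<in> K" for k
    using subfld_closed(4)[OF gal_K subfld_of_int[OF gal_K] gK] by metis
  fix \<sigma> k assume s: "\<sigma> \<in> S"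
  have "\<sigma> (fls_nth (fls_deriv g) k) = of_int (k + 1) * \<sigma> (fls_nth g (k + 1))"
    using emb_mult[OF gal_K gal_emb[OF s] subfld_of_int[OF gal_K] gK] emb_of_int[OF gal_K gal_emb[OF s], of "k + 1"]
    by (metis fls_deriv_nth)
  then have n: "cmod (\<sigma> (fls_nth (fls_deriv g) k)) = \<bar>real_of_int (k + 1)\<bar> * cmod (\<sigma> (fls_nth g (k + 1)))"
    by (simp only: norm_mult norm_of_int)
  show "cmod (\<sigma> (fls_nth (fls_deriv g) k)) \<le> real (e + 1) * B"
  proof (cases "fls_nth g (k + 1) = 0")
    case True
    then show ?thesis unfolding n using emb_0[OF gal_K gal_emb[OF s]] cbd_nonneg[OF g] by simp
  next
    case False
    then have "0 \<le> k + 1 \<and> k + 1 \<le> int e" using g by (auto simp: cbd_def pdeg_def)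
    then have "\<bar>real_of_int (k + 1)\<bar> \<le> real (e + 1)" by linarith
    then show ?thesis unfolding n using g s by (intro mult_mono) (auto simp: cbd_def)
  qed
qed

lemma cbd_hasse:
  assumes g: "cbd K S e B g"
  shows "cbd K S e (real (e + 1) ^ h * B) (hasse h g)"
proof -
  have d: "cbd K S e (real (e + 1) ^ h * B) ((fls_deriv ^^ h) g)" for h
  proof (induction h)
    case (Suc h)
    then show ?case using cbd_deriv[OF Suc.IH] by (simp add: mult_ac)
  qed (use g in simp)
  define x where "x = (1 / fact h :: complex)"
  have xQ: "x \<in> \<rat>" unfolding x_def by (metis Rats_divide Rats_1 Rats_of_nat of_nat_fact)
  have nth: "fls_nth (hasse h g) k = x * fls_nth ((fls_deriv ^^ h) g) k" for k
    by (simp add: hasse_def fls_nth_divide_fact x_def)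
  have c1: "cmod x \<le> 1" by (simp add: x_def norm_divide fact_ge_1)
  show ?thesis unfolding cbd_def
  proof (intro conjI ballI allI)
    show "pdeg (int e) (hasse h g)" unfolding hasse_def using d by (intro pdeg_divide_fact) (simp add: cbd_def)
    have dK: "fls_nth ((fls_deriv ^^ h) g) k \<in> K" for k using d by (simp add: cbd_def)
    show "fls_nth (hasse h g) k \<in> K" for k
      unfolding nth using dK subfld_Rats[OF gal_K xQ] gal_K by (intro subfld_closed)
    fix \<sigma> k assume s: "\<sigma> \<in> S"
    have "cmod (\<sigma> (fls_nth (hasse h g) k)) = cmod x * cmod (\<sigma> (fls_nth ((fls_deriv ^^ h) g) k))"
      unfolding nth emb_mult[OF gal_K gal_emb[OF s] subfld_Rats[OF gal_K xQ] dK]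
        emb_Rats[OF gal_K gal_emb[OF s] xQ] norm_mult ..
    also have "\<dots> \<le> 1 * (real (e + 1) ^ h * B)"
      using c1 d[of h] s by (intro mult_mono) (auto simp: cbd_def)
    finally show "cmod (\<sigma> (fls_nth (hasse h g) k)) \<le> real (e + 1) ^ h * B" by simp
  qed
qed

end

section \<open>A common denominator from one approximation\<close>

lemma hermite_pade_exists:
  fixes F :: "complex fls ^ 'n" and N M C :: nat
  assumes gal: "galois_field K S"
    and F: "\<And>i. ordge 0 (F $ i)" "\<And>i k. fls_nth (F $ i) k \<in> K"
    and FC: "\<And>i k \<sigma>. \<sigma> \<in> S \<Longrightarrow> cmod (\<sigma> (fls_nth (F $ i) (int k))) \<le> real C ^ (k + 1)" and C: "C \<ge> 1"
    and d: "\<And>i k. k \<le> int (N + M) \<Longrightarrow> algebraic_int (of_nat \<delta> * fls_nth (F $ i) k)"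
      "\<delta> \<ge> 1" "\<delta> \<le> C ^ (N + M + 1)"
    and N: "N + 1 = 4 * card S * CARD('n) * M"
  shows "\<exists>Q P. Q \<noteq> 0 \<and> Q \<in> int_fls \<and> cbd K S N (real (7 * (N + 1) * C ^ (2 * (N + M + 1)))) Q \<and>
    (\<forall>i. pdeg (int N) (P $ i) \<and> (\<forall>k. fls_nth (P $ i) k \<in> K) \<and> ordge (int (N + M + 1)) (Q * F $ i - P $ i))"
proof -
  have K: "subfld K" and emb: "\<And>\<sigma>. \<sigma> \<in> S \<Longrightarrow> emb K \<sigma>" using gal by (auto simp: galois_field_def)
  define A where "A = C ^ (2 * (N + M + 1))"
  define \<alpha> where "\<alpha> = (\<lambda>(i::'n, r) k. of_nat \<delta> * fls_nth (F $ i) (int (N + 1 + r) - int k))"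
  have aK: "\<alpha> ir k \<in> K \<and> algebraic_int (\<alpha> ir k)" if ir: "ir \<in> UNIV \<times> {..<M}" for ir k
  proof -
    obtain i r where e: "ir = (i, r)" "r < M" using ir by auto
    show ?thesis unfolding e \<alpha>_def using d(1) F(2) K e(2)
      by (auto intro!: subfld_closed(4) subfld_of_nat)
  qed
  have aA: "cmod (\<sigma> (\<alpha> ir k)) \<le> real A" if ir: "ir \<in> UNIV \<times> {..<M}" and s: "\<sigma> \<in> S" for ir k \<sigma>
  proof -
    obtain i r where e: "ir = (i, r)" "r < M" using ir by auto
    define l where "l = int (N + 1 + r) - int k"
    have "\<sigma> (\<alpha> ir k) = of_nat \<delta> * \<sigma> (fls_nth (F $ i) l)"
      unfolding e \<alpha>_def l_def using emb_mult[OF K emb[OF s] subfld_of_nat[OF K] F(2)] emb_of_nat[OF K emb[OF s]] by simp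
    moreover have "cmod (\<sigma> (fls_nth (F $ i) l)) \<le> real C ^ (N + M + 1)"
    proof (cases "l < 0")
      case True
      then have "fls_nth (F $ i) l = 0" using F(1)[of i] by (simp add: ordge_def)
      then show ?thesis using emb_0[OF K emb[OF s]] by simp
    next
      case False
      then have "cmod (\<sigma> (fls_nth (F $ i) l)) \<le> real C ^ (nat l + 1)" using FC[OF s, of i "nat l"] by simp
      also have "\<dots> \<le> real C ^ (N + M + 1)" using C e(2) by (intro power_increasing) (auto simp: l_def)
      finally show ?thesis .
    qed
    moreover have "real \<delta> \<le> real (C ^ (N + M + 1))" using d(3) by (rule of_nat_mono)
    ultimately have "cmod (\<sigma> (\<alpha> ir k)) \<le> real (C ^ (N + M + 1)) * real C ^ (N + M + 1)"
      by (simp only: norm_mult norm_of_nat) (intro mult_mono, auto)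
    also have "\<dots> = real A" by (simp add: A_def power_add mult_2)
    finally show ?thesis .
  qed
  have "4 * card S * card (UNIV \<times> {..<M} :: ('n \<times> nat) set) \<le> N + 1"
    by (simp only: N) (simp add: card_cartesian_product)
  then have "\<exists>q::nat \<Rightarrow> int. (\<exists>k<N + 1. q k \<noteq> 0) \<and> (\<forall>k. \<bar>q k\<bar> \<le> int (7 * (N + 1) * A)) \<and>
           (\<forall>ir\<in>UNIV \<times> {..<M}. (\<Sum>k<N + 1. of_int (q k) * \<alpha> ir k) = 0)"
    using C aK aA by (intro siegel[OF gal]) (auto simp: A_def)
  then obtain q :: "nat \<Rightarrow> int" where q: "\<exists>k<N + 1. q k \<noteq> 0" "\<And>k. \<bar>q k\<bar> \<le> int (7 * (N + 1) * A)"
    "\<And>i r. r < M \<Longrightarrow> (\<Sum>k<N + 1. of_int (q k) * \<alpha> (i, r) k) = 0" by blast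
  define p where "p = (\<Sum>k<N + 1. monom (of_int (q k) :: complex) k)"
  have cp: "coeff p k = (if k < N + 1 then of_int (q k) else 0)" for k
    by (simp add: p_def coeff_sum)
  define Q where "Q = fls_of_poly p"
  have Qn: "fls_nth Q k = (if 0 \<le> k \<and> k \<le> int N then of_int (q (nat k)) else 0)" for k
    by (auto simp: Q_def fls_of_poly_nth cp)
  have "Q \<noteq> 0"
  proof
    assume "Q = 0"
    obtain k where "k < N + 1" "q k \<noteq> 0" using q(1) by blast
    then have "fls_nth Q (int k) \<noteq> 0" by (simp add: Qn)
    then show False using \<open>Q = 0\<close> by simp
  qed
  have Qd: "pdeg (int N) Q" by (auto simp: pdeg_def Qn split: if_splits)
  have QK: "fls_nth Q k \<in> K" for k using K by (simp add: Qn subfld_of_int subfld_closed)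
  have "Q \<in> int_fls" by (simp add: int_fls_def Qn)
  have Qb: "cbd K S N (real (7 * (N + 1) * A)) Q"
    unfolding cbd_def
  proof (intro conjI ballI allI Qd QK)
    fix \<sigma> k assume s: "\<sigma> \<in> S"
    have "\<bar>real_of_int (q j)\<bar> \<le> real (7 * (N + 1) * A)" for j using q(2)[of j] by linarith
    then show "cmod (\<sigma> (fls_nth Q k)) \<le> real (7 * (N + 1) * A)"
      by (auto simp: Qn emb_0[OF K emb[OF s]] emb_of_int[OF K emb[OF s]])
  qed
  define P where "P = (\<chi> i. fls_of_poly (\<Sum>k<N + 1. monom (fls_nth (Q * F $ i) (int k)) k))"
  have Pn: "fls_nth (P $ i) k = (if 0 \<le> k \<and> k \<le> int N then fls_nth (Q * F $ i) k else 0)" for i k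
    by (auto simp: P_def fls_of_poly_nth coeff_sum)
  have "pdeg (int N) (P $ i)" for i by (auto simp: pdeg_def Pn split: if_splits)
  moreover have "fls_nth (P $ i) k \<in> K" for i k
    using fls_nth_mult_subfld[OF K QK F(2)] K by (simp add: Pn subfld_closed)
  moreover have "ordge (int (N + M + 1)) (Q * F $ i - P $ i)" for i
    unfolding ordge_def
  proof (intro allI impI)
    fix k assume k: "k < int (N + M + 1)"
    have oQF: "ordge 0 (Q * F $ i)" using ordge_mult0[OF pdeg_ordge[OF Qd] F(1)] .
    show "fls_nth (Q * F $ i - P $ i) k = 0"
    proof (cases "k \<le> int N")
      case True
      then show ?thesis using oQF by (cases "k < 0") (auto simp: Pn ordge_def)
    next
      case False
      define r where "r = nat (k - int (N + 1))"
      have r: "k = int (N + 1 + r)" "r < M" using False k by (auto simp: r_def)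
      have "fls_nth (Q * F $ i) k = (\<Sum>j=0..int N. fls_nth Q j * fls_nth (F $ i) (k - j))"
        by (rule pdeg_mult_nth[OF Qd F(1)])
      also have "\<dots> = (\<Sum>j<N + 1. fls_nth Q (int j) * fls_nth (F $ i) (k - int j))"
        by (rule sum.reindex_bij_witness[of _ int nat]) auto
      also have "\<dots> = (\<Sum>j<N + 1. of_int (q j) * fls_nth (F $ i) (k - int j))"
        by (intro sum.cong) (auto simp: Qn)
      finally have "of_nat \<delta> * fls_nth (Q * F $ i) k = (\<Sum>j<N + 1. of_int (q j) * \<alpha> (i, r) j)"
        by (simp add: \<alpha>_def r sum_distrib_left mult_ac del: lessThan_Suc sum.lessThan_Suc)
      also have "\<dots> = 0" using q(3)[OF r(2)] .
      finally show ?thesis using False d(2) by (simp add: Pn)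
    qed
  qed
  ultimately show ?thesis using \<open>Q \<noteq> 0\<close> \<open>Q \<in> int_fls\<close> Qb unfolding A_def by blast
qed

text \<open>The bound on the denominator: \<open>L\<close> dominates all degrees and indices, and the inner factor
  bounds the entries of the matrix of approximants.\<close>

definition den_bound :: "nat \<Rightarrow> nat \<Rightarrow> real \<Rightarrow> real \<Rightarrow> nat \<Rightarrow> real" where
  "den_bound d n c C L = (fact n * (real L * (C ^ L * (real L * (real L * c ^ n * (real L ^ n * (7 * real L * C ^ (2 * L)))) * C ^ L))) ^ n) ^ d"

lemma iterated_matrix_denominator:
  fixes F :: "complex fls ^ 'n" and M t C s :: nat and BT :: real
  assumes gal: "galois_field K S"
    and F: "nabla G F = 0" "\<And>i. ordge 0 (F $ i)" "\<And>i k. fls_nth (F $ i) k \<in> K"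
    and FC: "\<And>i k \<sigma>. \<sigma> \<in> S \<Longrightarrow> cmod (\<sigma> (fls_nth (F $ i) (int k))) \<le> real C ^ (k + 1)" and C: "C \<ge> 1"
    and den: "\<And>N. \<exists>\<delta>\<ge>1. \<delta> \<le> C ^ (N + 1) \<and> (\<forall>i k. k \<le> int N \<longrightarrow> algebraic_int (of_nat \<delta> * fls_nth (F $ i) k))"
    and T: "cbd K S t BT T" "T \<in> int_fls" "BT \<ge> 1" and TG: "\<And>i j. pdeg (int t) (T * G $ i $ j)"
    and nonvan: "\<And>N Q P e. Q \<noteq> 0 \<Longrightarrow> pdeg (int N) Q \<Longrightarrow> (\<And>i. pdeg (int N) (P $ i)) \<Longrightarrow>
      (\<And>i k. fls_nth (P $ i) k \<in> K) \<Longrightarrow> (\<And>i. ordge (int (N + M + 1)) (Q * F $ i - P $ i)) \<Longrightarrow>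
      bij_betw e UNIV {..<CARD('n)} \<Longrightarrow> det (\<chi> i j. T ^ e j * nabla_divided G (e j) P $ i) \<noteq> 0"
    and s: "(s + CARD('n)) * (t + 1) \<le> M"
  defines "L \<equiv> 4 * card S * CARD('n) * M + M + CARD('n) * t"
  shows "\<exists>q::nat. 1 \<le> q \<and> real q \<le> den_bound (card S) CARD('n) (real (t + 1) * BT) (real C) L \<and>
    (\<forall>m\<le>s. \<forall>i j k. algebraic_int (of_nat q * fls_nth (T ^ m * iterated_matrix G m $ i $ j / fact m) k))"
proof -
  have K: "subfld K" and emb: "\<And>\<sigma>. \<sigma> \<in> S \<Longrightarrow> emb K \<sigma>" using gal by (auto simp: galois_field_def)
  have S: "finite S" "S \<noteq> {}" using gal_S[OF gal] .
  define n where "n = CARD('n)"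
  have n: "n \<ge> 1" by (simp add: n_def Suc_leI)
  have "(s + n) * (t + 1) \<ge> 1" using n by simp
  then have M: "M \<ge> 1" using s by (simp add: n_def)
  define N where "N = 4 * card S * n * M - 1"
  have "card S \<ge> 1" using S by (simp add: Suc_leI card_gt_0_iff)
  then have "4 * card S * n * M \<ge> 1" using n M by simp
  then have N: "N + 1 = 4 * card S * CARD('n) * M" by (simp add: N_def n_def)
  have L: "L = N + M + n * t + 1" using N by (simp add: L_def n_def)
  obtain \<delta> where d: "\<delta> \<ge> 1" "\<delta> \<le> C ^ (N + M + 1)"
    "\<And>i k. k \<le> int (N + M) \<Longrightarrow> algebraic_int (of_nat \<delta> * fls_nth (F $ i) k)" using den[of "N + M"] by auto
  have "\<exists>Q P. Q \<noteq> 0 \<and> Q \<in> int_fls \<and> cbd K S N (real (7 * (N + 1) * C ^ (2 * (N + M + 1)))) Q \<and>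
    (\<forall>i. pdeg (int N) (P $ i) \<and> (\<forall>k. fls_nth (P $ i) k \<in> K) \<and> ordge (int (N + M + 1)) (Q * F $ i - P $ i))"
    by (rule hermite_pade_exists[where C = C and \<delta> = \<delta>, OF gal F(2,3) _ C d(3,1,2) N]) (rule FC)
  then obtain Q P where "Q \<noteq> 0 \<and> Q \<in> int_fls \<and> cbd K S N (real (7 * (N + 1) * C ^ (2 * (N + M + 1)))) Q \<and>
    (\<forall>i. pdeg (int N) (P $ i) \<and> (\<forall>k. fls_nth (P $ i) k \<in> K) \<and> ordge (int (N + M + 1)) (Q * F $ i - P $ i))"
    by (elim exE) (rule that)
  then have QP: "Q \<noteq> 0" "Q \<in> int_fls" "cbd K S N (real (7 * (N + 1) * C ^ (2 * (N + M + 1)))) Q"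
    "\<And>i. pdeg (int N) (P $ i)" "\<And>i k. fls_nth (P $ i) k \<in> K"
    "\<And>i. ordge (int (N + M + 1)) (Q * F $ i - P $ i)" by simp_all
  have Qd: "pdeg (int N) Q" and Td: "pdeg (int t) T" using QP(3) T(1) by (auto simp: cbd_def)
  obtain e where e: "bij_betw e (UNIV :: 'n set) {..<CARD('n)}"
    using ex_bij_betw_finite_nat[of "UNIV :: 'n set"] by (auto simp: atLeast0LessThan)
  have en: "e j < CARD('n)" for j using e by (metis UNIV_I bij_betwE lessThan_iff)
  define A where "A = (\<chi> i j. of_nat \<delta> * (T ^ e j * nabla_divided G (e j) P $ i))"
  have detA: "det A \<noteq> 0"
  proof -
    have "A = (\<chi> i j. (\<lambda>_. of_nat \<delta>) j * (\<chi> i j. T ^ e j * nabla_divided G (e j) P $ i) $ i $ j)"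
      by (simp add: A_def vec_eq_iff)
    then have "det A = (of_nat \<delta>) ^ CARD('n) * det (\<chi> i j. T ^ e j * nabla_divided G (e j) P $ i)"
      by (simp only: det_mul_columns prod_constant)
    moreover have "det (\<chi> i j. T ^ e j * nabla_divided G (e j) P $ i) \<noteq> 0"
      by (rule nonvan[OF QP(1) Qd QP(4,5,6) e])
    ultimately show ?thesis using d(1) by simp
  qed
  have key: "det A * (T ^ m * iterated_matrix G m $ i $ j / fact m) \<in> int_fls" if "m \<le> s" for m i j
    unfolding A_def
  proof (rule det_mult_iterated_matrix_int[OF F(1,2) Td TG T(2) QP(4,6,2) Qd d(3) en])
    show "(m + CARD('n)) * (t + 1) \<le> M" using s mult_le_mono1[of "m + CARD('n)" "s + CARD('n)" "t + 1"] that by linarith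
    show "det (\<chi> i j. of_nat \<delta> * (T ^ e j * nabla_divided G (e j) P $ i)) \<noteq> 0" using detA by (simp add: A_def)
  qed
  define c where "c = real (t + 1) * BT"
  have c: "c \<ge> 1" unfolding c_def using T(3) by (simp add: mult_ge1_I)
  define BQ where "BQ = 7 * real L * real C ^ (2 * L)"
  define BA where "BA = real C ^ L * (real L * (real L * c ^ n * (real L ^ n * BQ)) * real C ^ L)"
  have C1: "real C \<ge> 1" using C by simp
  have L1: "real L \<ge> 1" by (simp add: L)
  have ent: "cbd K S (N + n * t) BA (A $ i $ j)" for i j
  proof -
    define h where "h = e j"
    have h: "h \<le> n" using en[of j] by (simp add: h_def n_def)
    have ht: "h * t \<le> n * t" using h by simp
    have hM: "h * (t + 1) \<le> M" using s h mult_le_mono1[of h "s + n" "t + 1"] by (simp add: n_def)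
    note ac = approximant_coeffs[OF F(1,2) Td TG QP(4,6) hM]
    have Q1: "cbd K S N BQ Q"
    proof (rule cbd_mono[OF gal QP(3) order_refl])
      have "real C ^ (2 * (N + M + 1)) \<le> real C ^ (2 * L)" using C1 by (intro power_increasing) (auto simp: L)
      moreover have "7 * real (N + 1) \<le> 7 * real L" by (simp add: L)
      ultimately have "(7 * real (N + 1)) * real C ^ (2 * (N + M + 1)) \<le> (7 * real L) * real C ^ (2 * L)"
        by (intro mult_mono) auto
      then show "real (7 * (N + 1) * C ^ (2 * (N + M + 1))) \<le> BQ" by (simp add: BQ_def)
    qed
    have BQ0: "0 \<le> BQ" using cbd_nonneg[OF gal Q1] .
    have Q2: "cbd K S N (real L ^ n * BQ) (hasse h Q)"
    proof (rule cbd_mono[OF gal cbd_hasse[OF gal Q1] order_refl])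
      have "real (N + 1) ^ h \<le> real L ^ h" by (intro power_mono) (auto simp: L)
      also have "\<dots> \<le> real L ^ n" using L1 h by (intro power_increasing)
      finally show "real (N + 1) ^ h * BQ \<le> real L ^ n * BQ" using BQ0 by (intro mult_right_mono)
    qed
    have T1: "cbd K S (h * t) (c ^ n) (T ^ h)"
    proof (rule cbd_mono[OF gal cbd_power[OF gal T(1)] order_refl])
      show "(real (t + 1) * BT) ^ h \<le> c ^ n" unfolding c_def[symmetric] using c h by (intro power_increasing)
    qed
    have TQ: "cbd K S (h * t + N) (real L * c ^ n * (real L ^ n * BQ)) (T ^ h * hasse h Q)"
    proof (rule cbd_mono[OF gal cbd_mult[OF gal T1 Q2] order_refl])
      have "h * t + 1 \<le> L" using ht unfolding L by linarith
      then have "real (h * t + 1) \<le> real L" by (rule of_nat_mono)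
      then show "real (h * t + 1) * c ^ n * (real L ^ n * BQ) \<le> real L * c ^ n * (real L ^ n * BQ)"
        using c BQ0 by (intro mult_right_mono) auto
    qed
    define X where "X = T ^ h * nabla_divided G h P $ i"
    have XK: "fls_nth X k \<in> K" for k
    proof (cases "k \<le> int (N + h * t)")
      case True
      show ?thesis unfolding X_def ac(2)[OF True]
        by (rule fls_nth_mult_subfld[OF K _ F(3)]) (use TQ in \<open>simp add: cbd_def\<close>)
    next
      case False
      then have "fls_nth X k = 0" using ac(1)[of i] by (auto simp: X_def pdeg_def)
      then show ?thesis using K by (simp add: subfld_closed)
    qed
    have XB: "cmod (\<sigma> (fls_nth X k)) \<le> real L * (real L * c ^ n * (real L ^ n * BQ)) * real C ^ L" if s: "\<sigma> \<in> S" for \<sigma> k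
    proof (cases "k \<le> int (N + h * t)")
      case True
      have nn: "0 \<le> real L * c ^ n * (real L ^ n * BQ)" using cbd_nonneg[OF gal TQ] .
      have "cmod (\<sigma> (fls_nth X k)) \<le> real (h * t + N + 1) * (real L * c ^ n * (real L ^ n * BQ)) * real C ^ L"
        unfolding X_def ac(2)[OF True]
      proof (rule emb_mult_bound[OF gal TQ F(2,3) s])
        fix l assume l: "l \<le> k"
        show "cmod (\<sigma> (fls_nth (F $ i) l)) \<le> real C ^ L"
        proof (cases "l < 0")
          case True
          then have "fls_nth (F $ i) l = 0" using F(2)[of i] by (simp add: ordge_def)
          then show ?thesis using emb_0[OF K emb[OF s]] by simp
        next
          case False
          then have "cmod (\<sigma> (fls_nth (F $ i) l)) \<le> real C ^ (nat l + 1)" using FC[OF s, of i "nat l"] by simp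
          also have "\<dots> \<le> real C ^ L"
          proof (rule power_increasing[OF _ C1])
            have "int (N + h * t) \<le> int (N + n * t)" using ht by linarith
            then have "l \<le> int (N + n * t)" using l \<open>k \<le> int (N + h * t)\<close> by linarith
            then have "nat l \<le> N + n * t" unfolding nat_le_iff .
            then show "nat l + 1 \<le> L" using M unfolding L by linarith
          qed
          finally show ?thesis .
        qed
      qed
      also have "\<dots> \<le> real L * (real L * c ^ n * (real L ^ n * BQ)) * real C ^ L"
      proof -
        have "h * t + N + 1 \<le> L" using ht M unfolding L by linarith
        then have "real (h * t + N + 1) \<le> real L" by (rule of_nat_mono)
        then show ?thesis using nn by (intro mult_right_mono) auto
      qed
      finally show ?thesis .
    next
      case False
      then have "fls_nth X k = 0" using ac(1)[of i] by (auto simp: X_def pdeg_def)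
      then show ?thesis using emb_0[OF K emb[OF s]] cbd_nonneg[OF gal TQ] by simp
    qed
    have "cbd K S (N + h * t) (real L * (real L * c ^ n * (real L ^ n * BQ)) * real C ^ L) X"
      using ac(1)[of i] XK XB by (simp add: cbd_def X_def)
    from cbd_of_int_mult[OF gal this, of "int \<delta>"]
    have "cbd K S (N + h * t) (real \<delta> * (real L * (real L * c ^ n * (real L ^ n * BQ)) * real C ^ L)) (A $ i $ j)"
      by (simp add: A_def X_def h_def)
    then show ?thesis
    proof (rule cbd_mono[OF gal])
      show "N + h * t \<le> N + n * t" using ht by linarith
      have "real \<delta> \<le> real (C ^ (N + M + 1))" using d(2) by (rule of_nat_mono)
      also have "\<dots> \<le> real C ^ L" unfolding of_nat_power using C1 by (intro power_increasing) (auto simp: L)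
      finally show "real \<delta> * (real L * (real L * c ^ n * (real L ^ n * BQ)) * real C ^ L) \<le> BA"
        unfolding BA_def using cbd_nonneg[OF gal TQ] by (intro mult_right_mono) auto
    qed
  qed
  have BA0: "0 \<le> BA" using cbd_nonneg[OF gal ent] .
  have detB: "cbd K S (n * (N + n * t)) (fact n * (real L * BA) ^ n) (det A)"
  proof (rule cbd_mono[OF gal cbd_det[OF gal ent, folded n_def] order_refl])
    have "N + n * t + 1 \<le> L" by (simp add: L)
    then have "real (N + n * t + 1) \<le> real L" by (rule of_nat_mono)
    then have "(real (N + n * t + 1) * BA) ^ n \<le> (real L * BA) ^ n"
      using BA0 by (intro power_mono mult_right_mono) auto
    then show "fact n * (real (N + n * t + 1) * BA) ^ n \<le> fact n * (real L * BA) ^ n"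
      by (intro mult_left_mono) auto
  qed
  obtain l where l: "fls_nth (det A) l \<noteq> 0" using detA by (auto simp: fls_eq_iff)
  define x where "x = fls_nth (det A) l"
  have "det A \<in> int_fls"
    using key[of 0 undefined undefined] by (simp add: mat_def)
  then have xi: "algebraic_int x" by (simp add: x_def int_fls_def)
  have xK: "x \<in> K" and xB: "\<And>\<sigma>. \<sigma> \<in> S \<Longrightarrow> cmod (\<sigma> x) \<le> fact n * (real L * BA) ^ n"
    using detB by (auto simp: cbd_def x_def)
  obtain q :: nat where q: "q \<ge> 1" "real q \<le> (fact n * (real L * BA) ^ n) ^ card S" "algebraic_int (of_nat q / x)"
  proof -
    have x0: "x \<noteq> 0" using l by (simp add: x_def)
    have "\<exists>q::nat. q \<ge> 1 \<and> real q \<le> (fact n * (real L * BA) ^ n) ^ card S \<and> algebraic_int (of_nat q / x)"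
      by (rule galois_norm[OF gal xK xi x0]) (rule xB)
    then show ?thesis using that by blast
  qed
  have "algebraic_int (of_nat q * fls_nth (T ^ m * iterated_matrix G m $ i $ j / fact m) k)" if m: "m \<le> s" for m i j k
  proof -
    have "pdeg (int m * int t) (T ^ m * iterated_matrix G m $ i $ j / fact m)"
      by (intro pdeg_divide_fact pdeg_power_iterated_matrix Td TG)
    from algebraic_int_fls_nth_mult[OF _ this key[OF m], of "int (n * (N + n * t))" l k] detB
    have "algebraic_int (x * fls_nth (T ^ m * iterated_matrix G m $ i $ j / fact m) k)" by (simp add: x_def cbd_def)
    from algebraic_int_mult[OF q(3) this] show ?thesis using l by (simp add: x_def)
  qed
  moreover have "(fact n * (real L * BA) ^ n) ^ card S = den_bound (card S) CARD('n) (real (t + 1) * BT) (real C) L"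
    unfolding den_bound_def BA_def BQ_def c_def n_def ..
  ultimately show ?thesis using q(1,2) by auto
qed

section \<open>Exponential growth\<close>

definition expo_bounded :: "(nat \<Rightarrow> real) \<Rightarrow> bool" where
  "expo_bounded g \<longleftrightarrow> (\<exists>C\<ge>1. \<forall>s. g s \<le> C ^ (s + 1))"

lemma expo_bounded_const: "expo_bounded (\<lambda>_. c)"
  unfolding expo_bounded_def
proof (intro exI[of _ "max 1 c"] conjI allI)
  fix s :: nat
  have "max 1 c ^ 1 \<le> max 1 c ^ (s + 1)" by (intro power_increasing) auto
  then show "c \<le> max 1 c ^ (s + 1)" by simp
qed simp

lemma expo_bounded_mult:
  assumes "expo_bounded g" "expo_bounded h" "\<And>s. 0 \<le> g s" "\<And>s. 0 \<le> h s"
  shows "expo_bounded (\<lambda>s. g s * h s)"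
proof -
  obtain C D where C: "C \<ge> 1" "\<And>s. g s \<le> C ^ (s + 1)" and D: "D \<ge> 1" "\<And>s. h s \<le> D ^ (s + 1)"
    using assms by (auto simp: expo_bounded_def)
  have "g s * h s \<le> (C * D) ^ (s + 1)" for s
    unfolding power_mult_distrib using C D assms by (intro mult_mono) auto
  moreover have "C * D \<ge> 1" using C D by (simp add: mult_ge1_I)
  ultimately show ?thesis by (auto simp: expo_bounded_def)
qed

lemma expo_bounded_power: "expo_bounded g \<Longrightarrow> (\<And>s. 0 \<le> g s) \<Longrightarrow> expo_bounded (\<lambda>s. g s ^ k)"
  by (induction k) (auto intro: expo_bounded_const expo_bounded_mult)

lemma expo_bounded_exp_linear:
  assumes "c \<ge> 1" shows "expo_bounded (\<lambda>s. c ^ (a * s + b))"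
  unfolding expo_bounded_def
proof (intro exI[of _ "c ^ (a + b)"] conjI allI)
  show "1 \<le> c ^ (a + b)" using assms by (rule one_le_power)
  show "c ^ (a * s + b) \<le> (c ^ (a + b)) ^ (s + 1)" for s
    unfolding power_mult[symmetric] using assms by (intro power_increasing) (auto simp: algebra_simps)
qed

lemma expo_bounded_linear: "expo_bounded (\<lambda>s. real (a * s + b))"
proof -
  obtain C where C: "C \<ge> 1" "\<And>s. 2 ^ (a * s + b) \<le> (C::real) ^ (s + 1)"
    using expo_bounded_exp_linear[of 2 a b] by (auto simp: expo_bounded_def)
  have "real (a * s + b) \<le> 2 ^ (a * s + b)" for s
    using of_nat_less_two_power[of "a * s + b", where 'a = real] by linarith
  then have "real (a * s + b) \<le> C ^ (s + 1)" for s using C(2)[of s] order_trans by blast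
  then show ?thesis using C(1) unfolding expo_bounded_def by blast
qed

lemma expo_bounded_den_bound:
  assumes "c \<ge> 1" "C \<ge> 1"
  shows "expo_bounded (\<lambda>s. den_bound d n c C (x * s + y))"
proof -
  have L: "expo_bounded (\<lambda>s. real (x * s + y))" by (rule expo_bounded_linear)
  have E: "expo_bounded (\<lambda>s. C ^ (x * s + y))" using assms by (intro expo_bounded_exp_linear)
  have "expo_bounded (\<lambda>s. C ^ ((2 * x) * s + 2 * y))" using assms by (intro expo_bounded_exp_linear)
  then have E2: "expo_bounded (\<lambda>s. C ^ (2 * (x * s + y)))" by (simp add: algebra_simps)
  have nn: "0 \<le> c" "0 \<le> C" using assms by auto
  show ?thesis unfolding den_bound_def
    by (intro expo_bounded_power expo_bounded_mult expo_bounded_const L E E2)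
      (use nn in \<open>auto intro!: mult_nonneg_nonneg zero_le_power\<close>)
qed

section \<open>Denominators and number fields for the data\<close>

lemma alg_polys_prod: "(\<And>i. i \<in> I \<Longrightarrow> p i \<in> alg_polys) \<Longrightarrow> prod p I \<in> alg_polys"
  by (induction I rule: infinite_finite_induct) (auto intro: alg_polys_closed)

lemma common_poly_denominator:
  assumes "finite I" "\<And>i. i \<in> I \<Longrightarrow> x i \<in> alg_ratfuns"
  shows "\<exists>D\<in>alg_polys. D \<noteq> 0 \<and> (\<forall>i\<in>I. fls_of_poly D * x i \<in> fls_of_poly ` alg_polys)"
proof -
  have "\<forall>i\<in>I. \<exists>p q. p \<in> alg_polys \<and> q \<in> alg_polys \<and> q \<noteq> 0 \<and> x i = fls_of_poly p / fls_of_poly q"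
    using assms(2) by (metis alg_ratfunsE)
  then obtain p q where pq: "\<And>i. i \<in> I \<Longrightarrow> p i \<in> alg_polys" "\<And>i. i \<in> I \<Longrightarrow> q i \<in> alg_polys"
    "\<And>i. i \<in> I \<Longrightarrow> q i \<noteq> 0" "\<And>i. i \<in> I \<Longrightarrow> x i = fls_of_poly (p i) / fls_of_poly (q i)"
    by metis
  show ?thesis
  proof (intro bexI[of _ "prod q I"] conjI ballI)
    show "prod q I \<noteq> 0" using assms(1) pq(3) by simp
    show "prod q I \<in> alg_polys" using pq(2) by (rule alg_polys_prod)
    fix i assume i: "i \<in> I"
    have "fls_of_poly (prod q I) = fls_of_poly (q i) * fls_of_poly (prod q (I - {i}))"
      using prod.remove[OF assms(1) i, of q] by (simp add: fls_of_poly_hom)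
    then have "fls_of_poly (prod q I) * x i = fls_of_poly (p i * prod q (I - {i}))"
      using pq(3,4)[OF i] by (simp add: fls_of_poly_hom fls_of_poly_eq_0)
    moreover have "p i * prod q (I - {i}) \<in> alg_polys" using pq(1,2) i by (intro alg_polys_closed alg_polys_prod) auto
    ultimately show "fls_of_poly (prod q I) * x i \<in> fls_of_poly ` alg_polys" by blast
  qed
qed

lemma least_common_denominator_exists:
  fixes G :: "complex fls ^ 'n ^ 'n"
  assumes "\<And>i j. G $ i $ j \<in> alg_ratfuns"
  shows "\<exists>T. least_common_denominator T G"
proof -
  obtain D where "D \<in> alg_polys" "D \<noteq> 0" "\<forall>ij\<in>UNIV. fls_of_poly D * (case ij of (i, j) \<Rightarrow> G $ i $ j) \<in> fls_of_poly ` alg_polys"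
    using common_poly_denominator[of "UNIV :: ('n \<times> 'n) set" "\<lambda>(i, j). G $ i $ j"] assms by auto
  then have "common_denominator D G" by (auto simp: common_denominator_def)
  then obtain T where T: "common_denominator T G" "\<And>P. common_denominator P G \<Longrightarrow> degree T \<le> degree P"
    using ex_has_least_nat[of "\<lambda>P. common_denominator P G" D degree] by blast
  have "T dvd P" if P: "common_denominator P G" for P
  proof -
    have Ta: "T \<in> alg_polys" "T \<noteq> 0" and Pa: "P \<in> alg_polys" using T(1) P by (auto simp: common_denominator_def)
    obtain q r where qr: "q \<in> alg_polys" "r \<in> alg_polys" "P = T * q + r" "r = 0 \<or> degree r < degree T"
      using polys_over_division[OF subfld_algebraic, of P T] Ta Pa unfolding alg_polys_eq[symmetric] by blast
    have "r = 0"
    proof (rule ccontr)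
      assume "r \<noteq> 0"
      have "fls_of_poly r * G $ i $ j \<in> fls_of_poly ` alg_polys" for i j
      proof -
        obtain a b where a: "a \<in> alg_polys" "fls_of_poly P * G $ i $ j = fls_of_poly a"
          and b: "b \<in> alg_polys" "fls_of_poly T * G $ i $ j = fls_of_poly b"
          using T(1) P by (auto simp: common_denominator_def image_iff) metis
        have r: "fls_of_poly r = fls_of_poly P - fls_of_poly T * fls_of_poly q" using qr(3) by (simp add: fls_of_poly_hom)
        have "fls_of_poly r * G $ i $ j = fls_of_poly P * G $ i $ j - fls_of_poly q * (fls_of_poly T * G $ i $ j)"
          unfolding r by (simp add: algebra_simps)
        also have "\<dots> = fls_of_poly (a - q * b)" unfolding a(2) b(2) by (simp add: fls_of_poly_hom)
        finally show ?thesis using a(1) b(1) qr(1) by (auto intro!: imageI alg_polys_closed)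
      qed
      then have "common_denominator r G" using qr(2) \<open>r \<noteq> 0\<close> by (simp add: common_denominator_def)
      then show False using T(2) qr(4) \<open>r \<noteq> 0\<close> by fastforce
    qed
    then show ?thesis using qr(3) by simp
  qed
  then show ?thesis using T(1) by (auto simp: least_common_denominator_def)
qed

lemma finite_algebraic_multiple:
  assumes "finite X" "\<And>x. x \<in> X \<Longrightarrow> algebraic x"
  shows "\<exists>d::nat. d \<ge> 1 \<and> (\<forall>x\<in>X. algebraic_int (of_nat d * (x :: complex)))"
  using assms
proof (induction X rule: finite_induct)
  case empty
  show ?case by (rule exI[of _ 1]) simp
next
  case (insert x X)
  then obtain d where d: "d \<ge> 1" "\<forall>x\<in>X. algebraic_int (of_nat d * x)" by auto
  obtain c where c: "c \<ge> 1" "algebraic_int (of_nat c * x)" using algebraic_times_int insert.prems by blast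
  have "algebraic_int (of_nat (c * d) * y)" if "y \<in> insert x X" for y
  proof (cases "y = x")
    case True
    have "algebraic_int (of_nat d * (of_nat c * x))" by (rule algebraic_int_mult[OF algebraic_int_of_nat c(2)])
    then show ?thesis by (simp add: True mult_ac)
  next
    case False
    then have "algebraic_int (of_nat d * y)" using d(2) that by blast
    then have "algebraic_int (of_nat c * (of_nat d * y))" by (rule algebraic_int_mult[OF algebraic_int_of_nat])
    then show ?thesis by (simp add: mult_ac)
  qed
  then show ?case using c(1) d(1) by (intro exI[of _ "c * d"]) auto
qed

lemma common_den_props:
  assumes "f \<in> alg_fps"
  shows "1 \<le> common_den f n" "k \<le> n \<Longrightarrow> algebraic_int (of_nat (common_den f n) * fps_nth f k)"
proof -
  obtain d :: nat where "d \<ge> 1" "\<forall>x\<in>fps_nth f ` {..n}. algebraic_int (of_nat d * x)"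
    using finite_algebraic_multiple[of "fps_nth f ` {..n}"] assms by (auto simp: alg_fps_def)
  then have "1 \<le> d \<and> (\<forall>k\<le>n. algebraic_int (of_nat d * fps_nth f k))" by auto
  from LeastI[of "\<lambda>d. 1 \<le> d \<and> (\<forall>k\<le>n. algebraic_int (of_nat d * fps_nth f k))", OF this]
  show "1 \<le> common_den f n" "k \<le> n \<Longrightarrow> algebraic_int (of_nat (common_den f n) * fps_nth f k)"
    unfolding common_den_def by auto
qed

lemma fls_deriv_funpow_fps_to_fls: "(fls_deriv ^^ k) (fps_to_fls f) = fps_to_fls ((fps_deriv ^^ k) f)"
  by (induction k) (auto simp: fls_deriv_fps_to_fls)

lemma coeff_mem_of_finite:
  "subfld K \<Longrightarrow> coeff p ` {..degree p} \<subseteq> K \<Longrightarrow> coeff p k \<in> K"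
  by (cases "k \<le> degree p") (auto simp: coeff_eq_0 subfld_closed)

lemma ode_coeffs_finitely_generated:
  assumes f: "f \<in> alg_fps" and ode: "solves_linear_ode f"
  shows "\<exists>X. finite X \<and> (\<forall>x\<in>X. algebraic x) \<and> (\<forall>K. subfld K \<longrightarrow> X \<subseteq> K \<longrightarrow> (\<forall>k. fps_nth f k \<in> K))"
proof -
  obtain r :: nat and c where c: "\<forall>k\<le>r. c k \<in> alg_ratfuns" "\<exists>k\<le>r. c k \<noteq> 0"
    "(\<Sum>k\<le>r. c k * fps_to_fls ((fps_deriv ^^ k) f)) = 0"
    using ode by (auto simp: solves_linear_ode_def)
  obtain D where D: "D \<in> alg_polys" "D \<noteq> 0" "\<And>k. k \<le> r \<Longrightarrow> fls_of_poly D * c k \<in> fls_of_poly ` alg_polys"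
    using common_poly_denominator[of "{..r}" c] c(1) by auto
  then have "\<forall>k. \<exists>p. k \<le> r \<longrightarrow> p \<in> alg_polys \<and> fls_of_poly D * c k = fls_of_poly p" by blast
  then obtain p where p: "\<And>k. k \<le> r \<Longrightarrow> p k \<in> alg_polys" "\<And>k. k \<le> r \<Longrightarrow> fls_of_poly D * c k = fls_of_poly (p k)"
    by metis
  define F where "F = fps_to_fls f"
  have "diffop (\<lambda>k. fls_of_poly (p k)) r F = (\<Sum>k\<le>r. fls_of_poly D * (c k * fps_to_fls ((fps_deriv ^^ k) f)))"
    unfolding diffop_def F_def fls_deriv_funpow_fps_to_fls
    by (intro sum.cong refl) (metis atMost_iff mult.assoc p(2))
  also have "\<dots> = 0" using c(3) by (simp flip: sum_distrib_left)
  finally have op: "diffop (\<lambda>k. fls_of_poly (p k)) r F = 0" .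
  have "\<exists>k\<le>r. fls_of_poly (p k) \<noteq> 0" using c(2) p(2) D(2) by (metis fls_of_poly_eq_0 mult_eq_0_iff)
  from coeffs_subfld_of_diffop[OF this] obtain m0 where m0:
    "\<forall>K v. subfld K \<longrightarrow> (\<forall>k\<le>r. \<forall>j. fls_nth (fls_of_poly (p k)) j \<in> K) \<longrightarrow>
     (\<forall>j. fls_nth (diffop (\<lambda>k. fls_of_poly (p k)) r v) j \<in> K) \<longrightarrow> (\<forall>m<m0. fls_nth v m \<in> K) \<longrightarrow> (\<forall>m. fls_nth v m \<in> K)" ..
  define X where "X = (\<Union>k\<le>r. coeff (p k) ` {..degree (p k)}) \<union> fps_nth f ` {..<nat m0}"
  have "fps_nth f k \<in> K" if K: "subfld K" "X \<subseteq> K" for K k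
  proof -
    have "coeff (p j) ` {..degree (p j)} \<subseteq> K" if "j \<le> r" for j using K(2) that by (auto simp: X_def)
    then have 1: "\<forall>j\<le>r. \<forall>l. fls_nth (fls_of_poly (p j)) l \<in> K"
      using coeff_mem_of_finite[OF K(1)] K(1) by (simp add: fls_of_poly_nth subfld_closed)
    have 2: "\<forall>j. fls_nth (diffop (\<lambda>k. fls_of_poly (p k)) r F) j \<in> K" using op K(1) by (simp add: subfld_closed)
    have 3: "\<forall>m<m0. fls_nth F m \<in> K" using K by (auto simp: F_def X_def subfld_closed)
    have "fls_nth F (int k) \<in> K" using m0 K(1) 1 2 3 by blast
    then show ?thesis by (simp add: F_def)
  qed
  moreover have "finite X" by (simp add: X_def)
  moreover have "algebraic x" if "x \<in> X" for x
    using that p(1) f by (auto simp: X_def alg_polys_def alg_fps_def)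
  ultimately show ?thesis by blast
qed

lemma G_function_sizes:
  fixes f :: "complex fps ^ 'n"
  assumes gal: "galois_field K S" and f: "\<And>i. G_function (f $ i)" and fK: "\<And>i k. fps_nth (f $ i) k \<in> K"
  shows "\<exists>C::nat. C \<ge> 1 \<and> (\<forall>i k. \<forall>\<sigma>\<in>S. cmod (\<sigma> (fps_nth (f $ i) k)) \<le> real C ^ (k + 1)) \<and>
    (\<forall>N. \<exists>\<delta>\<ge>1. \<delta> \<le> C ^ (N + 1) \<and> (\<forall>i. \<forall>k\<le>N. algebraic_int (of_nat \<delta> * fps_nth (f $ i) k)))"
proof -
  have K: "subfld K" and emb: "\<And>\<sigma>. \<sigma> \<in> S \<Longrightarrow> emb K \<sigma>" using gal by (auto simp: galois_field_def)
  have alg: "f $ i \<in> alg_fps" for i using f by (simp add: G_function_def)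
  have "\<forall>i. \<exists>C>0. \<forall>n y. galois_conjugate (fps_nth (f $ i) n) y \<longrightarrow> norm y \<le> C ^ (n + 1)"
    using f by (simp add: G_function_def)
  then obtain C1 where C1: "\<And>i. C1 i > 0" "\<And>i n y. galois_conjugate (fps_nth (f $ i) n) y \<Longrightarrow> norm y \<le> C1 i ^ (n + 1)"
    by metis
  have "\<forall>i. \<exists>C>0. \<forall>n. real (common_den (f $ i) n) \<le> C ^ (n + 1)"
    using f by (simp add: G_function_def)
  then obtain C2 where C2: "\<And>i. C2 i > 0" "\<And>i n. real (common_den (f $ i) n) \<le> C2 i ^ (n + 1)"
    by metis
  define C where "C = nat \<lceil>1 + prod C2 UNIV + sum C1 UNIV\<rceil>"
  have p0: "prod C2 UNIV \<ge> 0" "sum C1 UNIV \<ge> 0"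
    using C1(1) C2(1) by (simp_all add: prod_nonneg sum_nonneg less_imp_le)
  have Cge: "real C \<ge> 1 + prod C2 UNIV + sum C1 UNIV" unfolding C_def by (rule real_nat_ceiling_ge)
  then have "real C \<ge> 1" using p0 by linarith
  then have "C \<ge> 1" by simp
  moreover have "cmod (\<sigma> (fps_nth (f $ i) k)) \<le> real C ^ (k + 1)" if "\<sigma> \<in> S" for i k \<sigma>
  proof -
    have "algebraic (fps_nth (f $ i) k)" using alg by (simp add: alg_fps_def)
    then have "cmod (\<sigma> (fps_nth (f $ i) k)) \<le> C1 i ^ (k + 1)"
      using galois_conjugate_emb[OF K emb[OF that] fK] C1(2) by blast
    also have "\<dots> \<le> real C ^ (k + 1)"
    proof (rule power_mono)
      have "C1 i \<le> sum C1 UNIV" using C1(1) by (intro member_le_sum) (auto intro: less_imp_le)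
      then show "C1 i \<le> real C" using Cge p0 by linarith
      show "0 \<le> C1 i" using C1(1)[of i] by simp
    qed
    finally show ?thesis .
  qed
  moreover have "\<exists>\<delta>\<ge>1. \<delta> \<le> C ^ (N + 1) \<and> (\<forall>i. \<forall>k\<le>N. algebraic_int (of_nat \<delta> * fps_nth (f $ i) k))" for N
  proof (intro exI[of _ "\<Prod>i\<in>UNIV. common_den (f $ i) N"] conjI allI impI)
    show "1 \<le> (\<Prod>i\<in>UNIV. common_den (f $ i) N)"
      using common_den_props(1)[OF alg] by (intro prod_ge_1) auto
    have "real (\<Prod>i\<in>UNIV. common_den (f $ i) N) \<le> (\<Prod>i\<in>UNIV. C2 i ^ (N + 1))"
      unfolding of_nat_prod using C2(2) by (intro prod_mono) auto
    also have "\<dots> = prod C2 UNIV ^ (N + 1)" by (rule prod_power_distrib[symmetric])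
    also have "\<dots> \<le> real C ^ (N + 1)" using Cge p0 by (intro power_mono) auto
    finally show "(\<Prod>i\<in>UNIV. common_den (f $ i) N) \<le> C ^ (N + 1)" by (simp flip: of_nat_power add: of_nat_le_iff[where 'a = real, symmetric] del: of_nat_le_iff of_nat_prod)
    fix i k assume "k \<le> N"
    then have i: "algebraic_int (of_nat (common_den (f $ i) N) * fps_nth (f $ i) k)" by (rule common_den_props(2)[OF alg])
    have e: "(\<Prod>i\<in>UNIV. common_den (f $ i) N) = (\<Prod>i\<in>UNIV - {i}. common_den (f $ i) N) * common_den (f $ i) N"
      by (subst prod.remove[of UNIV i]) (auto simp: mult.commute)
    show "algebraic_int (of_nat (\<Prod>i\<in>UNIV. common_den (f $ i) N) * fps_nth (f $ i) k)"
      unfolding e of_nat_mult mult.assoc by (rule algebraic_int_mult[OF algebraic_int_of_nat i])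
  qed
  ultimately show ?thesis by blast
qed

lemma cbd_exists:
  assumes gal: "galois_field K S" and g: "pdeg (int e) g" "\<And>k. fls_nth g k \<in> K"
  shows "\<exists>B\<ge>1. cbd K S e B g"
proof -
  define B where "B = 1 + (\<Sum>\<sigma>\<in>S. \<Sum>k\<in>{0..int e}. cmod (\<sigma> (fls_nth g k)))"
  have fin: "finite S" using gal by (simp add: galois_field_def)
  have nn: "0 \<le> (\<Sum>\<sigma>\<in>S. \<Sum>k\<in>{0..int e}. cmod (\<sigma> (fls_nth g k)))" by (intro sum_nonneg) auto
  have "cmod (\<sigma> (fls_nth g k)) \<le> B" if s: "\<sigma> \<in> S" for \<sigma> k
  proof (cases "k \<in> {0..int e}")
    case True
    then have "cmod (\<sigma> (fls_nth g k)) \<le> (\<Sum>k\<in>{0..int e}. cmod (\<sigma> (fls_nth g k)))"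
      using member_le_sum[of k "{0..int e}" "\<lambda>k. cmod (\<sigma> (fls_nth g k))"] by simp
    also have "\<dots> \<le> (\<Sum>\<sigma>\<in>S. \<Sum>k\<in>{0..int e}. cmod (\<sigma> (fls_nth g k)))"
      using member_le_sum[of \<sigma> S "\<lambda>\<sigma>. \<Sum>k\<in>{0..int e}. cmod (\<sigma> (fls_nth g k))"] s fin by (simp add: sum_nonneg)
    finally show ?thesis by (simp add: B_def)
  next
    case False
    then have "fls_nth g k = 0" using g(1) by (auto simp: pdeg_def)
    then show ?thesis using nn emb_0[OF gal_K[OF gal] gal_emb[OF gal s]] by (simp add: B_def)
  qed
  then show ?thesis using g nn by (intro exI[of _ B]) (auto simp: cbd_def B_def)
qed

lemma rf_vec_exists:
  assumes "\<And>i. pdeg (int N) (P $ i)" "\<And>i k. algebraic (fls_nth (P $ i) k)"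
  shows "\<exists>P'. P = rf_vec P'"
proof -
  have "\<exists>r. rf r = P $ i" for i
  proof -
    obtain p where p: "P $ i = fls_of_poly p" using pdeg_imp_poly assms(1) by blast
    have "coeff p k = fls_nth (P $ i) (int k)" for k by (simp add: p fls_of_poly_nth)
    then have "p \<in> alg_polys" using assms(2) by (simp add: alg_polys_def)
    then show ?thesis using alg_ratfuns_of_poly rf_exists p by metis
  qed
  then obtain r where "\<And>i. rf (r i) = P $ i" by metis
  then show ?thesis by (intro exI[of _ "\<chi> i. r i"]) (simp add: rf_vec_def vec_eq_iff)
qed

section \<open>Growth of the Galochkin denominators\<close>

lemma galochkin_den_bounded:
  fixes f :: "complex fps ^ 'n" and G :: "complex fls ^ 'n ^ 'n"
  assumes G: "\<And>i j. G $ i $ j \<in> alg_ratfuns"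
    and sys: "(\<chi> i. fps_to_fls (fps_deriv (f $ i))) = G *v (\<chi> i. fps_to_fls (f $ i))"
    and Gf: "\<And>i. G_function (f $ i)" and indep: "lin_indep_ratfuns f"
    and T: "common_denominator T G"
  shows "expo_bounded (\<lambda>s. real (galochkin_den T G s))"
proof -
  define n where "n = CARD('n)"
  define F where "F = (\<chi> i. fps_to_fls (f $ i))"
  have F0: "ordge 0 (F $ i)" for i by (simp add: F_def ordge_def)
  have alg: "f $ i \<in> alg_fps" for i using Gf by (simp add: G_function_def)
  have Fn: "fls_nth (F $ i) k = (if k < 0 then 0 else fps_nth (f $ i) (nat k))" for i k by (simp add: F_def)
  have Falg: "algebraic (fls_nth (F $ i) k)" for i k using alg by (auto simp: Fn alg_fps_def)
  have nF: "nabla G F = 0"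
    using sys by (simp add: nabla_def vderiv_def F_def fls_deriv_fps_to_fls)
  have "\<forall>i j. \<exists>r. rf r = G $ i $ j" using G rf_exists by blast
  then obtain H0 where H0: "\<And>i j. rf (H0 i j) = G $ i $ j" by metis
  define H where "H = (\<chi> i j. H0 i j)"
  have HG: "rf_mat H = G" by (simp add: rf_mat_def H_def H0 vec_eq_iff)
  have inj: "l = 0" if "linform F l = 0" for l
  proof -
    have "(\<Sum>i\<in>UNIV. rf (l $ i) * fps_to_fls (f $ i)) = 0" using that by (simp add: linform_def F_def)
    then have "(\<forall>i. rf (l $ i) \<in> alg_ratfuns) \<and> (\<Sum>i\<in>UNIV. rf (l $ i) * fps_to_fls (f $ i)) = 0"
      by (intro conjI allI rf)
    with indep[unfolded lin_indep_ratfuns_def, THEN spec, of "\<lambda>i. rf (l $ i)"]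
    have "\<forall>i. rf (l $ i) = 0" by (rule mp)
    then show ?thesis by (simp add: vec_eq_iff)
  qed
  have "\<exists>b. \<forall>N M Q P T e. Q \<noteq> 0 \<longrightarrow> fls_subdegree Q \<le> N \<longrightarrow> (\<forall>i. ordge (N + M + 1) (Q * F $ i - rf (P $ i))) \<longrightarrow>
     b \<le> M \<longrightarrow> T \<noteq> 0 \<longrightarrow> bij_betw e UNIV {..<CARD('n)} \<longrightarrow>
     det (\<chi> i j. T ^ e j * nabla_divided G (e j) (rf_vec P) $ i) \<noteq> 0"
    by (rule approximant_det_nonzero[where G = H and f = F, unfolded HG, OF nF _ Falg]) (rule inj)
  then obtain b where b: "\<forall>N M Q P T e. Q \<noteq> 0 \<longrightarrow> fls_subdegree Q \<le> N \<longrightarrow> (\<forall>i. ordge (N + M + 1) (Q * F $ i - rf (P $ i))) \<longrightarrow>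
     b \<le> M \<longrightarrow> T \<noteq> 0 \<longrightarrow> bij_betw e UNIV {..<CARD('n)} \<longrightarrow>
     det (\<chi> i j. T ^ e j * nabla_divided G (e j) (rf_vec P) $ i) \<noteq> 0" ..
  have TA: "T \<in> alg_polys" "T \<noteq> 0" "\<And>i j. fls_of_poly T * G $ i $ j \<in> fls_of_poly ` alg_polys"
    using T by (auto simp: common_denominator_def)
  then have "\<forall>i j. \<exists>a. fls_of_poly T * G $ i $ j = fls_of_poly a" by blast
  then obtain A where A: "\<And>i j. fls_of_poly T * G $ i $ j = fls_of_poly (A i j)" by metis
  define t where "t = degree T + (\<Sum>i\<in>UNIV. \<Sum>j\<in>UNIV. degree (A i j))"
  have "\<forall>i. \<exists>X. finite X \<and> (\<forall>x\<in>X. algebraic x) \<and> (\<forall>K. subfld K \<longrightarrow> X \<subseteq> K \<longrightarrow> (\<forall>k. fps_nth (f $ i) k \<in> K))"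
    using ode_coeffs_finitely_generated[OF alg] Gf by (simp add: G_function_def)
  then obtain X where X: "\<And>i. finite (X i)" "\<And>i x. x \<in> X i \<Longrightarrow> algebraic x"
    "\<And>i K k. subfld K \<Longrightarrow> X i \<subseteq> K \<Longrightarrow> fps_nth (f $ i) k \<in> K" by metis
  define XT where "XT = coeff T ` {..degree T}"
  have XT: "finite XT" "\<And>x. x \<in> XT \<Longrightarrow> algebraic x" using TA(1) by (auto simp: XT_def alg_polys_def)
  have finX: "finite (XT \<union> (\<Union>i. X i))" using X(1) XT by auto
  have algX: "algebraic x" if "x \<in> XT \<union> (\<Union>i. X i)" for x using that XT(2) X(2) by blast
  have "\<exists>K S. galois_field K S \<and> XT \<union> (\<Union>i. X i) \<subseteq> K"
    by (rule galois_field_exists[OF finX]) (rule algX)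
  then obtain K S where "galois_field K S \<and> XT \<union> (\<Union>i. X i) \<subseteq> K" by (elim exE) (rule that)
  then have gal: "galois_field K S" and KX: "XT \<union> (\<Union>i. X i) \<subseteq> K" by simp_all
  have K: "subfld K" and Kalg: "\<And>x. x \<in> K \<Longrightarrow> algebraic x" using gal by (auto simp: galois_field_def)
  have fK: "fps_nth (f $ i) k \<in> K" for i k
    by (rule X(3)[OF K]) (use KX in blast)
  then have FK: "fls_nth (F $ i) k \<in> K" for i k using K by (simp add: Fn subfld_closed)
  obtain \<tau> :: nat where tau: "\<tau> \<ge> 1" "\<And>x. x \<in> XT \<Longrightarrow> algebraic_int (of_nat \<tau> * x)"
    using finite_algebraic_multiple[OF XT] by blast
  define T0 where "T0 = of_nat \<tau> * fls_of_poly T"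
  have T0n: "fls_nth T0 k = of_nat \<tau> * (if k < 0 then 0 else coeff T (nat k))" for k
    by (simp add: T0_def fls_of_nat fls_of_poly_nth)
  have T0d: "pdeg (int t) T0"
  proof (rule pdeg_mono)
    show "pdeg (0 + int (degree T)) T0" unfolding T0_def by (rule pdeg_mult[OF pdeg_closed(4) pdeg_fls_of_poly])
    have "degree T \<le> t" by (simp add: t_def)
    then show "0 + int (degree T) \<le> int t" by simp
  qed
  have TGd: "pdeg (int t) (T0 * G $ i $ j)" for i j
  proof (rule pdeg_mono)
    have "T0 * G $ i $ j = of_nat \<tau> * fls_of_poly (A i j)" by (simp add: T0_def A[symmetric] mult.assoc)
    then show "pdeg (0 + int (degree (A i j))) (T0 * G $ i $ j)" by (simp only: pdeg_mult[OF pdeg_closed(4) pdeg_fls_of_poly])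
    have "degree (A i j) \<le> (\<Sum>j\<in>UNIV. degree (A i j))" by (rule member_le_sum) auto
    also have "\<dots> \<le> (\<Sum>i\<in>UNIV. \<Sum>j\<in>UNIV. degree (A i j))"
      by (rule member_le_sum[of i UNIV "\<lambda>i. \<Sum>j\<in>UNIV. degree (A i j)"]) auto
    finally have "degree (A i j) \<le> t" by (simp add: t_def)
    then show "0 + int (degree (A i j)) \<le> int t" by simp
  qed
  have T0K: "fls_nth T0 k \<in> K" for k
    using coeff_mem_of_finite[OF K, of T] KX K by (auto simp: T0n XT_def intro!: subfld_closed(4) subfld_of_nat subfld_closed(1))
  have T0i: "T0 \<in> int_fls"
    unfolding int_fls_def
  proof (intro CollectI allI)
    fix k
    have "algebraic_int (of_nat \<tau> * coeff T l)" for l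
      using tau(2)[of "coeff T l"] by (cases "l \<le> degree T") (auto simp: XT_def coeff_eq_0)
    then show "algebraic_int (fls_nth T0 k)" by (simp add: T0n)
  qed
  have T00: "T0 \<noteq> 0" using tau(1) TA(2) by (simp add: T0_def fls_of_poly_eq_0)
  obtain BT where BT: "BT \<ge> 1" "cbd K S t BT T0" using cbd_exists[OF gal T0d T0K] by blast
  obtain C :: nat where C: "C \<ge> 1 \<and> (\<forall>i k. \<forall>\<sigma>\<in>S. cmod (\<sigma> (fps_nth (f $ i) k)) \<le> real C ^ (k + 1)) \<and>
    (\<forall>N. \<exists>\<delta>\<ge>1. \<delta> \<le> C ^ (N + 1) \<and> (\<forall>i. \<forall>k\<le>N. algebraic_int (of_nat \<delta> * fps_nth (f $ i) k)))"
    using G_function_sizes[OF gal Gf fK] by (elim exE) (rule that)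
  note C1 = conjunct1[OF C] and C2 = conjunct1[OF conjunct2[OF C]] and C3 = conjunct2[OF conjunct2[OF C]]
  have FC: "cmod (\<sigma> (fls_nth (F $ i) (int k))) \<le> real C ^ (k + 1)" if "\<sigma> \<in> S" for i k \<sigma>
    using C2[rule_format, OF that, of i k] by (simp add: Fn)
  have den: "\<exists>\<delta>\<ge>1. \<delta> \<le> C ^ (N + 1) \<and> (\<forall>i k. k \<le> int N \<longrightarrow> algebraic_int (of_nat \<delta> * fls_nth (F $ i) k))" for N
  proof -
    obtain \<delta> where "\<delta> \<ge> 1" "\<delta> \<le> C ^ (N + 1)" "\<forall>i. \<forall>k\<le>N. algebraic_int (of_nat \<delta> * fps_nth (f $ i) k)"
      using C3[rule_format, of N] by (elim exE conjE) (rule that)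
    then show ?thesis by (intro exI[of _ \<delta>]) (auto simp: Fn)
  qed
  define u where "u = 4 * card S * n + 1"
  define x where "x = u * (t + 1)"
  define y where "y = u * (n * (t + 1) + nat b) + n * t"
  have step: "\<exists>q::nat. 1 \<le> q \<and> real q \<le> den_bound (card S) n (real (t + 1) * BT) (real C) (x * s + y) \<and>
    (\<forall>m\<le>s. \<forall>i j k. algebraic_int (of_nat q * fls_nth (T0 ^ m * iterated_matrix G m $ i $ j / fact m) k))" for s
  proof -
    define M where "M = (s + n) * (t + 1) + nat b"
    have "nat b \<le> M" by (simp add: M_def)
    then have Mb: "b \<le> int M" by linarith
    have sM: "(s + CARD('n)) * (t + 1) \<le> M" by (simp add: M_def n_def)
    have nonvan: "det (\<chi> i j. T0 ^ e j * nabla_divided G (e j) P $ i) \<noteq> 0"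
      if Q: "Q \<noteq> 0" "pdeg (int N) Q" and P: "\<And>i. pdeg (int N) (P $ i)" "\<And>i k. fls_nth (P $ i) k \<in> K"
        and R: "\<And>i. ordge (int (N + M + 1)) (Q * F $ i - P $ i)" and e: "bij_betw e UNIV {..<CARD('n)}"
      for N :: nat and Q P and e :: "'n \<Rightarrow> nat"
    proof -
      obtain P' where P': "P = rf_vec P'" using rf_vec_exists[OF P(1)] P(2) Kalg by blast
      have "fls_nth Q (fls_subdegree Q) \<noteq> 0" using Q(1) by simp
      then have sd: "fls_subdegree Q \<le> int N" using Q(2) unfolding pdeg_def by blast
      have ord: "\<forall>i. ordge (int N + int M + 1) (Q * F $ i - rf (P' $ i))" using R by (simp add: P' rf_vec_def add_ac)
      show ?thesis unfolding P' using b Q(1) sd ord Mb T00 e by blast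
    qed
    have "4 * card S * CARD('n) * M + M + CARD('n) * t = x * s + y"
      by (simp add: M_def x_def y_def u_def n_def algebra_simps)
    moreover have "\<exists>q::nat. 1 \<le> q \<and>
      real q \<le> den_bound (card S) CARD('n) (real (t + 1) * BT) (real C) (4 * card S * CARD('n) * M + M + CARD('n) * t) \<and>
      (\<forall>m\<le>s. \<forall>i j k. algebraic_int (of_nat q * fls_nth (T0 ^ m * iterated_matrix G m $ i $ j / fact m) k))"
    proof (rule iterated_matrix_denominator[OF gal nF F0 FK _ C1 den BT(2) T0i BT(1) TGd _ sM])
      show "cmod (\<sigma> (fls_nth (F $ i) (int k))) \<le> real C ^ (k + 1)" if "\<sigma> \<in> S" for i k \<sigma>
        using that by (rule FC)
      show "det (\<chi> i j. T0 ^ e j * nabla_divided G (e j) P $ i) \<noteq> 0"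
        if "Q \<noteq> 0" "pdeg (int N) Q" "\<And>i. pdeg (int N) (P $ i)" "\<And>i k. fls_nth (P $ i) k \<in> K"
          "\<And>i. ordge (int (N + M + 1)) (Q * F $ i - P $ i)" "bij_betw e UNIV {..<CARD('n)}"
        for N :: nat and Q P and e :: "'n \<Rightarrow> nat"
        using that by (rule nonvan)
    qed
    ultimately show ?thesis by (simp only: n_def)
  qed
  have bound: "real (galochkin_den T G s) \<le> den_bound (card S) n (real (t + 1) * BT) (real C) (x * s + y) * real \<tau> ^ (1 * s + 0)" for s
  proof -
    obtain q :: nat where q: "1 \<le> q" "real q \<le> den_bound (card S) n (real (t + 1) * BT) (real C) (x * s + y)"
      "\<And>m i j k. m \<le> s \<Longrightarrow> algebraic_int (of_nat q * fls_nth (T0 ^ m * iterated_matrix G m $ i $ j / fact m) k)"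
      using step[of s] by blast
    have "algebraic_int (of_nat (q * \<tau> ^ s) * fls_nth (fls_of_poly T ^ m * (iterated_matrix G m $ i $ j / fact m)) k)"
      if "m \<in> {1..s}" for m i j k
    proof -
      have "T0 ^ m * iterated_matrix G m $ i $ j / fact m = of_nat (\<tau> ^ m) * (fls_of_poly T ^ m * (iterated_matrix G m $ i $ j / fact m))"
        by (simp add: T0_def power_mult_distrib mult.assoc)
      then have "fls_nth (T0 ^ m * iterated_matrix G m $ i $ j / fact m) k
          = of_nat (\<tau> ^ m) * fls_nth (fls_of_poly T ^ m * (iterated_matrix G m $ i $ j / fact m)) k"
        by (simp only: fls_of_nat fls_mult_const_nth(1))
      then have "algebraic_int (of_nat q * (of_nat (\<tau> ^ m) * fls_nth (fls_of_poly T ^ m * (iterated_matrix G m $ i $ j / fact m)) k))"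
        using q(3)[of m i j k] that by simp
      then have e: "algebraic_int (of_nat (\<tau> ^ (s - m)) *
          (of_nat q * (of_nat (\<tau> ^ m) * fls_nth (fls_of_poly T ^ m * (iterated_matrix G m $ i $ j / fact m)) k)))"
        by (rule algebraic_int_mult[OF algebraic_int_of_nat])
      have "q * \<tau> ^ s = \<tau> ^ (s - m) * (q * \<tau> ^ m)" using that by (simp flip: power_add)
      then show ?thesis using e by (simp only: of_nat_mult mult.assoc)
    qed
    then have "galochkin_den T G s \<le> q * \<tau> ^ s"
      unfolding galochkin_den_def using q(1) tau(1) by (intro Least_le) auto
    then have "real (galochkin_den T G s) \<le> real (q * \<tau> ^ s)" by (rule of_nat_mono)
    also have "\<dots> \<le> den_bound (card S) n (real (t + 1) * BT) (real C) (x * s + y) * real \<tau> ^ (1 * s + 0)"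
      using q(2) by (auto intro!: mult_right_mono)
    finally show ?thesis .
  qed
  have "real (t + 1) * BT \<ge> 1" using BT(1) by (simp add: mult_ge1_I)
  then have eb: "expo_bounded (\<lambda>s. den_bound (card S) n (real (t + 1) * BT) (real C) (x * s + y) * real \<tau> ^ (1 * s + 0))"
    using C1 tau(1) BT(1)
    by (intro expo_bounded_mult expo_bounded_den_bound expo_bounded_exp_linear)
      (auto simp: den_bound_def intro!: mult_nonneg_nonneg zero_le_power)
  then show ?thesis unfolding expo_bounded_def using bound by (meson order_trans)
qed

theorem mainTheorem2:
  fixes f :: "complex fps ^ 'n" and G :: "complex fls ^ 'n ^ 'n"
  assumes "\<And>i. f $ i \<in> alg_fps"
    and "\<And>i j. G $ i $ j \<in> alg_ratfuns"
    and "(\<chi> i. fps_to_fls (fps_deriv (f $ i))) = G *v (\<chi> i. fps_to_fls (f $ i))"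
    and "\<And>i. G_function (f $ i)"
    and "lin_indep_ratfuns f"
  shows "galochkin_condition G"
  unfolding galochkin_condition_def
proof (intro conjI allI impI)
  show "\<exists>T. least_common_denominator T G" using assms(2) by (rule least_common_denominator_exists)
  fix T assume "least_common_denominator T G"
  then have "expo_bounded (\<lambda>s. real (galochkin_den T G s))"
    using galochkin_den_bounded[OF assms(2-5)] by (simp add: least_common_denominator_def)
  then obtain C where "C \<ge> 1" "\<forall>s. real (galochkin_den T G s) \<le> C ^ (s + 1)" by (auto simp: expo_bounded_def)
  then show "\<exists>C>0. \<forall>s. real (galochkin_den T G s) \<le> C ^ (s + 1)" by (intro exI[of _ C]) auto
qed

end
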